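(* Let $X=X_\Delta$ be a smooth compact toric variety of complex dimension $n$ associated with a fan $\Delta$ in $N_{\mathbb{R}}$, and let $(\mathcal{A}_\Delta,\wedge,[\,,])$ be the Gerstenhaber algebra of holomorphic polyvector fields on $X_\Delta$. (1) A BV operator of the Gerstenhaber algebra $(\mathcal{A}_\Delta,\wedge,[\,,])$ exists if and only if $$\bigcap_{I\in S_\Delta}\hat F_I(\Delta)\neq\varnothing .$$ (2) If $\bigcap_{I\in S_\Delta}\hat F_I(\Delta)\neq\varnothing$, then for any choice of element $\delta\in\bigcap_{I\in S_\Delta}\hat F_I(\Delta)$, the degree $-1$ $\mathbb{C}$-linear operator $D:\mathcal{A}_\Delta\to\mathcal{A}_\Delta$ (so $D=0$ on $\mathcal{A}^0_\Delta$) given by $$D(\chi^I\cdot\rho(A))=\chi^I\cdot\rho(\imath_{\delta-I}A)$$ for all $1\le k\le n$, $I\in S_k(\Delta)$, $A\in N_I^k(\Delta)$ (i.e. for all $\chi^I\cdot\rho(A)\in V_I^k(\Delta)$) is well defined and is a BV operator of $(\mathcal{A}_\Delta,\wedge,[\,,])$. (3) Every BV operator of the Gerstenhaber algebra $(\mathcal{A}_\Delta,\wedge,[\,,])$ is of the form given in (2) for some $\delta\in\bigcap_{I\in S_\Delta}\hat F_I(\Delta)$.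
   Context: Toric setting. $T=(\mathbb{C}^* )^n$, $N=\mathrm{Hom}(\mathbb{C}^*,T)\cong\mathbb{Z}^n$, $M=\mathrm{Hom}(T,\mathbb{C}^* )\cong\mathrm{Hom}_{\mathbb{Z}}(N,\mathbb{Z})$ (algebraic group homomorphisms); $N_{\mathbb{R}},M_{\mathbb{R}},N_{\mathbb{C}},M_{\mathbb{C}}$ are the tensor products over $\mathbb{Z}$ with $\mathbb{R}$, $\mathbb{C}$, and $\langle\,,\rangle$ is the natural pairing. $X=X_\Delta$ is the smooth compact toric variety of the fan $\Delta$ in $N_{\mathbb{R}}$; $m\in M$ gives a character $\chi^m$, regarded as a rational function on $X$. The map $\rho:N_{\mathbb{C}}\cong\mathrm{Lie}(T)\to H^0(X,\mathcal{T}_X)$ is the infinitesimal action, determined by $\rho(x)(\chi^m)=\langle x,m\rangle\chi^m$; it is extended to $\rho:\wedge^kN_{\mathbb{C}}\to H^0(X,\wedge^k\mathcal{T}_X)$ by $\rho(x_1\wedge\dots\wedge x_k)=\rho(x_1)\wedge\dots\wedge\rho(x_k)$ (injective; identity of $\mathbb{C}$ for $k=0$). Polytope. Let $\Delta(1)=\{\alpha_1,\dots,\alpha_r\}$ be the one-dimensional cones, $e(\alpha_t)\in N$ the primitive generator of $\alpha_t\cap N$, $P_\Delta=\{I\in M_{\mathbb{R}}: \langle I,e(\alpha_t)\rangle\ge-1,\ 1\le t\le r\}$ (a compact polytope), and $S_\Delta=M\cap P_\Delta$. For $0\le i\le n$, $S(\Delta,i)$ is the set of $I\in M$ lying in the relative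 interior of some $(n-i)$-dimensional face of $P_\Delta$, and $S_k(\Delta)=\bigcup_{0\le i\le k}S(\Delta,i)$. For $I\in S_\Delta$, $F_I(\Delta)$ is the unique face of $P_\Delta$ whose relative interior contains $I$; $F_I^\perp(\Delta)\subseteq N_{\mathbb{R}}$ is the real span of all $e(\alpha_t)$ with $\langle I,e(\alpha_t)\rangle=-1$ (zero if there are none); it has dimension $i$ if $I\in S(\Delta,i)$. $\hat F_I(\Delta)$ is the smallest complex affine subspace of $M_{\mathbb{C}}$ containing $F_I(\Delta)\subset M_{\mathbb{R}}\subset M_{\mathbb{C}}$; equivalently $\hat F_I(\Delta)=\{I+\alpha:\alpha\in(F_I^\perp(\Delta)\otimes\mathbb{C})^\perp\}$, where $(\cdot)^\perp\subseteq M_{\mathbb{C}}$ denotes the annihilator of a subspace of $N_{\mathbb{C}}$. Weight spaces. For $I\in S(\Delta,i)$ put $N_I^k(\Delta)=\wedge^i(F_I^\perp(\Delta)\otimes\mathbb{C})\wedge(\wedge^{k-i}N_{\mathbb{C}})$ if $0<i\le k$, $N_I^k(\Delta)=\wedge^kN_{\mathbb{C}}$ if $i=0$, and $N_I^k(\Delta)=0$ if $i>k$. Put $V_I^k(\Delta)=\{\chi^I\cdot\rho(A):A\in N_I^k(\Delta)\}$, a space of meromorphic $k$-vector fields. For $I\in S_k(\Delta)$ these have removable singularities and are identified with the corresponding holomorphic $k$-vector fields; it is known that $H^0(X,\wedge^k\mathcal{T}_X)=\bigoplus_{I\in S_k(\Delta)}V_I^k(\Delta)$ for $0\le k\le n$.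 Gerstenhaber algebra. $\mathcal{A}_\Delta=\bigoplus_{k\in\mathbb{Z}}\mathcal{A}^k_\Delta$ with $\mathcal{A}^k_\Delta=H^0(X,\wedge^k\mathcal{T}_X)$ for $0\le k\le n$ (so $\mathcal{A}^0_\Delta=\mathbb{C}$) and $\mathcal{A}^k_\Delta=0$ otherwise; the product is the wedge product and the bracket is the Schouten bracket, with sign convention such that for $\chi^I\cdot\rho(A_I)\in V_I^k(\Delta)$ and $\chi^J\cdot\rho(A_J)\in V_J^l(\Delta)$: $(\chi^I\rho(A_I))\wedge(\chi^J\rho(A_J))=\chi^{I+J}\rho(A_I\wedge A_J)$ and $[\chi^I\rho(A_I),\chi^J\rho(A_J)]=(-1)^{k+1}\chi^{I+J}\rho\big((\imath_JA_I)\wedge A_J+(-1)^kA_I\wedge(\imath_IA_J)\big)$. Here $\imath_\alpha$ for $\alpha\in M_{\mathbb{C}}$ is contraction on $\wedge^\bullet N_{\mathbb{C}}$, i.e. the degree $-1$ graded derivation with $\imath_\alpha x=\langle\alpha,x\rangle$ for $x\in N_{\mathbb{C}}$. BV operator. A BV operator (generating operator) of $(\mathcal{A}_\Delta,\wedge,[\,,])$ is a degree $-1$ $\mathbb{C}$-linear operator $D:\mathcal{A}_\Delta\to\mathcal{A}_\Delta$ such that $[a,b]=(-1)^{|a|}\big(D(a\wedge b)-D(a)\wedge b-(-1)^{|a|}a\wedge D(b)\big)$ for all (homogeneous) $a,b\in\mathcal{A}_\Delta$, and $D^2=0$. *)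

theory Defs
  imports "HOL-Analysis.Analysis"
begin

section \<open>Lattices and their scalar extensions\<close>

text \<open>
  The torus is \<open>T = (\<complex>\<^sup>*)\<^sup>n\<close> with \<open>n = CARD('n)\<close>. Its coordinates identify both \<open>N\<close> and \<open>M\<close> with
  \<^typ>\<open>int ^ 'n\<close>, the pairing being the coordinatewise dot product; the real and complex
  extensions are \<^typ>\<open>real ^ 'n\<close> and \<^typ>\<open>complex ^ 'n\<close>. The linear order on the index type
  only fixes the order of the coordinates, which the signs in the exterior algebra need.
\<close>

type_synonym 'n ivec = "(int, 'n) vec"
type_synonym 'n rvec = "(real, 'n) vec"
type_synonym 'n cvec = "(complex, 'n) vec"

definition real_of_lattice :: "'n::finite ivec \<Rightarrow> 'n rvec" where
  "real_of_lattice v = (\<chi> i. of_int (v $ i))"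

definition cplx_of_lattice :: "'n::finite ivec \<Rightarrow> 'n cvec" where
  "cplx_of_lattice v = (\<chi> i. of_int (v $ i))"

definition cplx_of_real :: "'n::finite rvec \<Rightarrow> 'n cvec" where
  "cplx_of_real v = (\<chi> i. of_real (v $ i))"

definition complexify :: "'n::finite rvec set \<Rightarrow> 'n cvec set" where
  "complexify W = vec.span (cplx_of_real ` W)"

definition complex_affine :: "'n::finite cvec set \<Rightarrow> bool" where
  "complex_affine S \<longleftrightarrow> (\<forall>x\<in>S. \<forall>y\<in>S. \<forall>u v. u + v = 1 \<longrightarrow> u *s x + v *s y \<in> S)"

section \<open>Exterior algebra\<close>

text \<open>
  With \<open>e\<^sub>1, \<dots>, e\<^sub>n\<close> the standard basis of \<^typ>\<open>complex ^ 'n\<close>, an element of its exterior algebra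
  is the family of its coefficients with respect to the basis
  \<open>e\<^sub>K = e\<^bsub>i\<^sub>1\<^esub> \<and> \<dots> \<and> e\<^bsub>i\<^sub>p\<^esub>\<close>, where \<open>K = {i\<^sub>1 < \<dots> < i\<^sub>p}\<close>.
\<close>

type_synonym 'n ext = "complex ^ ('n set)"

text \<open>The sign with \<open>e\<^sub>K \<and> e\<^sub>L = shuffle_sign K L \<cdot> e\<^bsub>K \<union> L\<^esub>\<close> for disjoint \<open>K\<close> and \<open>L\<close>.\<close>

definition shuffle_sign :: "'n::{finite,linorder} set \<Rightarrow> 'n set \<Rightarrow> complex" where
  "shuffle_sign K L = (- 1) ^ card {(i, j). i \<in> K \<and> j \<in> L \<and> j < i}"

definition wedge :: "'n::{finite,linorder} ext \<Rightarrow> 'n ext \<Rightarrow> 'n ext"  (infixr \<open>\<and>\<^sub>e\<close> 70) where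
  "A \<and>\<^sub>e B = (\<chi> K. \<Sum>L\<in>Pow K. shuffle_sign L (K - L) * A $ L * B $ (K - L))"

definition ext_vector :: "'n::{finite,linorder} cvec \<Rightarrow> 'n ext" where
  "ext_vector x = (\<chi> K. \<Sum>i\<in>UNIV. if K = {i} then x $ i else 0)"

definition wedge_list :: "'n::{finite,linorder} cvec list \<Rightarrow> 'n ext" where
  "wedge_list xs = foldr (\<lambda>x A. ext_vector x \<and>\<^sub>e A) xs (axis {} 1)"

text \<open>The \<open>k\<close>-th exterior power of a complex subspace \<open>W\<close>, inside the exterior algebra.\<close>

definition ext_power :: "'n::{finite,linorder} cvec set \<Rightarrow> nat \<Rightarrow> 'n ext set" where
  "ext_power W k = vec.span {wedge_list xs |xs. length xs = k \<and> set xs \<subseteq> W}"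

text \<open>
  The algebra homomorphism \<open>x\<^sub>1 \<and> \<dots> \<and> x\<^sub>k \<mapsto> L x\<^sub>1 \<and> \<dots> \<and> L x\<^sub>k\<close> induced by a linear map \<open>L\<close>.
\<close>

definition ext_map ::
    "('n::{finite,linorder} cvec \<Rightarrow> 'n cvec) \<Rightarrow> 'n ext \<Rightarrow> 'n ext" where
  "ext_map L A =
     (\<Sum>K\<in>UNIV. A $ K *s wedge_list (map (\<lambda>i. L (axis i 1)) (sorted_list_of_set K)))"

text \<open>
  Contraction \<open>\<iota>\<^sub>\<alpha>\<close>: since \<open>\<iota>\<^sub>\<alpha>\<close> is a graded derivation of degree \<open>-1\<close>,
  \<open>\<iota>\<^sub>\<alpha> (x\<^sub>1 \<and> \<dots> \<and> x\<^sub>k)\<close> is the sum over \<open>p\<close> of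
  \<open>(-1)\<^bsup>p-1\<^esup> \<langle>\<alpha>, x\<^sub>p\<rangle> x\<^sub>1 \<and> \<dots> \<and> x\<^sub>k\<close> with \<open>x\<^sub>p\<close> omitted.
\<close>

definition contract :: "'n::{finite,linorder} cvec \<Rightarrow> 'n ext \<Rightarrow> 'n ext" where
  "contract \<alpha> A =
     (\<chi> K. \<Sum>i\<in>- K. (- 1) ^ card {j\<in>K. j < i} * \<alpha> $ i * A $ (insert i K))"

text \<open>Multiplication by \<open>(-1)\<^sup>k\<close> in degree \<open>k\<close>.\<close>

definition grade_inv :: "'n::{finite,linorder} ext \<Rightarrow> 'n ext" where
  "grade_inv A = (\<chi> K. (- 1) ^ card K * A $ K)"

section \<open>Fans\<close>

definition rational_cone :: "'n::finite rvec set \<Rightarrow> bool" where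
  "rational_cone \<sigma> \<longleftrightarrow>
     (\<exists>G. finite G \<and> \<sigma> = convex_cone hull (real_of_lattice ` G)) \<and> \<sigma> \<inter> uminus ` \<sigma> = {0}"

definition fan :: "'n::finite rvec set set \<Rightarrow> bool" where
  "fan \<Delta> \<longleftrightarrow> finite \<Delta> \<and> \<Delta> \<noteq> {} \<and>
     (\<forall>\<sigma>\<in>\<Delta>. rational_cone \<sigma>) \<and>
     (\<forall>\<sigma>\<in>\<Delta>. \<forall>\<tau>. \<tau> face_of \<sigma> \<and> \<tau> \<noteq> {} \<longrightarrow> \<tau> \<in> \<Delta>) \<and>
     (\<forall>\<sigma>\<in>\<Delta>. \<forall>\<tau>\<in>\<Delta>. \<sigma> \<inter> \<tau> face_of \<sigma> \<and> \<sigma> \<inter> \<tau> face_of \<tau>)"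

text \<open>The rows of an integer matrix form a basis of the lattice iff it is invertible over \<open>\<int>\<close>.\<close>

definition smooth_fan :: "'n::finite rvec set set \<Rightarrow> bool" where
  "smooth_fan \<Delta> \<longleftrightarrow>
     (\<forall>\<sigma>\<in>\<Delta>. \<exists>(B :: ('n ivec, 'n) vec) K. invertible B \<and>
        \<sigma> = convex_cone hull ((\<lambda>j. real_of_lattice (B $ j)) ` K))"

text \<open>\<open>X\<^sub>\<Delta>\<close> is smooth and compact iff \<open>\<Delta>\<close> is a smooth fan whose support is all of \<open>N\<^sub>\<real>\<close>.\<close>

definition smooth_complete_fan :: "'n::finite rvec set set \<Rightarrow> bool" where
  "smooth_complete_fan \<Delta> \<longleftrightarrow> fan \<Delta> \<and> smooth_fan \<Delta> \<and> \<Union>\<Delta> = UNIV"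

definition rays :: "'n::finite rvec set set \<Rightarrow> 'n rvec set set" where
  "rays \<Delta> = {\<alpha>\<in>\<Delta>. aff_dim \<alpha> = 1}"

definition prim_gen :: "'n::finite rvec set \<Rightarrow> 'n ivec" where
  "prim_gen \<alpha> = (THE v. {w. real_of_lattice w \<in> \<alpha>} = range (\<lambda>k::nat. int k *s v))"

section \<open>The polytope, its faces, and the weight spaces\<close>

definition polytope_of :: "'n::finite rvec set set \<Rightarrow> 'n rvec set" where
  "polytope_of \<Delta> = {x. \<forall>\<alpha>\<in>rays \<Delta>. x \<bullet> real_of_lattice (prim_gen \<alpha>) \<ge> - 1}"

definition S_all :: "'n::finite rvec set set \<Rightarrow> 'n ivec set" where
  "S_all \<Delta> = {I. real_of_lattice I \<in> polytope_of \<Delta>}"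

definition S_codim :: "'n::finite rvec set set \<Rightarrow> nat \<Rightarrow> 'n ivec set" where
  "S_codim \<Delta> i = {I. \<exists>F. F face_of polytope_of \<Delta> \<and> aff_dim F = int CARD('n) - int i \<and>
                          real_of_lattice I \<in> rel_interior F}"

definition S_upto :: "'n::finite rvec set set \<Rightarrow> nat \<Rightarrow> 'n ivec set" where
  "S_upto \<Delta> k = (\<Union>i\<in>{0..k}. S_codim \<Delta> i)"

definition face_at :: "'n::finite rvec set set \<Rightarrow> 'n ivec \<Rightarrow> 'n rvec set" where
  "face_at \<Delta> I = (THE F. F face_of polytope_of \<Delta> \<and> real_of_lattice I \<in> rel_interior F)"

definition face_perp :: "'n::finite rvec set set \<Rightarrow> 'n ivec \<Rightarrow> 'n rvec set" where
  "face_perp \<Delta> I = span {real_of_lattice (prim_gen \<alpha>) |\<alpha>.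
      \<alpha> \<in> rays \<Delta> \<and> real_of_lattice I \<bullet> real_of_lattice (prim_gen \<alpha>) = - 1}"

definition face_hat :: "'n::finite rvec set set \<Rightarrow> 'n ivec \<Rightarrow> 'n cvec set" where
  "face_hat \<Delta> I = complex_affine hull (cplx_of_real ` face_at \<Delta> I)"

definition weight_ext ::
    "'n::{finite,linorder} rvec set set \<Rightarrow> nat \<Rightarrow> 'n ivec \<Rightarrow> 'n ext set" where
  "weight_ext \<Delta> k I =
     (let i = (THE i. I \<in> S_codim \<Delta> i) in
      if i = 0 then ext_power UNIV k
      else if i \<le> k then
        vec.span {A \<and>\<^sub>e B |A B. A \<in> ext_power (complexify (face_perp \<Delta> I)) i
                                \<and> B \<in> ext_power UNIV (k - i)}
      else {0})"

section \<open>Polyvector fields\<close>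

text \<open>
  A polyvector field on the open set \<open>T \<subseteq> \<complex>\<^sup>n\<close> is the family of its coefficients with respect to
  the coordinate frame \<open>\<partial>/\<partial>t\<^sub>1, \<dots>, \<partial>/\<partial>t\<^sub>n\<close>, i.e. a function from \<open>T\<close> to the exterior algebra. To
  make fields determined by their values on \<open>T\<close>, they are set to \<open>0\<close> off \<open>T\<close>.
\<close>

type_synonym 'n field = "'n cvec \<Rightarrow> 'n ext"

definition torus :: "'n::finite cvec set" where
  "torus = {t. \<forall>i. t $ i \<noteq> 0}"

definition character :: "'n::finite ivec \<Rightarrow> 'n cvec \<Rightarrow> complex" where
  "character m t = (\<Prod>i\<in>UNIV. (t $ i) powi (m $ i))"

text \<open>
  The infinitesimal action: \<open>x \<in> N\<^sub>\<complex>\<close> acts by the vector field whose value at \<open>t\<close> is the velocity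
  at \<open>s = 0\<close> of \<open>(exp (s x\<^sub>i) t\<^sub>i)\<^sub>i\<close>, that is \<open>(t\<^sub>i x\<^sub>i)\<^sub>i\<close>.
\<close>

definition rho :: "'n::{finite,linorder} ext \<Rightarrow> 'n field" where
  "rho A t = (if t \<in> torus then ext_map (\<lambda>x. \<chi> i. t $ i * x $ i) A else 0)"

text \<open>The field \<open>\<chi>\<^sup>I \<cdot> \<rho>(A)\<close>.\<close>

definition weight_field :: "'n::{finite,linorder} ivec \<Rightarrow> 'n ext \<Rightarrow> 'n field" where
  "weight_field I A = (\<lambda>t. character I t *s rho A t)"

definition field_wedge :: "'n::{finite,linorder} field \<Rightarrow> 'n field \<Rightarrow> 'n field" where
  "field_wedge f g = (\<lambda>t. f t \<and>\<^sub>e g t)"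

definition partial_deriv :: "'n::{finite,linorder} \<Rightarrow> 'n field \<Rightarrow> 'n field" where
  "partial_deriv i f t =
     (\<chi> K. deriv (\<lambda>s. f (\<chi> j. if j = i then s else t $ j) $ K) (t $ i))"

text \<open>
  The Schouten bracket in coordinates. For \<open>f\<close> of degree \<open>k\<close> the coordinate formula is
  \<open>[f, g] = (-1)\<^bsup>k+1\<^esup> (\<Sum>\<^sub>i \<iota>\<^bsub>dt\<^sub>i\<^esub> f \<and> \<partial>\<^sub>i g + (-1)\<^sup>k \<partial>\<^sub>i f \<and> \<iota>\<^bsub>dt\<^sub>i\<^esub> g)\<close>; as \<open>\<iota>\<^bsub>dt\<^sub>i\<^esub> f\<close> has degree
  \<open>k - 1\<close>, writing the first sign with \<^const>\<open>grade_inv\<close> gives a formula that no longer mentions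
  \<open>k\<close> and so applies to inhomogeneous fields. It is the Lie bracket on vector fields,
  \<open>[v, h] = v h\<close> for a vector field \<open>v\<close> and a function \<open>h\<close>, and on the fields \<open>\<chi>\<^sup>I \<cdot> \<rho>(A)\<close>,
  \<open>A\<close> of degree \<open>k\<close>, it is
  \<open>[\<chi>\<^sup>I \<rho>(A), \<chi>\<^sup>J \<rho>(B)] = (-1)\<^bsup>k+1\<^esup> \<chi>\<^bsup>I+J\<^esup> \<rho>(\<iota>\<^sub>J A \<and> B + (-1)\<^sup>k A \<and> \<iota>\<^sub>I B)\<close>.
\<close>

definition schouten :: "'n::{finite,linorder} field \<Rightarrow> 'n field \<Rightarrow> 'n field" where
  "schouten f g t =
     (if t \<in> torus then
        \<Sum>i\<in>UNIV. grade_inv (contract (axis i 1) (f t)) \<and>\<^sub>e partial_deriv i g t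
                  - partial_deriv i f t \<and>\<^sub>e contract (axis i 1) (g t)
      else 0)"

section \<open>Holomorphic polyvector fields on the toric variety\<close>

definition entire :: "'n::finite field \<Rightarrow> bool" where
  "entire h \<longleftrightarrow>
     (\<forall>z. \<exists>h'. (h has_derivative h') (at z) \<and> (\<forall>c v. h' (c *s v) = c *s h' v))"

text \<open>
  The smooth complete toric variety \<open>X\<^sub>\<Delta>\<close> is covered by the charts \<open>U\<^sub>\<sigma> \<cong> \<complex>\<^sup>n\<close> of the
  \<open>n\<close>-dimensional cones \<open>\<sigma>\<close>. If the rows \<open>b\<^sub>1, \<dots>, b\<^sub>n\<close> of \<open>B\<close> are a lattice basis generating
  \<open>\<sigma>\<close>, the coordinates on \<open>U\<^sub>\<sigma>\<close> are the characters of the dual basis; each chart contains \<open>T\<close>, as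
  the locus where no coordinate vanishes, and there the coordinates \<open>z\<close> describe the point
  \<open>chart_param B z\<close>, the product of the one-parameter subgroups \<open>b\<^sub>j\<close> evaluated at \<open>z\<^sub>j\<close>.
\<close>

definition chart_bases :: "'n::finite rvec set set \<Rightarrow> ('n ivec, 'n) vec set" where
  "chart_bases \<Delta> =
     {B. invertible B \<and> convex_cone hull (range (\<lambda>j. real_of_lattice (B $ j))) \<in> \<Delta>}"

definition chart_param :: "('n::finite ivec, 'n) vec \<Rightarrow> 'n cvec \<Rightarrow> 'n cvec" where
  "chart_param B z = (\<chi> i. \<Prod>j\<in>UNIV. (z $ j) powi (B $ j $ i))"

text \<open>
  \<open>H\<^sup>0(X\<^sub>\<Delta>, \<Lambda>\<^sup>k T)\<close>. As \<open>T\<close> is open and dense in \<open>X\<^sub>\<Delta>\<close>, a holomorphic \<open>k\<close>-vector field on \<open>X\<^sub>\<Delta>\<close> is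
  the same as its restriction \<open>f\<close> to \<open>T\<close>, and \<open>f\<close> arises in this way iff in every chart it is the
  push-forward of a holomorphic \<open>k\<close>-vector field \<open>h\<close> on the whole of \<open>\<complex>\<^sup>n\<close> (two such local
  extensions agree on the overlap of their charts by density of \<open>T\<close>).
\<close>

definition holo_fields :: "'n::{finite,linorder} rvec set set \<Rightarrow> nat \<Rightarrow> 'n field set" where
  "holo_fields \<Delta> k =
     {f. (\<forall>t. t \<notin> torus \<longrightarrow> f t = 0) \<and>
         (\<forall>B\<in>chart_bases \<Delta>. \<exists>h. entire h \<and> (\<forall>z. h z \<in> ext_power UNIV k) \<and>
            (\<forall>z\<in>torus. f (chart_param B z) =
               ext_map (frechet_derivative (chart_param B) (at z)) (h z)))}"

section \<open>The Gerstenhaber algebra and its BV operators\<close>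

definition alg_piece :: "'n::{finite,linorder} rvec set set \<Rightarrow> int \<Rightarrow> 'n field set" where
  "alg_piece \<Delta> k =
     (if 0 \<le> k \<and> k \<le> int CARD('n) then holo_fields \<Delta> (nat k) else {\<lambda>t. 0})"

definition alg :: "'n::{finite,linorder} rvec set set \<Rightarrow> 'n field set" where
  "alg \<Delta> = {f. \<exists>c. (\<forall>k. c k \<in> alg_piece \<Delta> k) \<and>
                   f = (\<lambda>t. \<Sum>k\<in>{0..int CARD('n)}. c k t)}"

text \<open>Operators on the algebra are extensional: they have no meaningful value off \<^const>\<open>alg\<close>.\<close>

definition degree_minus_one_operator ::
    "'n::{finite,linorder} rvec set set \<Rightarrow> ('n field \<Rightarrow> 'n field) \<Rightarrow> bool" where
  "degree_minus_one_operator \<Delta> D \<longleftrightarrow>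
     D \<in> alg \<Delta> \<rightarrow>\<^sub>E alg \<Delta> \<and>
     (\<forall>a\<in>alg \<Delta>. \<forall>b\<in>alg \<Delta>. D (\<lambda>t. a t + b t) = (\<lambda>t. D a t + D b t)) \<and>
     (\<forall>c. \<forall>a\<in>alg \<Delta>. D (\<lambda>t. c *s a t) = (\<lambda>t. c *s D a t)) \<and>
     (\<forall>k. D ` alg_piece \<Delta> k \<subseteq> alg_piece \<Delta> (k - 1))"

definition BV_operator ::
    "'n::{finite,linorder} rvec set set \<Rightarrow> ('n field \<Rightarrow> 'n field) \<Rightarrow> bool" where
  "BV_operator \<Delta> D \<longleftrightarrow>
     degree_minus_one_operator \<Delta> D \<and>
     (\<forall>k l. \<forall>a\<in>alg_piece \<Delta> k. \<forall>b\<in>alg_piece \<Delta> l.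
        schouten a b =
          (\<lambda>t. (- 1) powi k *s
             (D (field_wedge a b) t - field_wedge (D a) b t
                - (- 1) powi k *s field_wedge a (D b) t))) \<and>
     (\<forall>a\<in>alg \<Delta>. D (D a) = (\<lambda>t. 0))"

definition given_by ::
    "'n::{finite,linorder} rvec set set \<Rightarrow> 'n cvec \<Rightarrow> ('n field \<Rightarrow> 'n field) \<Rightarrow> bool" where
  "given_by \<Delta> \<delta> D \<longleftrightarrow>
     degree_minus_one_operator \<Delta> D \<and>
     (\<forall>k\<in>{1..CARD('n)}. \<forall>I\<in>S_upto \<Delta> k. \<forall>A\<in>weight_ext \<Delta> k I.
        D (weight_field I A) = weight_field I (contract (\<delta> - cplx_of_lattice I) A))"

end

theory Submission
  imports Defs "HOL-Complex_Analysis.Conformal_Mappings" "HOL-Computational_Algebra.Polynomial"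
begin

text \<open>
  Holomorphic \<open>k\<close>-vector fields are the finite sums of fields \<open>\<chi>\<^sup>I \<rho>(A)\<close> with \<open>I \<in> S\<^sub>\<Delta>\<close> and \<open>A\<close> of degree
  \<open>k\<close> annihilated by every \<open>e(\<alpha>\<^sub>t)\<close> with \<open>\<langle>I, e(\<alpha>\<^sub>t)\<rangle> = -1\<close>. Indeed, as the polydiscs of the charts cover
  the torus, the coefficients of such a field grow at most polynomially, so they are Laurent
  polynomials, and boundedness near the toric divisors restricts their exponents.

  For every \<open>\<delta>\<close> the operator \<open>\<chi>\<^sup>I \<rho>(A) \<mapsto> \<chi>\<^sup>I \<rho>(\<iota>\<^bsub>\<delta>-I\<^esub> A)\<close> is a first order differential operator that
  squares to zero and generates the Schouten bracket; it preserves holomorphic fields when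
  \<open>\<delta> - I\<close> vanishes on \<open>F\<^sub>I\<^sup>\<bottom>\<close> for all \<open>I\<close>. Conversely, put \<open>\<langle>\<delta>, x\<rangle> = D(\<rho>(x))\<close> for a BV operator \<open>D\<close>.
  Its difference from the operator of \<open>\<delta>\<close> is a derivation up to sign that kills all \<open>\<rho>(x)\<close>. On
  \<open>\<chi>\<^sup>I \<rho>(\<omega>)\<close>, where \<open>\<omega>\<close> spans \<open>\<Lambda>\<^sup>i F\<^sub>I\<^sup>\<bottom>\<close>, it takes a value of degree \<open>i - 1\<close> annihilated by the
  \<open>i\<close>-dimensional space \<open>F\<^sub>I\<^sup>\<bottom>\<close>, which must be \<open>0\<close>; these fields generate, so the two operators agree.
\<close>

section \<open>Exterior algebra\<close>

text \<open>The chart definition of \<open>holo_fields\<close> does not show its weights, so the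
  decomposition must be derived. Function theory of several variables is kept out: along a
  coordinate line a removable singularity and Liouville's theorem give a Laurent polynomial, and
  interpolation at fixed nodes, possible because the degree bound is uniform, assembles the lines.
  The growth bound rests on completeness: -log|t| lies in some full-dimensional cone, which places t
  in the closed unit polydisc of the corresponding chart. The spaces N_I^k are replaced by the
  condition b \<and> A = 0 for all active generators b, because in a chart this says exactly that
  the coefficients which would have a pole vanish. The vector \<delta> of a BV operator exists
  because elements of degree 0 are constants. It lies in every \<open>face_hat\<close> because b
  \<and> \<iota>\<omega> = <\<delta> - I, b> \<omega> for the top form \<omega> of the span of the
  active generators, contraction being by \<delta> - I: holomorphy of the value at \<omega> makes
  the left side 0, and \<omega> is not 0.\<close>

lemma ext_eqI: "(\<And>K. A $ K = B $ K) \<Longrightarrow> A = (B :: ('n::finite) ext)"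
  by (simp add: vec_eq_iff)

section \<open>Bilinearity and associativity of the wedge product\<close>

lemma wedge_nth:
  "(A \<and>\<^sub>e B) $ K = (\<Sum>L\<in>Pow K. shuffle_sign L (K - L) * A $ L * B $ (K - L))"
  by (simp add: wedge_def)

lemma wedge_add_left: "(A + B) \<and>\<^sub>e C = A \<and>\<^sub>e C + B \<and>\<^sub>e C"
  by (rule ext_eqI) (simp add: wedge_nth algebra_simps sum.distrib)

lemma wedge_add_right: "C \<and>\<^sub>e (A + B) = C \<and>\<^sub>e A + C \<and>\<^sub>e B"
  by (rule ext_eqI) (simp add: wedge_nth algebra_simps sum.distrib)

lemma wedge_scale_left [simp]: "(c *s A) \<and>\<^sub>e B = c *s (A \<and>\<^sub>e B)"
  by (rule ext_eqI) (simp add: wedge_nth sum_distrib_left mult_ac)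

lemma wedge_scale_right [simp]: "A \<and>\<^sub>e (c *s B) = c *s (A \<and>\<^sub>e B)"
  by (rule ext_eqI) (simp add: wedge_nth sum_distrib_left mult_ac)

lemma wedge_zero_left [simp]: "0 \<and>\<^sub>e B = 0"
  by (rule ext_eqI) (simp add: wedge_nth)

lemma wedge_zero_right [simp]: "A \<and>\<^sub>e 0 = 0"
  by (rule ext_eqI) (simp add: wedge_nth)

lemma wedge_minus_left [simp]: "(- A) \<and>\<^sub>e B = - (A \<and>\<^sub>e B)"
  by (rule ext_eqI) (simp add: wedge_nth sum_negf)

lemma wedge_minus_right [simp]: "A \<and>\<^sub>e (- B) = - (A \<and>\<^sub>e B)"
  by (rule ext_eqI) (simp add: wedge_nth sum_negf)

lemma wedge_diff_left: "(A - B) \<and>\<^sub>e C = A \<and>\<^sub>e C - B \<and>\<^sub>e C"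
  using wedge_add_left[of A "- B" C] by simp

lemma wedge_diff_right: "C \<and>\<^sub>e (A - B) = C \<and>\<^sub>e A - C \<and>\<^sub>e B"
  using wedge_add_right[of C A "- B"] by simp

lemma wedge_sum_left: "(\<Sum>i\<in>S. f i) \<and>\<^sub>e B = (\<Sum>i\<in>S. f i \<and>\<^sub>e B)"
  by (induction S rule: infinite_finite_induct) (auto simp: wedge_add_left)

lemma wedge_sum_right: "B \<and>\<^sub>e (\<Sum>i\<in>S. f i) = (\<Sum>i\<in>S. B \<and>\<^sub>e f i)"
  by (induction S rule: infinite_finite_induct) (auto simp: wedge_add_right)

lemma shuffle_sign_Un_left:
  assumes "M \<inter> N = {}"
  shows "shuffle_sign (M \<union> N) R = shuffle_sign M R * shuffle_sign N R"
proof -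
  have "{(i, j). i \<in> M \<union> N \<and> j \<in> R \<and> j < i} =
        {(i, j). i \<in> M \<and> j \<in> R \<and> j < i} \<union> {(i, j). i \<in> N \<and> j \<in> R \<and> j < i}"
    by auto
  moreover have "{(i, j). i \<in> M \<and> j \<in> R \<and> j < i} \<inter> {(i, j). i \<in> N \<and> j \<in> R \<and> j < i} = {}"
    using assms by auto
  ultimately show ?thesis
    by (simp add: shuffle_sign_def card_Un_disjoint power_add)
qed

lemma shuffle_sign_Un_right:
  assumes "M \<inter> N = {}"
  shows "shuffle_sign R (M \<union> N) = shuffle_sign R M * shuffle_sign R N"
proof -
  have "{(i, j). i \<in> R \<and> j \<in> M \<union> N \<and> j < i} =
        {(i, j). i \<in> R \<and> j \<in> M \<and> j < i} \<union> {(i, j). i \<in> R \<and> j \<in> N \<and> j < i}"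
    by auto
  moreover have "{(i, j). i \<in> R \<and> j \<in> M \<and> j < i} \<inter> {(i, j). i \<in> R \<and> j \<in> N \<and> j < i} = {}"
    using assms by auto
  ultimately show ?thesis
    by (simp add: shuffle_sign_def card_Un_disjoint power_add)
qed

text \<open>Both sides sum over the ordered partitions of \<open>K\<close> into three blocks, here
  M, L - M, K - L. The sign counts inversions between each pair of blocks, and this count does not
  depend on the bracketing.\<close>

lemma wedge_assoc: "(A \<and>\<^sub>e B) \<and>\<^sub>e C = A \<and>\<^sub>e (B \<and>\<^sub>e C)"
proof (rule ext_eqI)
  fix K
  have "((A \<and>\<^sub>e B) \<and>\<^sub>e C) $ K =
      (\<Sum>(L, M)\<in>Sigma (Pow K) Pow.
        shuffle_sign L (K - L) * (shuffle_sign M (L - M) * A $ M * B $ (L - M)) * C $ (K - L))"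
    by (simp add: wedge_nth sum_distrib_left sum_distrib_right sum.Sigma)
  also have "\<dots> = (\<Sum>(M, N)\<in>Sigma (Pow K) (\<lambda>M. Pow (K - M)).
        shuffle_sign M (K - M) * A $ M * (shuffle_sign N (K - M - N) * B $ N * C $ (K - M - N)))"
  proof (rule sum.reindex_bij_witness[where i = "\<lambda>(M, N). (M \<union> N, M)"
        and j = "\<lambda>(L, M). (M, L - M)"], goal_cases)
    case (5 LM)
    obtain L M where LM: "LM = (L, M)" "M \<subseteq> L" "L \<subseteq> K" using 5 by auto
    have eq: "K - M - (L - M) = K - L" "K - M = (L - M) \<union> (K - L)" "L = M \<union> (L - M)"
      using LM by auto
    have "shuffle_sign L (K - L) = shuffle_sign M (K - L) * shuffle_sign (L - M) (K - L)"
      using shuffle_sign_Un_left[of M "L - M" "K - L"] eq(3) by auto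
    moreover have "shuffle_sign M (K - M) = shuffle_sign M (L - M) * shuffle_sign M (K - L)"
      using shuffle_sign_Un_right[of "L - M" "K - L" M] eq(2) by auto
    ultimately show ?case
      unfolding LM by (simp only: prod.case eq(1)) (simp add: mult_ac)
  qed auto
  also have "\<dots> = (A \<and>\<^sub>e (B \<and>\<^sub>e C)) $ K"
    by (simp add: wedge_nth sum_distrib_left sum_distrib_right sum.Sigma)
  finally show "((A \<and>\<^sub>e B) \<and>\<^sub>e C) $ K = (A \<and>\<^sub>e (B \<and>\<^sub>e C)) $ K" .
qed

section \<open>Wedging with a vector, and contraction\<close>

lemma ext_vector_nth: "ext_vector x $ K = (\<Sum>i\<in>UNIV. if K = {i} then x $ i else 0)"
  by (simp add: ext_vector_def)

lemma ext_vector_add [simp]: "ext_vector (x + y) = ext_vector x + ext_vector y"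
  by (rule ext_eqI) (auto simp: ext_vector_nth simp flip: sum.distrib intro!: sum.cong)

lemma ext_vector_scale [simp]: "ext_vector (c *s x) = c *s ext_vector x"
  by (rule ext_eqI) (auto simp: ext_vector_nth sum_distrib_left intro!: sum.cong)

lemma ext_vector_zero [simp]: "ext_vector 0 = 0"
  by (rule ext_eqI) (simp add: ext_vector_nth cong: if_cong)

lemma ext_vector_sum: "ext_vector (\<Sum>i\<in>S. f i) = (\<Sum>i\<in>S. ext_vector (f i))"
  by (induction S rule: infinite_finite_induct) auto

lemma ext_vector_singleton: "ext_vector x $ {i} = x $ i"
proof -
  have "(\<Sum>j\<in>UNIV. if {i} = {j} then x $ j else 0) = (\<Sum>j\<in>{i}. x $ j)"
    by (rule sum.mono_neutral_cong_right) auto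
  then show ?thesis by (simp add: ext_vector_nth)
qed

lemma ext_vector_eq_0: "card K \<noteq> 1 \<Longrightarrow> ext_vector x $ K = 0"
  unfolding ext_vector_nth by (intro sum.neutral) auto

lemma vector_expand: "(x :: complex ^ 'n::finite) = (\<Sum>i\<in>UNIV. x $ i *s axis i 1)"
  by (simp add: vec_eq_iff axis_def if_distrib cong: if_cong)

text \<open>Only singletons \<open>L\<close> contribute, and the shuffle sign of {i} against the
  rest of \<open>K\<close> counts the elements of \<open>K\<close> below i. The formula mirrors that
  of \<open>contract\<close>, with removal of an index in place of insertion.\<close>

lemma vec_wedge_nth:
  "(ext_vector x \<and>\<^sub>e A) $ K = (\<Sum>i\<in>K. (- 1) ^ card {j \<in> K. j < i} * x $ i * A $ (K - {i}))"
proof -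
  have "(ext_vector x \<and>\<^sub>e A) $ K =
      (\<Sum>L\<in>(\<lambda>i. {i}) ` K. shuffle_sign L (K - L) * ext_vector x $ L * A $ (K - L))"
    unfolding wedge_nth
  proof (rule sum.mono_neutral_right)
    show "\<forall>L\<in>Pow K - (\<lambda>i. {i}) ` K. shuffle_sign L (K - L) * ext_vector x $ L * A $ (K - L) = 0"
    proof
      fix L assume L: "L \<in> Pow K - (\<lambda>i. {i}) ` K"
      have "card L \<noteq> 1"
      proof
        assume "card L = 1"
        then obtain i where "L = {i}" by (auto simp: card_1_singleton_iff)
        with L show False by auto
      qed
      then show "shuffle_sign L (K - L) * ext_vector x $ L * A $ (K - L) = 0"
        by (simp add: ext_vector_eq_0)
    qed
  qed auto
  also have "\<dots> = (\<Sum>i\<in>K. shuffle_sign {i} (K - {i}) * x $ i * A $ (K - {i}))"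
    by (subst sum.reindex) (auto simp: inj_on_def ext_vector_singleton)
  also have "\<dots> = (\<Sum>i\<in>K. (- 1) ^ card {j \<in> K. j < i} * x $ i * A $ (K - {i}))"
  proof (rule sum.cong[OF refl])
    fix i assume "i \<in> K"
    have "{(a, b). a \<in> {i} \<and> b \<in> K - {i} \<and> b < a} = Pair i ` {j \<in> K. j < i}" by auto
    then have "card {(a, b). a \<in> {i} \<and> b \<in> K - {i} \<and> b < a} = card {j \<in> K. j < i}"
      by (simp only:) (rule card_image, simp add: inj_on_def)
    then show "shuffle_sign {i} (K - {i}) * x $ i * A $ (K - {i}) =
        (- 1) ^ card {j \<in> K. j < i} * x $ i * A $ (K - {i})"
      by (simp add: shuffle_sign_def)
  qed
  finally show ?thesis .
qed

text \<open>The complex bilinear pairing of \<open>M\<close> and \<open>N\<close> extended to the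
  complex numbers; there is no conjugation.\<close>

definition cdot :: "'n::finite cvec \<Rightarrow> 'n cvec \<Rightarrow> complex" where
  "cdot \<alpha> x = (\<Sum>i\<in>UNIV. \<alpha> $ i * x $ i)"

lemma cdot_add_left: "cdot (a + b) x = cdot a x + cdot b x"
  by (simp add: cdot_def algebra_simps sum.distrib)

lemma cdot_diff_left: "cdot (a - b) x = cdot a x - cdot b x"
  by (simp add: cdot_def algebra_simps sum_subtractf)

lemma cdot_scale_left: "cdot (c *s a) x = c * cdot a x"
  by (simp add: cdot_def sum_distrib_left mult_ac)

lemma contract_nth:
  "contract \<alpha> A $ K = (\<Sum>i\<in>- K. (- 1) ^ card {j\<in>K. j < i} * \<alpha> $ i * A $ (insert i K))"
  by (simp add: contract_def)

lemma contract_add [simp]: "contract \<alpha> (A + B) = contract \<alpha> A + contract \<alpha> B"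
  by (rule ext_eqI) (simp add: contract_nth algebra_simps sum.distrib)

lemma contract_scale [simp]: "contract \<alpha> (c *s A) = c *s contract \<alpha> A"
  by (rule ext_eqI) (simp add: contract_nth sum_distrib_left mult_ac)

lemma contract_zero [simp]: "contract \<alpha> 0 = 0"
  by (rule ext_eqI) (simp add: contract_nth)

lemma contract_minus [simp]: "contract \<alpha> (- A) = - contract \<alpha> A"
  by (rule ext_eqI) (simp add: contract_nth sum_negf)

lemma contract_diff [simp]: "contract \<alpha> (A - B) = contract \<alpha> A - contract \<alpha> B"
  using contract_add[of \<alpha> A "- B"] by simp

lemma contract_axis_nth:
  "contract (axis i 1) A $ K =
    (if i \<in> K then 0 else (- 1) ^ card {j\<in>K. j < i} * A $ (insert i K))"
proof -
  have "contract (axis i 1) A $ K =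
      (\<Sum>l\<in>- K. if l = i then (- 1) ^ card {j\<in>K. j < i} * A $ (insert i K) else 0)"
    unfolding contract_nth by (rule sum.cong) (auto simp: axis_def)
  then show ?thesis by simp
qed

lemma card_below_insert:
  fixes K :: "'n::{finite,linorder} set"
  assumes "i \<notin> K"
  shows "card {j \<in> insert i K. j < l} = card {j \<in> K. j < l} + (if i < l then 1 else 0)"
proof (cases "i < l")
  case True
  then have "{j \<in> insert i K. j < l} = insert i {j \<in> K. j < l}" by auto
  then show ?thesis using assms True by simp
next
  case False
  then have "{j \<in> insert i K. j < l} = {j \<in> K. j < l}" by auto
  then show ?thesis using False by simp
qed

text \<open>In coordinates, the terms in which the same index is inserted and removed come from the
  left side for i outside \<open>K\<close> and from the subtracted product for i in
  \<open>K\<close>; together they make up the full pairing. The mixed terms agree up to the sign -1,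
  because of two distinct indices exactly one lies below the other.\<close>

lemma contract_vec_wedge:
  "contract \<alpha> (ext_vector x \<and>\<^sub>e A) = cdot \<alpha> x *s A - ext_vector x \<and>\<^sub>e contract \<alpha> A"
proof (rule ext_eqI)
  fix K
  define s :: "'a \<Rightarrow> 'a set \<Rightarrow> complex" where "s i L = (- 1) ^ card {j\<in>L. j < i}" for i L
  have ss: "s i L * s i L = 1" for i L
    by (simp add: s_def flip: power_add mult_2)
  have ss': "s i L * (s i L * c) = c" for i L c
    by (simp add: ss flip: mult.assoc)
  have s_insert: "s l (insert i L) = s l L * (if i < l then - 1 else 1)" if "i \<notin> L" for i l L
    unfolding s_def card_below_insert[OF that]
    by (cases "i < l") (simp_all only: if_True if_False power_add power_one_right power_0 add_0_right mult_1_right not_False_eq_True)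
  have s_self: "s i (insert i L) = s i L" for i L
    unfolding s_def by (rule arg_cong[where f = "\<lambda>S. (- 1) ^ card S"]) auto
  have s_self': "s i (L - {i}) = s i L" for i L
    unfolding s_def by (rule arg_cong[where f = "\<lambda>S. (- 1) ^ card S"]) auto
  have "contract \<alpha> (ext_vector x \<and>\<^sub>e A) $ K =
     (\<Sum>i\<in>- K. s i K * \<alpha> $ i * (\<Sum>l\<in>insert i K. s l (insert i K) * x $ l * A $ (insert i K - {l})))"
    by (simp add: contract_nth vec_wedge_nth s_def)
  also have "\<dots> = (\<Sum>i\<in>- K. \<alpha> $ i * x $ i * A $ K +
      (\<Sum>l\<in>K. s i K * s l (insert i K) * \<alpha> $ i * x $ l * A $ (insert i K - {l})))"
  proof (rule sum.cong[OF refl])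
    fix i assume i: "i \<in> - K"
    have "s i K * \<alpha> $ i * (s i K * x $ i * A $ K) = (s i K * s i K) * (\<alpha> $ i * x $ i * A $ K)"
      by (simp only: mult_ac)
    then show "s i K * \<alpha> $ i * (\<Sum>l\<in>insert i K. s l (insert i K) * x $ l * A $ (insert i K - {l})) =
        \<alpha> $ i * x $ i * A $ K +
        (\<Sum>l\<in>K. s i K * s l (insert i K) * \<alpha> $ i * x $ l * A $ (insert i K - {l}))"
      using i by (simp add: s_self ss distrib_left sum_distrib_left mult_ac)
  qed
  also have "\<dots> = (\<Sum>i\<in>- K. \<alpha> $ i * x $ i * A $ K) +
      (\<Sum>i\<in>- K. \<Sum>l\<in>K. s i K * s l (insert i K) * \<alpha> $ i * x $ l * A $ (insert i K - {l}))"
    by (simp add: sum.distrib)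
  also have "(\<Sum>i\<in>- K. \<Sum>l\<in>K. s i K * s l (insert i K) * \<alpha> $ i * x $ l * A $ (insert i K - {l})) =
      (\<Sum>l\<in>K. \<Sum>i\<in>- K. - (s l K * s i (K - {l}) * \<alpha> $ i * x $ l * A $ (insert i (K - {l}))))"
  proof (subst sum.swap, intro sum.cong refl)
    fix l i assume li: "l \<in> K" "i \<in> - K"
    have 1: "s i K = s i (K - {l}) * (if l < i then - 1 else 1)"
      using s_insert[of l "K - {l}" i] li by (simp add: insert_absorb)
    have 2: "s l (insert i K) = s l K * (if i < l then - 1 else 1)"
      using s_insert[of i K l] li by simp
    have "i \<noteq> l" using li by auto
    then have 3: "(if l < i then - 1 else 1) * (if i < l then - 1 else 1) = (- 1 :: complex)"
      by auto
    have "s i K * s l (insert i K) =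
        ((if l < i then - 1 else 1) * (if i < l then - 1 else 1)) * (s l K * s i (K - {l}))"
      by (simp only: 1 2 mult_ac)
    then have "s i K * s l (insert i K) = - (s l K * s i (K - {l}))"
      by (simp only: 3 mult_minus1)
    moreover have "insert i K - {l} = insert i (K - {l})" using \<open>i \<noteq> l\<close> by auto
    ultimately show "s i K * s l (insert i K) * \<alpha> $ i * x $ l * A $ (insert i K - {l}) =
        - (s l K * s i (K - {l}) * \<alpha> $ i * x $ l * A $ (insert i (K - {l})))"
      by simp
  qed
  also have "\<dots> = (\<Sum>l\<in>K. \<alpha> $ l * x $ l * A $ K -
      s l K * x $ l * (\<Sum>i\<in>- (K - {l}). s i (K - {l}) * \<alpha> $ i * A $ (insert i (K - {l}))))"
  proof (rule sum.cong[OF refl])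
    fix l assume l: "l \<in> K"
    then have eq: "- (K - {l}) = insert l (- K)" "insert l (K - {l}) = K" "insert l K = K" by auto
    show "(\<Sum>i\<in>- K. - (s l K * s i (K - {l}) * \<alpha> $ i * x $ l * A $ (insert i (K - {l})))) =
        \<alpha> $ l * x $ l * A $ K -
          s l K * x $ l * (\<Sum>i\<in>- (K - {l}). s i (K - {l}) * \<alpha> $ i * A $ (insert i (K - {l})))"
      using l unfolding eq
      by (simp add: s_self' ss ss' eq sum_negf distrib_left sum_distrib_left mult_ac)
  qed
  also have "\<dots> = (\<Sum>l\<in>K. \<alpha> $ l * x $ l * A $ K) - (ext_vector x \<and>\<^sub>e contract \<alpha> A) $ K"
    by (simp add: sum_subtractf vec_wedge_nth contract_nth s_def)
  also have "(\<Sum>i\<in>- K. \<alpha> $ i * x $ i * A $ K) +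
      ((\<Sum>l\<in>K. \<alpha> $ l * x $ l * A $ K) - (ext_vector x \<and>\<^sub>e contract \<alpha> A) $ K) =
      (cdot \<alpha> x *s A - ext_vector x \<and>\<^sub>e contract \<alpha> A) $ K"
  proof -
    have "(\<Sum>i\<in>UNIV. \<alpha> $ i * x $ i * A $ K) =
        (\<Sum>i\<in>- K. \<alpha> $ i * x $ i * A $ K) + (\<Sum>i\<in>K. \<alpha> $ i * x $ i * A $ K)"
      using sum.subset_diff[of K UNIV] by (simp add: Compl_eq_Diff_UNIV)
    then show ?thesis by (simp add: cdot_def sum_distrib_right)
  qed
  finally show "contract \<alpha> (ext_vector x \<and>\<^sub>e A) $ K =
      (cdot \<alpha> x *s A - ext_vector x \<and>\<^sub>e contract \<alpha> A) $ K" .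
qed


lemma ext_vector_axis: "ext_vector (axis i 1) = axis {i} 1"
proof (rule ext_eqI)
  fix K
  show "ext_vector (axis i 1) $ K = axis {i} 1 $ K"
  proof (cases "K = {i}")
    case True
    then show ?thesis by (simp only: ext_vector_singleton axis_nth)
  next
    case False
    then show ?thesis unfolding ext_vector_nth by (subst sum.neutral) (auto simp: axis_def)
  qed
qed

text \<open>In the basis this is a double sum over (i, l) whose summand is antisymmetric, so it
  equals its own negative. Here \<open>P i\<close> is left multiplication by the i-th basis
  vector.\<close>

lemma vec_wedge_self: "ext_vector x \<and>\<^sub>e (ext_vector x \<and>\<^sub>e A) = 0"
proof -
  define P where "P i A = ext_vector (axis i 1) \<and>\<^sub>e A" for i and A :: "'a ext"
  have P: "P i A $ K = (if i \<in> K then (- 1) ^ card {j \<in> K. j < i} * A $ (K - {i}) else 0)" for i A K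
  proof -
    have "P i A $ K =
        (\<Sum>l\<in>K. if l = i then (- 1) ^ card {j \<in> K. j < i} * A $ (K - {i}) else 0)"
      unfolding P_def vec_wedge_nth by (rule sum.cong) (auto simp: axis_def)
    then show ?thesis by simp
  qed
  have swap: "P i (P l A) + P l (P i A) = 0" if "i < l" for i l A
  proof (rule ext_eqI)
    fix K
    show "(P i (P l A) + P l (P i A)) $ K = 0 $ K"
    proof (cases "i \<in> K \<and> l \<in> K")
      case True
      have 1: "{j \<in> K - {i}. j < l} = {j \<in> K. j < l} - {i}" by auto
      have 2: "{j \<in> K - {l}. j < i} = {j \<in> K. j < i}" using that by auto
      have "card {j \<in> K. j < l} = Suc (card ({j \<in> K. j < l} - {i}))"
        using True that by (intro card.remove) auto
      then obtain n where "card {j \<in> K. j < l} = Suc n" "card ({j \<in> K. j < l} - {i}) = n"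
        by blast
      moreover have "K - {l} - {i} = K - {i} - {l}" by auto
      ultimately show ?thesis using True that
        by (simp only: vector_add_component P 1 2) simp
    qed (auto simp: P)
  qed
  have diag: "P i (P i A) = 0" for i A
    by (rule ext_eqI) (simp add: P)
  have x: "ext_vector x \<and>\<^sub>e A = (\<Sum>i\<in>UNIV. x $ i *s P i A)" for A
    by (subst (1) vector_expand[of x])
      (simp only: ext_vector_sum ext_vector_scale wedge_sum_left wedge_scale_left P_def)
  have P_lin: "P i (\<Sum>l\<in>UNIV. f l) = (\<Sum>l\<in>UNIV. P i (f l))" "P i (c *s A) = c *s P i A" for i c A f
    by (simp_all add: P_def wedge_sum_right)
  define g where "g i l = (x $ i * x $ l) *s P i (P l A)" for i l
  have "ext_vector x \<and>\<^sub>e (ext_vector x \<and>\<^sub>e A) = (\<Sum>i\<in>UNIV. \<Sum>l\<in>UNIV. g i l)"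
    by (simp only: x P_lin g_def vec.scale_sum_right vector_smult_assoc)
  also have "\<dots> = 0"
  proof -
    have anti: "g i l = - g l i" for i l
    proof -
      have "P i (P l A) = - P l (P i A)"
        using swap[of i l] swap[of l i] diag[of i]
        by (cases i l rule: linorder_cases) (auto simp: eq_neg_iff_add_eq_0 add.commute)
      then show ?thesis by (simp add: g_def mult.commute vector_smult_rneg)
    qed
    have "(\<Sum>i\<in>UNIV. \<Sum>l\<in>UNIV. g i l) = (\<Sum>i\<in>UNIV. \<Sum>l\<in>UNIV. g l i)"
      by (rule sum.swap)
    also have "\<dots> = (\<Sum>i\<in>UNIV. \<Sum>l\<in>UNIV. - g i l)"
      by (intro sum.cong refl anti)
    also have "\<dots> = - (\<Sum>i\<in>UNIV. \<Sum>l\<in>UNIV. g i l)"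
      by (simp add: sum_negf)
    finally have "(2::complex) *s (\<Sum>i\<in>UNIV. \<Sum>l\<in>UNIV. g i l) = 0"
      by (metis add.right_inverse one_add_one vec.scale_left_distrib vec.scale_one)
    then show ?thesis by simp
  qed
  finally show ?thesis .
qed

text \<open>Polarization of \<open>vec_wedge_self\<close>.\<close>

lemma vec_wedge_anticommute:
  "ext_vector x \<and>\<^sub>e (ext_vector y \<and>\<^sub>e A) = - (ext_vector y \<and>\<^sub>e (ext_vector x \<and>\<^sub>e A))"
proof -
  have "ext_vector (x + y) \<and>\<^sub>e (ext_vector (x + y) \<and>\<^sub>e A) = 0"
    by (rule vec_wedge_self)
  then show ?thesis
    by (simp add: wedge_add_left wedge_add_right vec_wedge_self eq_neg_iff_add_eq_0 add.commute)
qed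

section \<open>Decomposable elements, and induction over them\<close>

lemma wedge_list_Nil [simp]: "wedge_list [] = axis {} 1"
  by (simp add: wedge_list_def)

lemma wedge_list_Cons [simp]: "wedge_list (x # xs) = ext_vector x \<and>\<^sub>e wedge_list xs"
  by (simp add: wedge_list_def)

lemma axis_wedge_below:
  assumes "\<And>j. j \<in> K \<Longrightarrow> i < j"
  shows "ext_vector (axis i 1) \<and>\<^sub>e axis K 1 = axis (insert i K) 1"
proof (rule ext_eqI)
  fix L
  have "(ext_vector (axis i 1) \<and>\<^sub>e axis K 1) $ L =
      (\<Sum>l\<in>L. if l = i then (- 1) ^ card {j \<in> L. j < i} * axis K 1 $ (L - {i}) else 0)"
    unfolding vec_wedge_nth by (rule sum.cong) (auto simp: axis_def)
  also have "\<dots> = axis (insert i K) 1 $ L"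
  proof -
    have "i \<notin> K" using assms by blast
    have "{j \<in> insert i K. j < i} = {}" using assms by (fastforce dest: less_asym)
    then have c: "card {j \<in> insert i K. j < i} = 0" by (simp only: card.empty)
    show ?thesis
    proof (cases "L = insert i K")
      case True
      have "L - {i} = K" "i \<in> L" using True \<open>i \<notin> K\<close> by auto
      then show ?thesis
        by (simp add: True c axis_def del: insert_iff)
    next
      case False
      then have "i \<in> L \<Longrightarrow> L - {i} \<noteq> K" by auto
      then show ?thesis using False by (simp add: axis_def)
    qed
  qed
  finally show "(ext_vector (axis i 1) \<and>\<^sub>e axis K 1) $ L = axis (insert i K) 1 $ L" .
qed

text \<open>Prepending an index below all the others costs no sign, so the sorted order yields the
  basis element itself.\<close>

lemma wedge_list_axis:
  "sorted xs \<Longrightarrow> distinct xs \<Longrightarrow> wedge_list (map (\<lambda>i. axis i 1) xs) = axis (set xs) 1"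
proof (induction xs)
  case (Cons x xs)
  then have "\<And>j. j \<in> set xs \<Longrightarrow> x < j" by (auto simp: order_less_le)
  with Cons show ?case by (simp add: axis_wedge_below)
qed simp

lemma ext_expand: "(A :: ('n::finite) ext) = (\<Sum>K\<in>UNIV. A $ K *s axis K 1)"
  by (rule vector_expand)

text \<open>Wedge lists of basis vectors span. An identity linear in \<open>A\<close> is thereby
  reduced to the unit and to its passage through one vector factor, which keeps the signs of basis
  elements out of the later proofs.\<close>

lemma ext_induct [case_names one vec add scale]:
  assumes one: "P (axis {} 1)"
    and vec: "\<And>x A. P A \<Longrightarrow> P (ext_vector x \<and>\<^sub>e A)"
    and add: "\<And>A B. P A \<Longrightarrow> P B \<Longrightarrow> P (A + B)"
    and scale: "\<And>c A. P A \<Longrightarrow> P (c *s A)"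
  shows "P A"
proof -
  have list: "P (wedge_list xs)" for xs
    by (induction xs) (auto intro: one vec)
  have zero: "P 0" using scale[OF one, of 0] by simp
  have axis: "P (axis K 1)" for K :: "'a set"
    using list[of "map (\<lambda>i. axis i 1) (sorted_list_of_set K)"] by (simp add: wedge_list_axis)
  have "P (\<Sum>K\<in>S. A $ K *s axis K 1)" for S :: "'a set set"
    by (induction S rule: infinite_finite_induct) (auto intro: zero add scale axis)
  then show ?thesis by (subst ext_expand)
qed

lemma one_wedge [simp]: "axis {} 1 \<and>\<^sub>e A = A"
proof (rule ext_eqI)
  fix K
  have "(axis {} 1 \<and>\<^sub>e A) $ K = (\<Sum>L\<in>{{}}. shuffle_sign L (K - L) * axis {} 1 $ L * A $ (K - L))"
    unfolding wedge_nth by (rule sum.mono_neutral_right) (auto simp: axis_def)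
  then show "(axis {} 1 \<and>\<^sub>e A) $ K = A $ K"
    by (simp add: axis_def shuffle_sign_def)
qed

lemma wedge_one [simp]: "A \<and>\<^sub>e axis {} 1 = A"
proof (rule ext_eqI)
  fix K
  have "(A \<and>\<^sub>e axis {} 1) $ K = (\<Sum>L\<in>{K}. shuffle_sign L (K - L) * A $ L * axis {} 1 $ (K - L))"
    unfolding wedge_nth by (rule sum.mono_neutral_right) (auto simp: axis_def)
  then show "(A \<and>\<^sub>e axis {} 1) $ K = A $ K"
    by (simp add: axis_def shuffle_sign_def)
qed

lemma grade_inv_nth: "grade_inv A $ K = (- 1) ^ card K * A $ K"
  by (simp add: grade_inv_def)

lemma grade_inv_add [simp]: "grade_inv (A + B) = grade_inv A + grade_inv B"
  by (rule ext_eqI) (simp add: grade_inv_nth algebra_simps)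

lemma grade_inv_scale [simp]: "grade_inv (c *s A) = c *s grade_inv A"
  by (rule ext_eqI) (simp add: grade_inv_nth)

lemma grade_inv_one [simp]: "grade_inv (axis {} 1) = axis {} 1"
  by (rule ext_eqI) (auto simp: grade_inv_nth axis_def)

lemma grade_inv_vec_wedge: "grade_inv (ext_vector x \<and>\<^sub>e A) = - (ext_vector x \<and>\<^sub>e grade_inv A)"
proof (rule ext_eqI)
  fix K
  have "(- 1) ^ card K * ((- 1) ^ card {j \<in> K. j < i} * x $ i * A $ (K - {i})) =
      - ((- 1) ^ card {j \<in> K. j < i} * x $ i * ((- 1) ^ card (K - {i}) * A $ (K - {i})))"
    if "i \<in> K" for i
  proof -
    have "(- 1 :: complex) ^ card K = - ((- 1) ^ card (K - {i}))"
      by (metis that card_Suc_Diff1 finite_code mult_minus1 power_Suc)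
    then show ?thesis by (simp only:) (simp add: mult_ac)
  qed
  then show "grade_inv (ext_vector x \<and>\<^sub>e A) $ K = (- (ext_vector x \<and>\<^sub>e grade_inv A)) $ K"
    by (simp add: grade_inv_nth vec_wedge_nth sum_distrib_left flip: sum_negf)
qed

lemma contract_one [simp]: "contract \<alpha> (axis {} 1) = 0"
  by (rule ext_eqI) (auto simp: contract_nth axis_def intro!: sum.neutral)

lemma contract_wedge:
  "contract \<alpha> (A \<and>\<^sub>e B) = contract \<alpha> A \<and>\<^sub>e B + grade_inv A \<and>\<^sub>e contract \<alpha> B"
proof (induction A rule: ext_induct)
  case (vec x A)
  then show ?case
    by (simp add: wedge_assoc contract_vec_wedge grade_inv_vec_wedge wedge_diff_left wedge_add_right)
qed (simp_all add: wedge_add_left vec.scale_right_distrib)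

lemma contract_contract [simp]: "contract \<alpha> (contract \<alpha> A) = 0"
  by (induction A rule: ext_induct) (simp_all add: contract_vec_wedge)

section \<open>Homogeneous elements and exterior powers\<close>

definition homog :: "nat \<Rightarrow> 'n::finite ext \<Rightarrow> bool" where
  "homog k A \<longleftrightarrow> (\<forall>K. card K \<noteq> k \<longrightarrow> A $ K = 0)"

lemma homog_add: "homog k A \<Longrightarrow> homog k B \<Longrightarrow> homog k (A + B)"
  by (simp add: homog_def)

lemma homog_scale: "homog k A \<Longrightarrow> homog k (c *s A)"
  by (simp add: homog_def)

lemma homog_zero [simp]: "homog k 0"
  by (simp add: homog_def)

lemma homog_sum: "(\<And>i. i \<in> S \<Longrightarrow> homog k (f i)) \<Longrightarrow> homog k (\<Sum>i\<in>S. f i)"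
  by (induction S rule: infinite_finite_induct) (auto intro: homog_add)

lemma homog_axis: "homog (card K) (axis K 1)"
  by (simp add: homog_def axis_def)

lemma homog_grade_inv: "homog k A \<Longrightarrow> grade_inv A = (- 1) ^ k *s A"
proof (rule ext_eqI)
  fix K assume "homog k A"
  then show "grade_inv A $ K = ((- 1) ^ k *s A) $ K"
    by (cases "card K = k") (simp_all add: grade_inv_nth homog_def)
qed

lemma homog_vec_wedge: "homog k A \<Longrightarrow> homog (Suc k) (ext_vector x \<and>\<^sub>e A)"
  unfolding homog_def
proof (intro allI impI)
  fix K :: "'a set" assume A: "\<forall>K. card K \<noteq> k \<longrightarrow> A $ K = 0" and K: "card K \<noteq> Suc k"
  have "A $ (K - {i}) = 0" if "i \<in> K" for i
  proof -
    have "card (K - {i}) \<noteq> k" using K that by (metis card_Suc_Diff1 finite_code)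
    with A show ?thesis by blast
  qed
  then show "(ext_vector x \<and>\<^sub>e A) $ K = 0"
    by (simp add: vec_wedge_nth)
qed

lemma homog_wedge:
  assumes "homog k A" "homog l B"
  shows "homog (k + l) (A \<and>\<^sub>e B)"
  unfolding homog_def
proof (intro allI impI)
  fix K :: "'a set" assume K: "card K \<noteq> k + l"
  have "A $ L * B $ (K - L) = 0" if "L \<subseteq> K" for L
  proof -
    have "card K = card L + card (K - L)"
      using card_Un_disjoint[of L "K - L"] that by (simp add: Un_absorb1)
    then have "card L \<noteq> k \<or> card (K - L) \<noteq> l" using K by auto
    then show ?thesis using assms by (auto simp: homog_def)
  qed
  then show "(A \<and>\<^sub>e B) $ K = 0"
    unfolding wedge_nth by (intro sum.neutral) (simp add: mult.assoc)
qed

text \<open>For \<open>k = 0\<close> the truncated \<open>k - 1\<close> is 0 as well; this is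
  harmless, since the contraction then vanishes (\<open>homog_0_contract\<close>).\<close>

lemma homog_contract:
  assumes "homog k A"
  shows "homog (k - 1) (contract \<alpha> A)"
  unfolding homog_def
proof (intro allI impI)
  fix K :: "'a set" assume K: "card K \<noteq> k - 1"
  have "A $ (insert i K) = 0" if "i \<in> - K" for i
    using assms K that unfolding homog_def by auto
  then show "contract \<alpha> A $ K = 0"
    by (simp add: contract_nth)
qed

lemma homog_0_contract: "homog 0 A \<Longrightarrow> contract \<alpha> A = 0"
  by (rule ext_eqI) (simp add: contract_nth homog_def)

lemma homog_0_imp: "homog 0 A \<Longrightarrow> A = A $ {} *s axis {} 1"
  by (rule ext_eqI) (auto simp: homog_def axis_def)

lemma homog_gt: "homog k (A :: ('n::finite) ext) \<Longrightarrow> CARD('n) < k \<Longrightarrow> A = 0"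
proof (rule ext_eqI)
  fix K :: "'n set" assume "homog k A" "CARD('n) < k"
  moreover have "card K \<le> CARD('n)" by (rule card_mono) auto
  ultimately show "A $ K = 0 $ K" by (simp add: homog_def)
qed

lemma homog_wedge_list: "homog (length xs) (wedge_list xs)"
proof (induction xs)
  case Nil
  then show ?case using homog_axis[of "{}"] by simp
qed (simp add: homog_vec_wedge)

lemma ext_power_UNIV: "ext_power UNIV k = {A. homog k A}"
proof (intro set_eqI iffI; simp)
  fix A assume "A \<in> ext_power UNIV k"
  then show "homog k A" unfolding ext_power_def
    by (induction rule: vec.span_induct_alt) (auto intro!: homog_add homog_scale homog_wedge_list)
next
  fix A :: "'a ext" assume A: "homog k A"
  have "A $ K *s axis K 1 \<in> ext_power UNIV k" for K
  proof (cases "card K = k")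
    case True
    have "axis K 1 = wedge_list (map (\<lambda>i. axis i 1) (sorted_list_of_set K))"
      by (simp add: wedge_list_axis)
    moreover have "length (map (\<lambda>i. axis i 1) (sorted_list_of_set K)) = k"
      using True by simp
    ultimately show ?thesis
      unfolding ext_power_def by (intro vec.span_scale vec.span_base) blast
  next
    case False
    then show ?thesis using A by (simp add: homog_def ext_power_def vec.span_zero)
  qed
  then have "(\<Sum>K\<in>UNIV. A $ K *s axis K 1) \<in> ext_power UNIV k"
    unfolding ext_power_def by (intro vec.span_sum) auto
  then show "A \<in> ext_power UNIV k" by (subst ext_expand)
qed

section \<open>Functoriality of the exterior algebra\<close>

lemma ext_map_add: "ext_map L (A + B) = ext_map L A + ext_map L B"
  by (simp add: ext_map_def vec.scale_left_distrib sum.distrib)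

lemma ext_map_scale: "ext_map L (c *s A) = c *s ext_map L A"
  by (simp add: ext_map_def vec.scale_sum_right)

lemma ext_map_zero [simp]: "ext_map L 0 = 0"
  by (simp add: ext_map_def)

lemma ext_map_minus: "ext_map L (- A) = - ext_map L A"
  using ext_map_scale[of L "- 1" A] by simp

lemma ext_map_sum: "ext_map L (\<Sum>i\<in>S. f i) = (\<Sum>i\<in>S. ext_map L (f i))"
  by (induction S rule: infinite_finite_induct) (auto simp: ext_map_add)

lemma ext_map_axis:
  "ext_map L (axis K 1) = wedge_list (map (\<lambda>i. L (axis i 1)) (sorted_list_of_set K))"
proof -
  have "ext_map L (axis K 1) =
      (\<Sum>M\<in>UNIV. if M = K then wedge_list (map (\<lambda>i. L (axis i 1)) (sorted_list_of_set K)) else 0)"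
    unfolding ext_map_def by (rule sum.cong) (auto simp: axis_def)
  then show ?thesis by simp
qed

lemma ext_map_one [simp]: "ext_map L (axis {} 1) = axis {} 1"
  by (simp add: ext_map_axis)

definition clinear :: "('n::finite cvec \<Rightarrow> 'm::finite cvec) \<Rightarrow> bool" where
  "clinear L \<longleftrightarrow> (\<forall>x y. L (x + y) = L x + L y) \<and> (\<forall>c x. L (c *s x) = c *s L x)"

lemma clinear_sum: "clinear L \<Longrightarrow> L (\<Sum>i\<in>S. f i) = (\<Sum>i\<in>S. L (f i))"
proof (induction S rule: infinite_finite_induct)
  case (infinite S)
  then show ?case using vec.scale_zero_left[of 0] unfolding clinear_def
    by (metis sum.infinite vec.scale_zero_left)
next
  case empty
  then show ?case unfolding clinear_def by (metis sum.empty vec.scale_zero_left)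
qed (simp add: clinear_def)

lemma ext_map_cons:
  assumes "\<And>j. j \<in> K \<Longrightarrow> i < j"
  shows "ext_map L (axis (insert i K) 1) = ext_vector (L (axis i 1)) \<and>\<^sub>e ext_map L (axis K 1)"
proof -
  have "i \<notin> K" using assms by blast
  then have "sorted_list_of_set (insert i K) = i # sorted_list_of_set K"
    using assms by (simp add: insort_is_Cons less_imp_le)
  then show ?thesis by (simp add: ext_map_axis)
qed

lemma axis_wedge_axis:
  "\<exists>c. ext_vector (axis i 1) \<and>\<^sub>e axis K 1 = c *s axis (insert i K) 1"
proof -
  have "(ext_vector (axis i 1) \<and>\<^sub>e axis K 1) $ L = 0" if L: "L \<noteq> insert i K" for L
    unfolding vec_wedge_nth
  proof (rule sum.neutral, rule ballI)
    fix l assume "l \<in> L"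
    then have "l \<noteq> i \<or> L - {l} \<noteq> K" using L by auto
    then show "(- 1) ^ card {j \<in> L. j < l} * axis i 1 $ l * axis K 1 $ (L - {l}) = (0::complex)"
      by (auto simp: axis_def)
  qed
  then have "ext_vector (axis i 1) \<and>\<^sub>e axis K 1 =
      (ext_vector (axis i 1) \<and>\<^sub>e axis K 1) $ insert i K *s axis (insert i K) 1"
    by (intro ext_eqI) (auto simp: axis_def)
  then show ?thesis by blast
qed

text \<open>\<open>ext_map\<close> is given on sorted basis elements, so a new index has to travel
  to its sorted place. Induction on the list moves it past each smaller head by anticommutation, on
  both sides at once; meeting an equal head kills both sides.\<close>

lemma ext_map_axis_wedge:
  "sorted xs \<Longrightarrow> distinct xs \<Longrightarrow>
    ext_map L (ext_vector (axis i 1) \<and>\<^sub>e axis (set xs) 1) =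
    ext_vector (L (axis i 1)) \<and>\<^sub>e ext_map L (axis (set xs) 1)"
proof (induction xs)
  case Nil
  then show ?case using ext_map_cons[of "{}" i L] by (simp add: ext_vector_axis)
next
  case (Cons y ys)
  have y: "\<And>j. j \<in> set ys \<Longrightarrow> y < j" using Cons.prems by (auto simp: order_less_le)
  consider "i < y" | "i = y" | "y < i" by fastforce
  then show ?case
  proof cases
    case 1
    then have "\<And>j. j \<in> set (y # ys) \<Longrightarrow> i < j" using y by fastforce
    then show ?thesis by (simp only: axis_wedge_below ext_map_cons)
  next
    case 2
    have "ext_vector (axis i 1) \<and>\<^sub>e axis (set (y # ys)) 1 = 0"
      by (simp add: 2 vec_wedge_self flip: axis_wedge_below[OF y])
    moreover have "ext_vector (L (axis i 1)) \<and>\<^sub>e ext_map L (axis (set (y # ys)) 1) = 0"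
      by (simp add: 2 vec_wedge_self ext_map_cons[OF y])
    ultimately show ?thesis by simp
  next
    case 3
    obtain c where c: "ext_vector (axis i 1) \<and>\<^sub>e axis (set ys) 1 = c *s axis (insert i (set ys)) 1"
      using axis_wedge_axis by blast
    define K where "K = insert i (set ys)"
    have "\<And>j. j \<in> K \<Longrightarrow> y < j" using y 3 by (auto simp: K_def)
    then have "ext_vector (axis y 1) \<and>\<^sub>e axis K 1 = axis (insert y K) 1"
      and "ext_map L (axis (insert y K) 1) = ext_vector (L (axis y 1)) \<and>\<^sub>e ext_map L (axis K 1)"
      by (simp_all add: axis_wedge_below ext_map_cons)
    note y' = this[unfolded K_def]
    have "ext_map L (ext_vector (axis i 1) \<and>\<^sub>e axis (set (y # ys)) 1) =
        - ext_map L (ext_vector (axis y 1) \<and>\<^sub>e (ext_vector (axis i 1) \<and>\<^sub>e axis (set ys) 1))"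
      by (simp add: vec_wedge_anticommute[of "axis i 1"] ext_map_minus flip: axis_wedge_below[OF y])
    also have "\<dots> = - (ext_vector (L (axis y 1)) \<and>\<^sub>e ext_map L (ext_vector (axis i 1) \<and>\<^sub>e axis (set ys) 1))"
      by (simp add: c ext_map_scale y')
    also have "\<dots> = ext_vector (L (axis i 1)) \<and>\<^sub>e ext_map L (axis (set (y # ys)) 1)"
      using Cons y by (simp add: ext_map_cons vec_wedge_anticommute[of "L (axis i 1)"])
    finally show ?thesis .
  qed
qed

lemma ext_map_vec_wedge:
  assumes "clinear L"
  shows "ext_map L (ext_vector x \<and>\<^sub>e A) = ext_vector (L x) \<and>\<^sub>e ext_map L A"
proof -
  have axis: "ext_map L (ext_vector (axis i 1) \<and>\<^sub>e axis K 1) =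
      ext_vector (L (axis i 1)) \<and>\<^sub>e ext_map L (axis K 1)" for i K
    using ext_map_axis_wedge[of "sorted_list_of_set K" L i] by simp
  have "ext_map L (ext_vector (axis i 1) \<and>\<^sub>e A) = ext_vector (L (axis i 1)) \<and>\<^sub>e ext_map L A" for i
    by (subst (1 2) ext_expand[of A])
      (simp add: wedge_sum_right ext_map_sum ext_map_scale axis)
  moreover have "L x = (\<Sum>i\<in>UNIV. x $ i *s L (axis i 1))"
    using assms by (subst vector_expand[of x]) (simp add: clinear_sum clinear_def)
  ultimately show ?thesis
    by (subst vector_expand[of x])
      (simp add: ext_vector_sum wedge_sum_left ext_map_sum ext_map_scale)
qed

lemma ext_map_comp:
  assumes "clinear L" "clinear M"
  shows "ext_map L (ext_map M A) = ext_map (\<lambda>x. L (M x)) A"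
proof -
  have "clinear (\<lambda>x. L (M x))" using assms by (simp add: clinear_def)
  then show ?thesis using assms
    by (induction A rule: ext_induct) (simp_all add: ext_map_vec_wedge ext_map_add ext_map_scale)
qed

lemma ext_map_id [simp]: "ext_map (\<lambda>x. x) A = A"
proof -
  have "clinear (\<lambda>x :: 'a cvec. x)" by (simp add: clinear_def)
  then show ?thesis
    by (induction A rule: ext_induct) (simp_all add: ext_map_vec_wedge ext_map_add ext_map_scale)
qed

lemma homog_ext_map: "homog k A \<Longrightarrow> homog k (ext_map L A)"
  unfolding ext_map_def
proof (rule homog_sum)
  fix K assume A: "homog k A"
  show "homog k (A $ K *s wedge_list (map (\<lambda>i. L (axis i 1)) (sorted_list_of_set K)))"
  proof (cases "card K = k")
    case True
    then show ?thesis
      using homog_wedge_list[of "map (\<lambda>i. L (axis i 1)) (sorted_list_of_set K)"]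
      by (intro homog_scale) simp
  next
    case False
    then show ?thesis using A by (simp add: homog_def)
  qed
qed

text \<open>Multiplication by \<open>t\<close> on the torus, which is also its own differential, and
  the identification of N_C with the tangent space at \<open>t\<close> that underlies
  \<open>rho\<close>.\<close>

definition diag_map :: "'n::finite cvec \<Rightarrow> 'n cvec \<Rightarrow> 'n cvec" where
  "diag_map t x = (\<chi> i. t $ i * x $ i)"

lemma clinear_diag_map: "clinear (diag_map t)"
  by (simp add: clinear_def diag_map_def vec_eq_iff algebra_simps)

lemma ext_map_diag: "ext_map (diag_map t) A $ K = (\<Prod>i\<in>K. t $ i) * A $ K"
proof -
  have list: "distinct xs \<Longrightarrow> wedge_list (map (\<lambda>i. diag_map t (axis i 1)) xs) =
      (\<Prod>i\<in>set xs. t $ i) *s wedge_list (map (\<lambda>i. axis i 1) xs)" for xs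
  proof (induction xs)
    case (Cons x xs)
    have "diag_map t (axis x 1) = t $ x *s axis x 1"
      by (simp add: vec_eq_iff diag_map_def axis_def)
    then show ?case using Cons by (simp add: mult.commute)
  qed simp
  have "ext_map (diag_map t) (axis M 1) = (\<Prod>i\<in>M. t $ i) *s axis M 1" for M
    by (simp add: ext_map_axis list wedge_list_axis)
  then have "ext_map (diag_map t) A = (\<Sum>M\<in>UNIV. (A $ M * (\<Prod>i\<in>M. t $ i)) *s axis M 1)"
    by (subst ext_expand[of A]) (simp add: ext_map_sum ext_map_scale)
  then show ?thesis by (simp add: axis_def if_distrib cong: if_cong)
qed

section \<open>Multivectors annihilated by given vectors\<close>

lemma vec_wedge_kill: "x \<in> vec.span (set xs) \<Longrightarrow> ext_vector x \<and>\<^sub>e wedge_list xs = 0"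
proof (induction rule: vec.span_induct_alt)
  case (step c x y)
  have "ext_vector x \<and>\<^sub>e wedge_list xs = 0" if "x \<in> set xs" for x :: "'a cvec" and xs
    using that
    by (induction xs) (auto simp: vec_wedge_self vec_wedge_anticommute[of x])
  then show ?case using step by (simp add: wedge_add_left)
qed simp

text \<open>Either the head lies in the span of the tail, which kills the product, or dropping it
  lowers dimension and length together.\<close>

lemma wedge_list_eq_0: "vec.dim (set xs) < length xs \<Longrightarrow> wedge_list xs = 0"
proof (induction xs)
  case (Cons x xs)
  show ?case
  proof (cases "x \<in> vec.span (set xs)")
    case True
    then show ?thesis by (simp add: vec_wedge_kill)
  next
    case False
    then have "vec.dim (set xs) < length xs" using Cons.prems by (simp add: vec.dim_insert)
    then show ?thesis using Cons by simp
  qed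
qed simp

text \<open>One factor too many: \<open>length bs + 1\<close> vectors in a span of dimension at most
  \<open>length bs\<close> are dependent.\<close>

lemma vec_wedge_ext_power:
  assumes "b \<in> vec.span (set bs)" "A \<in> ext_power (vec.span (set bs)) (length bs)"
  shows "ext_vector b \<and>\<^sub>e A = 0"
  using assms(2) unfolding ext_power_def
proof (induction rule: vec.span_induct_alt)
  case (step c x y)
  then obtain xs where xs: "x = wedge_list xs" "length xs = length bs" "set xs \<subseteq> vec.span (set bs)"
    by auto
  have "vec.dim (set (b # xs)) \<le> vec.dim (vec.span (set bs))"
    using xs assms(1) by (intro vec.dim_subset) auto
  also have "\<dots> \<le> length bs"
    using vec.dim_le_card'[of "set bs"] card_length[of bs] by simp
  finally have "wedge_list (b # xs) = 0"
    using xs by (intro wedge_list_eq_0) simp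
  then show ?case using step xs by (simp add: wedge_add_right)
qed simp

text \<open>Linear independence of \<open>bs\<close> in witnessed form: contraction with the dual
  covectors is what allows division by \<open>wedge_list bs\<close>.\<close>

definition dual_lists :: "'n::finite cvec list \<Rightarrow> 'n cvec list \<Rightarrow> bool" where
  "dual_lists \<alpha>s bs \<longleftrightarrow> length \<alpha>s = length bs \<and>
    (\<forall>i<length bs. \<forall>j<length bs. cdot (\<alpha>s ! i) (bs ! j) = (if i = j then 1 else 0))"

lemma dual_lists_Cons:
  assumes "dual_lists (\<alpha> # \<alpha>s) (b # bs)"
  shows "dual_lists \<alpha>s bs" "cdot \<alpha> b = 1" "\<And>c. c \<in> set bs \<Longrightarrow> cdot \<alpha> c = 0"
proof -
  have len: "length \<alpha>s = length bs" using assms by (simp add: dual_lists_def)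
  have *: "cdot ((\<alpha> # \<alpha>s) ! i) ((b # bs) ! j) = (if i = j then 1 else 0)"
    if "i < Suc (length bs)" "j < Suc (length bs)" for i j
    using assms that by (simp add: dual_lists_def)
  show "dual_lists \<alpha>s bs"
    unfolding dual_lists_def using *[of "Suc _" "Suc _"] len by simp
  show "cdot \<alpha> b = 1" using *[of 0 0] by simp
  show "cdot \<alpha> c = 0" if c: "c \<in> set bs" for c
  proof -
    obtain j where "j < length bs" "c = bs ! j" using c by (auto simp: in_set_conv_nth)
    then show ?thesis using *[of 0 "Suc j"] by simp
  qed
qed

text \<open>If b \<and> A = 0 and <\<alpha>, b> = 1, the derivation rule gives A = b \<and> \<iota>A
  with contraction by \<alpha>. The quotient is still annihilated by the remaining vectors, because
  \<alpha> vanishes on them, so the division can be repeated.\<close>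

lemma divisible_by_wedge_list:
  assumes "dual_lists \<alpha>s bs" "\<And>b. b \<in> set bs \<Longrightarrow> ext_vector b \<and>\<^sub>e A = 0"
  shows "A = wedge_list bs \<and>\<^sub>e fold contract \<alpha>s A"
  using assms
proof (induction bs arbitrary: \<alpha>s A)
  case Nil
  then show ?case by (simp add: dual_lists_def)
next
  case (Cons b bs)
  obtain \<alpha> \<alpha>s' where \<alpha>s: "\<alpha>s = \<alpha> # \<alpha>s'"
    using Cons.prems(1) by (cases \<alpha>s) (auto simp: dual_lists_def)
  note dual = dual_lists_Cons[OF Cons.prems(1)[unfolded \<alpha>s]]
  have kill: "cdot \<alpha> c *s A - ext_vector c \<and>\<^sub>e contract \<alpha> A = 0" if "c \<in> set (b # bs)" for c
    using contract_vec_wedge[of \<alpha> c A] Cons.prems(2)[OF that] by simp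
  have "contract \<alpha> A = wedge_list bs \<and>\<^sub>e fold contract \<alpha>s' (contract \<alpha> A)"
  proof (rule Cons.IH[OF dual(1)])
    fix c assume "c \<in> set bs"
    then show "ext_vector c \<and>\<^sub>e contract \<alpha> A = 0" using kill[of c] dual(3)[of c] by simp
  qed
  then have "ext_vector b \<and>\<^sub>e contract \<alpha> A =
      wedge_list (b # bs) \<and>\<^sub>e fold contract \<alpha>s' (contract \<alpha> A)"
    by (simp add: wedge_assoc)
  moreover have "A = ext_vector b \<and>\<^sub>e contract \<alpha> A"
    using kill[of b] dual(2) by simp
  ultimately show ?case by (simp add: \<alpha>s)
qed

lemma homog_fold_contract:
  "homog k A \<Longrightarrow> homog (k - length \<alpha>s) (fold contract \<alpha>s A)"
proof (induction \<alpha>s arbitrary: k A)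
  case (Cons \<alpha> \<alpha>s)
  have "homog (k - 1) (contract \<alpha> A)" using Cons.prems by (rule homog_contract)
  from Cons.IH[OF this] show ?case by simp
qed simp

lemma fold_contract_eq_0:
  "homog k A \<Longrightarrow> k < length \<alpha>s \<Longrightarrow> fold contract \<alpha>s A = 0"
proof (induction \<alpha>s arbitrary: k A)
  case (Cons \<alpha> \<alpha>s)
  show ?case
  proof (cases k)
    case 0
    have "fold contract \<alpha>s 0 = 0" by (induction \<alpha>s) auto
    then show ?thesis using Cons.prems 0 by (simp add: homog_0_contract)
  next
    case (Suc l)
    then show ?thesis using Cons homog_contract[OF Cons.prems(1), of \<alpha>] by simp
  qed
qed simp

text \<open>Contraction with the first dual covector strips the first factor.\<close>

lemma wedge_list_nonzero: "dual_lists \<alpha>s bs \<Longrightarrow> wedge_list bs \<noteq> 0"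
proof (induction bs arbitrary: \<alpha>s)
  case Nil
  then show ?case by (simp add: axis_eq_0_iff)
next
  case (Cons b bs)
  obtain \<alpha> \<alpha>s' where \<alpha>s: "\<alpha>s = \<alpha> # \<alpha>s'"
    using Cons.prems(1) by (cases \<alpha>s) (auto simp: dual_lists_def)
  note dual = dual_lists_Cons[OF Cons.prems(1)[unfolded \<alpha>s]]
  have "contract \<alpha> (wedge_list xs) = 0" if "\<And>c. c \<in> set xs \<Longrightarrow> cdot \<alpha> c = 0" for xs
    using that by (induction xs) (simp_all add: contract_vec_wedge)
  then have "contract \<alpha> (wedge_list (b # bs)) = wedge_list bs"
    using dual by (simp add: contract_vec_wedge)
  then show ?case using Cons.IH[OF dual(1)] by (metis contract_zero)
qed

text \<open>Turns the spanning description of N_I^k into annihilation by a basis. Generators are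
  annihilated since their first factor is a top form of the span; conversely an annihilated form is
  divisible by \<open>wedge_list bs\<close>, with the iterated contraction as quotient.\<close>

lemma span_wedge_ext_power:
  assumes dual: "dual_lists \<alpha>s bs" and k: "length bs \<le> k"
  shows "vec.span {A \<and>\<^sub>e B |A B. A \<in> ext_power (vec.span (set bs)) (length bs) \<and>
      B \<in> ext_power UNIV (k - length bs)} =
    {A. homog k A \<and> (\<forall>b\<in>set bs. ext_vector b \<and>\<^sub>e A = 0)}" (is "vec.span ?G = ?R")
proof (intro set_eqI iffI)
  fix X assume "X \<in> vec.span ?G"
  then show "X \<in> ?R"
  proof (induction rule: vec.span_induct_alt)
    case (step c x y)
    then obtain A B where AB: "x = A \<and>\<^sub>e B" "A \<in> ext_power (vec.span (set bs)) (length bs)"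
      "homog (k - length bs) B" by (auto simp: ext_power_UNIV)
    have "homog (length bs) A"
      using AB(2) unfolding ext_power_def
      by (induction rule: vec.span_induct_alt)
        (auto intro!: homog_add homog_scale simp: homog_wedge_list dest!: sym[of _ "length bs"])
    from homog_wedge[OF this AB(3)] have "homog k x" using k by (simp add: AB(1))
    moreover have "ext_vector b \<and>\<^sub>e x = 0" if "b \<in> set bs" for b
      using vec_wedge_ext_power[OF vec.span_base[OF that] AB(2)]
      by (simp add: AB(1) flip: wedge_assoc)
    ultimately show ?case using step by (auto simp: wedge_add_right intro!: homog_add homog_scale)
  qed simp
next
  fix X assume X: "X \<in> ?R"
  have "X = wedge_list bs \<and>\<^sub>e fold contract \<alpha>s X"
    using divisible_by_wedge_list[OF dual] X by auto
  moreover have "fold contract \<alpha>s X \<in> ext_power UNIV (k - length bs)"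
    using homog_fold_contract[of k X \<alpha>s] X dual by (simp add: ext_power_UNIV dual_lists_def)
  moreover have "wedge_list bs \<in> ext_power (vec.span (set bs)) (length bs)"
    unfolding ext_power_def by (intro vec.span_base) (auto intro: vec.span_base)
  ultimately show "X \<in> vec.span ?G" by (intro vec.span_base) blast
qed

text \<open>Such an \<open>A\<close> is divisible by a form of larger degree than its own; the
  quotient is a contraction by more than \<open>k\<close> covectors and hence 0.\<close>

lemma annihilated_low_degree:
  assumes "dual_lists \<alpha>s bs" "\<And>b. b \<in> set bs \<Longrightarrow> ext_vector b \<and>\<^sub>e A = 0"
    and "homog k A" "k < length bs"
  shows "A = 0"
  using divisible_by_wedge_list[OF assms(1,2)] fold_contract_eq_0[OF assms(3), of \<alpha>s] assms(1,4)
  by (simp add: dual_lists_def)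

section \<open>Smooth complete fans\<close>

lemma real_of_lattice_nth [simp]: "real_of_lattice v $ i = of_int (v $ i)"
  by (simp add: real_of_lattice_def)

lemma real_of_lattice_scale: "real_of_lattice (k *s v) = of_int k *\<^sub>R real_of_lattice v"
  by (simp add: vec_eq_iff)

lemma inner_real_of_lattice:
  "real_of_lattice v \<bullet> real_of_lattice w = of_int (\<Sum>i\<in>UNIV. v $ i * w $ i)"
  by (simp add: inner_vec_def)

lemma real_of_lattice_inject [simp]: "real_of_lattice v = real_of_lattice w \<longleftrightarrow> v = w"
  by (simp add: vec_eq_iff)

lemma real_of_lattice_eq_0 [simp]: "real_of_lattice v = 0 \<longleftrightarrow> v = 0"
  by (simp add: vec_eq_iff)

lemma real_of_lattice_0 [simp]: "real_of_lattice 0 = 0"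
  by simp

text \<open>The rows of \<open>C\<close> are the basis of \<open>M\<close> dual to the rows of
  \<open>B\<close>, that is, the exponents of the coordinate characters of the chart of
  \<open>B\<close>.\<close>

definition lattice_dual :: "('n::finite ivec, 'n) vec \<Rightarrow> ('n ivec, 'n) vec \<Rightarrow> bool" where
  "lattice_dual B C \<longleftrightarrow>
    (\<forall>i j. real_of_lattice (B $ i) \<bullet> real_of_lattice (C $ j) = (if i = j then 1 else 0)) \<and>
    (\<forall>v. v = (\<Sum>j\<in>UNIV. (v \<bullet> real_of_lattice (C $ j)) *\<^sub>R real_of_lattice (B $ j)))"

text \<open>The dual basis consists of the columns of the inverse matrix, which is integral.\<close>

lemma invertible_lattice_dual:
  fixes B :: "('n::finite ivec, 'n) vec"
  assumes "invertible B"
  obtains C where "lattice_dual B C"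
proof -
  obtain A where A: "B ** A = mat 1" "A ** B = mat 1"
    using assms by (auto simp: invertible_def)
  have 1: "(\<Sum>k\<in>UNIV. B $ i $ k * A $ k $ j) = (if i = j then 1 else 0)" for i j
    using arg_cong[OF A(1), of "\<lambda>M. M $ i $ j"] by (simp add: matrix_matrix_mult_def mat_def)
  have 2: "(\<Sum>k\<in>UNIV. A $ i $ k * B $ k $ j) = (if i = j then 1 else 0)" for i j
    using arg_cong[OF A(2), of "\<lambda>M. M $ i $ j"] by (simp add: matrix_matrix_mult_def mat_def)
  have 3: "(\<Sum>k\<in>UNIV. real_of_int (A $ i $ k) * real_of_int (B $ k $ j)) = (if i = j then 1 else 0)" for i j
    using arg_cong[OF 2[of i j], of real_of_int] by simp
  have "v = (\<Sum>j\<in>UNIV. (v \<bullet> real_of_lattice (transpose A $ j)) *\<^sub>R real_of_lattice (B $ j))" for v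
  proof -
    have "(\<Sum>j\<in>UNIV. (v \<bullet> real_of_lattice (transpose A $ j)) *\<^sub>R real_of_lattice (B $ j)) $ k = v $ k" for k
    proof -
      have "(\<Sum>j\<in>UNIV. (v \<bullet> real_of_lattice (transpose A $ j)) *\<^sub>R real_of_lattice (B $ j)) $ k
          = (\<Sum>j\<in>UNIV. \<Sum>i\<in>UNIV. v $ i * (of_int (A $ i $ j) * of_int (B $ j $ k)))"
        by (simp add: inner_vec_def transpose_def sum_distrib_right mult.assoc)
      also have "\<dots> = (\<Sum>i\<in>UNIV. v $ i * (\<Sum>j\<in>UNIV. of_int (A $ i $ j) * of_int (B $ j $ k)))"
        by (subst sum.swap) (simp add: sum_distrib_left)
      also have "\<dots> = v $ k"
        by (simp add: 3 if_distrib cong: if_cong)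
      finally show ?thesis .
    qed
    then show ?thesis by (simp add: vec_eq_iff)
  qed
  then have "lattice_dual B (transpose A)"
    unfolding lattice_dual_def inner_real_of_lattice by (simp add: transpose_def 1)
  then show thesis by (rule that)
qed

lemma lattice_dual_inner:
  "lattice_dual B C \<Longrightarrow>
    real_of_lattice (B $ i) \<bullet> real_of_lattice (C $ j) = (if i = j then 1 else 0)"
  by (simp add: lattice_dual_def)

lemma lattice_dual_expand:
  "lattice_dual B C \<Longrightarrow>
    v = (\<Sum>j\<in>UNIV. (v \<bullet> real_of_lattice (C $ j)) *\<^sub>R real_of_lattice (B $ j))"
  unfolding lattice_dual_def by blast

lemma lattice_dual_nonzero:
  assumes "lattice_dual B C"
  shows "B $ j \<noteq> 0" "real_of_lattice (C $ j) \<noteq> 0"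
  using lattice_dual_inner[OF assms, of j j] by auto

lemma convex_cone_sum:
  assumes "convex_cone T" "\<And>j. j \<in> S \<Longrightarrow> f j \<in> T"
  shows "sum f S \<in> T"
  using assms(2)
proof (induction S rule: infinite_finite_induct)
  case (insert x F)
  then show ?case using convex_cone_add[OF assms(1)] by auto
qed (use convex_cone_contains_0[OF assms(1)] in auto)

text \<open>The cone generated by the rows of \<open>B\<close> with index in \<open>K\<close>,
  described by inequalities in the dual coordinates; faces, closedness and dimension are easier to
  read off from these than from the hull.\<close>

definition coord_cone :: "('n::finite ivec, 'n) vec \<Rightarrow> 'n set \<Rightarrow> 'n rvec set" where
  "coord_cone C K = {v. \<forall>j. 0 \<le> v \<bullet> real_of_lattice (C $ j) \<and>
      (j \<notin> K \<longrightarrow> v \<bullet> real_of_lattice (C $ j) = 0)}"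

lemma convex_cone_coord_cone: "convex_cone (coord_cone C K)"
  by (rule convex_cone_iff[THEN iffD2]) (auto simp: coord_cone_def inner_add_left)

lemma cone_hull_eq_coord_cone:
  assumes dual: "lattice_dual B C"
  shows "convex_cone hull ((\<lambda>j. real_of_lattice (B $ j)) ` K) = coord_cone C K"
proof (intro equalityI)
  show "convex_cone hull ((\<lambda>j. real_of_lattice (B $ j)) ` K) \<subseteq> coord_cone C K"
    by (intro hull_minimal convex_cone_coord_cone)
      (auto simp: coord_cone_def lattice_dual_inner[OF dual])
  show "coord_cone C K \<subseteq> convex_cone hull ((\<lambda>j. real_of_lattice (B $ j)) ` K)" (is "_ \<subseteq> ?H")
  proof
    fix v assume v: "v \<in> coord_cone C K"
    have "(v \<bullet> real_of_lattice (C $ j)) *\<^sub>R real_of_lattice (B $ j) \<in> ?H" for j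
    proof (cases "j \<in> K")
      case True
      then have "real_of_lattice (B $ j) \<in> ?H" by (intro hull_inc) auto
      then show ?thesis using v by (simp add: coord_cone_def convex_cone_hull_mul)
    next
      case False
      then show ?thesis using v by (simp add: coord_cone_def convex_cone_hull_contains_0)
    qed
    then show "v \<in> ?H"
      by (subst lattice_dual_expand[OF dual])
        (intro convex_cone_sum convex_cone_convex_cone_hull)
  qed
qed

lemma closed_coord_cone: "closed (coord_cone C K)"
proof -
  have "coord_cone C K = (\<Inter>j. {v. 0 \<le> v \<bullet> real_of_lattice (C $ j)}) \<inter>
      (\<Inter>j\<in>- K. {v. v \<bullet> real_of_lattice (C $ j) = 0})"
    by (auto simp: coord_cone_def)
  moreover have "closed {v. 0 \<le> v \<bullet> real_of_lattice (C $ j)}"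
    and "closed {v. v \<bullet> real_of_lattice (C $ j) = 0}" for j
    by (auto intro!: closed_Collect_le closed_Collect_eq continuous_intros)
  ultimately show ?thesis by (auto intro!: closed_INT closed_Int)
qed

lemma negligible_coord_cone:
  assumes "lattice_dual B C" "K \<noteq> UNIV"
  shows "negligible (coord_cone C K)"
proof -
  obtain j where j: "j \<notin> K" using assms(2) by auto
  have "negligible {v. real_of_lattice (C $ j) \<bullet> v = 0}"
    using lattice_dual_nonzero(2)[OF assms(1)] by (intro negligible_hyperplane) auto
  moreover have "coord_cone C K \<subseteq> {v. real_of_lattice (C $ j) \<bullet> v = 0}"
    using j by (auto simp: coord_cone_def inner_commute)
  ultimately show ?thesis by (rule negligible_subset)
qed

lemma coord_cone_face:
  assumes "L \<subseteq> K"
  shows "coord_cone C L face_of coord_cone C K"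
proof -
  have "a \<in> coord_cone C L \<and> b \<in> coord_cone C L"
    if a: "a \<in> coord_cone C K" and b: "b \<in> coord_cone C K" and x: "x \<in> coord_cone C L"
      and seg: "x \<in> open_segment a b" for a b x
  proof -
    obtain u where u: "0 < u" "u < 1" "x = (1 - u) *\<^sub>R a + u *\<^sub>R b"
      using seg by (auto simp: in_segment)
    have "a \<bullet> real_of_lattice (C $ j) = 0 \<and> b \<bullet> real_of_lattice (C $ j) = 0" if "j \<notin> L" for j
    proof -
      have ge: "0 \<le> (1 - u) * (a \<bullet> real_of_lattice (C $ j))" "0 \<le> u * (b \<bullet> real_of_lattice (C $ j))"
        using a b u by (auto simp: coord_cone_def)
      have "(1 - u) * (a \<bullet> real_of_lattice (C $ j)) + u * (b \<bullet> real_of_lattice (C $ j)) = 0"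
        using x that by (simp add: u(3) coord_cone_def inner_add_left)
      with ge have "(1 - u) * (a \<bullet> real_of_lattice (C $ j)) = 0"
        "u * (b \<bullet> real_of_lattice (C $ j)) = 0" by linarith+
      then show ?thesis using u by simp
    qed
    then show ?thesis using a b by (auto simp: coord_cone_def)
  qed
  moreover have "coord_cone C L \<subseteq> coord_cone C K" using assms by (auto simp: coord_cone_def)
  moreover have "convex (coord_cone C L)"
    using convex_cone_coord_cone[of C L] by (simp add: convex_cone_def)
  ultimately show ?thesis unfolding face_of_def by blast
qed

lemma aff_dim_coord_cone:
  assumes dual: "lattice_dual B C"
  shows "aff_dim (coord_cone C K) = int (card K)"
proof -
  let ?r = "\<lambda>j. real_of_lattice (B $ j)"
  have inj: "inj ?r"
  proof (rule injI)
    fix i j assume "?r i = ?r j"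
    then have "?r i \<bullet> real_of_lattice (C $ i) = ?r j \<bullet> real_of_lattice (C $ i)" by (simp only:)
    then show "i = j" by (simp only: lattice_dual_inner[OF dual]) (simp split: if_splits)
  qed
  have "independent (?r ` K)"
    unfolding dependent_def
  proof
    assume "\<exists>a\<in>?r ` K. a \<in> span (?r ` K - {a})"
    then obtain j where j: "?r j \<in> span (?r ` K - {?r j})" by auto
    have "span (?r ` K - {?r j}) \<subseteq> {x. real_of_lattice (C $ j) \<bullet> x = 0}"
      by (intro span_minimal subspace_hyperplane)
        (auto simp: inner_commute lattice_dual_inner[OF dual])
    with j lattice_dual_inner[OF dual, of j j] show False by (auto simp: inner_commute)
  qed
  then have "dim (?r ` K) = card K"
    using card_image[of ?r K] inj_on_subset[OF inj] by (simp add: dim_eq_card_independent)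
  moreover have "dim (coord_cone C K) = dim (?r ` K)"
  proof -
    have "coord_cone C K \<subseteq> span (?r ` K)"
      unfolding cone_hull_eq_coord_cone[OF dual, symmetric]
      by (intro hull_minimal convex_cone_span) (auto intro: span_base)
    moreover have "?r ` K \<subseteq> span (coord_cone C K)"
      unfolding cone_hull_eq_coord_cone[OF dual, symmetric] by (auto intro!: span_base hull_inc)
    ultimately show ?thesis
      by (meson dim_mono order_antisym)
  qed
  moreover have "0 \<in> affine hull (coord_cone C K)"
    by (rule hull_inc) (simp add: coord_cone_def)
  ultimately show ?thesis by (simp add: aff_dim_zero)
qed

text \<open>The dual basis is integral, so the coordinate of a lattice point on the ray is an
  integer, and it is nonnegative.\<close>

lemma lattice_points_ray:
  assumes dual: "lattice_dual B C"
  shows "{w. real_of_lattice w \<in> coord_cone C {j}} = range (\<lambda>k::nat. int k *s B $ j)"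
proof (intro set_eqI iffI)
  fix w assume "w \<in> {w. real_of_lattice w \<in> coord_cone C {j}}"
  then have w: "real_of_lattice w \<in> coord_cone C {j}" by simp
  define k where "k = (\<Sum>i\<in>UNIV. w $ i * C $ j $ i)"
  have k: "real_of_lattice w \<bullet> real_of_lattice (C $ j) = of_int k"
    unfolding k_def inner_real_of_lattice ..
  have "real_of_lattice w = (\<Sum>i\<in>UNIV. (real_of_lattice w \<bullet> real_of_lattice (C $ i)) *\<^sub>R real_of_lattice (B $ i))"
    by (rule lattice_dual_expand[OF dual])
  also have "\<dots> = (\<Sum>i\<in>{j}. (real_of_lattice w \<bullet> real_of_lattice (C $ i)) *\<^sub>R real_of_lattice (B $ i))"
    using w by (intro sum.mono_neutral_right) (auto simp: coord_cone_def)
  also have "\<dots> = real_of_lattice (k *s B $ j)" using k by (simp add: real_of_lattice_scale)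
  finally have "w = k *s B $ j" by simp
  moreover have "0 \<le> real_of_int k"
    unfolding k[symmetric] using w by (simp add: coord_cone_def)
  then have "k = int (nat k)" by simp
  ultimately show "w \<in> range (\<lambda>k::nat. int k *s B $ j)" by (metis rangeI)
qed (auto simp: coord_cone_def real_of_lattice_scale lattice_dual_inner[OF dual])

text \<open>Two generators of the same monoid of lattice points are natural multiples of each other
  and hence equal, which justifies the definite description in \<open>prim_gen\<close>.\<close>

lemma prim_gen_coord_cone:
  assumes dual: "lattice_dual B C"
  shows "prim_gen (coord_cone C {j}) = B $ j"
  unfolding prim_gen_def lattice_points_ray[OF dual]
proof (rule the_equality)
  fix v assume v: "range (\<lambda>k::nat. int k *s B $ j) = range (\<lambda>k::nat. int k *s v)"
  have "B $ j \<in> range (\<lambda>k::nat. int k *s v)"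
    unfolding v[symmetric] by (rule range_eqI[of _ _ 1]) simp
  then obtain k where k: "B $ j = int k *s v" by auto
  have "v \<in> range (\<lambda>k::nat. int k *s B $ j)"
    unfolding v by (rule range_eqI[of _ _ 1]) simp
  then obtain l where l: "v = int l *s B $ j" by auto
  have "B $ j = int (k * l) *s B $ j" using k l by (metis of_nat_mult vector_smult_assoc)
  moreover obtain i where "B $ j $ i \<noteq> 0"
    using lattice_dual_nonzero(1)[OF dual, of j] by (auto simp: vec_eq_iff)
  ultimately have "int (k * l) = 1"
    by (metis mult_cancel_right1 vector_smult_component)
  then have "l = 1" by (metis of_nat_eq_1_iff nat_mult_eq_1_iff)
  then show "v = B $ j" using l by simp
qed simp

definition gens :: "'n::finite rvec set set \<Rightarrow> 'n ivec set" where
  "gens \<Delta> = prim_gen ` rays \<Delta>"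

lemma chart_basesD:
  assumes "B \<in> chart_bases \<Delta>"
  obtains C where "lattice_dual B C" "coord_cone C UNIV \<in> \<Delta>"
proof -
  obtain C where "lattice_dual B C"
    using assms invertible_lattice_dual by (auto simp: chart_bases_def)
  with assms show thesis
    using that cone_hull_eq_coord_cone[of B C UNIV] by (auto simp: chart_bases_def)
qed

section \<open>Maximal cones, charts and rays of a smooth complete fan\<close>

context
  fixes \<Delta> :: "'n::finite rvec set set"
  assumes complete: "smooth_complete_fan \<Delta>"
begin

lemma fan: "fan \<Delta>" and cover: "\<Union>\<Delta> = UNIV"
  using complete by (auto simp: smooth_complete_fan_def)

lemma coneE:
  assumes "\<sigma> \<in> \<Delta>"
  obtains B C K where "lattice_dual B C" "invertible B" "\<sigma> = coord_cone C K"
proof -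
  obtain B :: "('n ivec, 'n) vec" and K where "invertible B" and \<sigma>: "\<sigma> = convex_cone hull ((\<lambda>j. real_of_lattice (B $ j)) ` K)"
    using assms complete unfolding smooth_complete_fan_def smooth_fan_def by blast
  moreover obtain C where "lattice_dual B C" using invertible_lattice_dual[OF \<open>invertible B\<close>] .
  ultimately show thesis using that cone_hull_eq_coord_cone by metis
qed

lemma chart_basesI:
  assumes "invertible B" "lattice_dual B C" "coord_cone C UNIV \<in> \<Delta>"
  shows "B \<in> chart_bases \<Delta>"
  using assms cone_hull_eq_coord_cone[of B C UNIV] by (simp add: chart_bases_def)

text \<open>
  The union of the full-dimensional cones is closed, and its open complement is covered by the
  remaining cones, which are negligible.
\<close>

lemma full_cone_exists: "\<exists>B C. B \<in> chart_bases \<Delta> \<and> lattice_dual B C \<and> v \<in> coord_cone C UNIV"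
proof -
  define F where "F = {\<sigma>\<in>\<Delta>. \<exists>B C. B \<in> chart_bases \<Delta> \<and> lattice_dual B C \<and> \<sigma> = coord_cone C UNIV}"
  have fin: "finite \<Delta>" using fan by (simp add: fan_def)
  have "closed (\<Union>F)"
    by (rule closed_Union) (use fin in \<open>auto simp: F_def closed_coord_cone\<close>)
  then have "open (- \<Union>F)" by (rule open_Compl)
  moreover have "negligible (- \<Union>F)"
  proof (rule negligible_subset)
    show "- \<Union>F \<subseteq> \<Union>(\<Delta> - F)" using cover by auto
    show "negligible (\<Union>(\<Delta> - F))"
    proof (rule negligible_Union)
      fix \<sigma> assume \<sigma>: "\<sigma> \<in> \<Delta> - F"
      then obtain B C K where "lattice_dual B C" "invertible B" "\<sigma> = coord_cone C K"
        using coneE by blast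
      moreover from this \<sigma> have "K \<noteq> UNIV" using chart_basesI by (auto simp: F_def)
      ultimately show "negligible \<sigma>" using negligible_coord_cone by blast
    qed (use fin in simp)
  qed
  ultimately have "- \<Union>F = {}" using open_not_negligible by blast
  then obtain \<sigma> where "\<sigma> \<in> F" "v \<in> \<sigma>" by auto
  then show ?thesis by (auto simp: F_def)
qed

lemma rayE:
  assumes "\<alpha> \<in> rays \<Delta>"
  obtains B C j where "lattice_dual B C" "\<alpha> = coord_cone C {j}"
proof -
  obtain B C K where BCK: "lattice_dual B C" "\<alpha> = coord_cone C K"
    using assms coneE by (metis (no_types, lifting) mem_Collect_eq rays_def)
  then have "card K = 1" using assms aff_dim_coord_cone[OF BCK(1)] by (simp add: rays_def)
  then obtain j where "K = {j}" by (auto simp: card_1_singleton_iff)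
  with BCK show thesis using that by blast
qed

lemma chart_basis_row_in_gens:
  assumes "B \<in> chart_bases \<Delta>"
  shows "B $ j \<in> gens \<Delta>"
proof -
  obtain C where C: "lattice_dual B C" "coord_cone C UNIV \<in> \<Delta>"
    using chart_basesD[OF assms] .
  have "coord_cone C {j} face_of coord_cone C UNIV" by (rule coord_cone_face) auto
  moreover have "0 \<in> coord_cone C {j}" by (simp add: coord_cone_def)
  ultimately have "coord_cone C {j} \<in> \<Delta>" using fan C(2) unfolding fan_def by blast
  then have "coord_cone C {j} \<in> rays \<Delta>" by (simp add: rays_def aff_dim_coord_cone[OF C(1)])
  then show ?thesis using prim_gen_coord_cone[OF C(1), of j] unfolding gens_def by (metis imageI)
qed

text \<open>
  A ray is a face of any full-dimensional cone of the fan that contains its generator, hence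
  contains one of the basis vectors of that cone; primitivity identifies the two.
\<close>

lemma gens_chart_basis_row:
  assumes "v \<in> gens \<Delta>"
  obtains B j where "B \<in> chart_bases \<Delta>" "v = B $ j"
proof -
  obtain \<alpha> where \<alpha>: "\<alpha> \<in> rays \<Delta>" "v = prim_gen \<alpha>" using assms by (auto simp: gens_def)
  obtain B C j where BC: "lattice_dual B C" "\<alpha> = coord_cone C {j}" using rayE[OF \<alpha>(1)] .
  have v: "v = B $ j" using \<alpha>(2) prim_gen_coord_cone BC by metis
  obtain B' C' where B': "B' \<in> chart_bases \<Delta>" "lattice_dual B' C'"
    and in_cone: "real_of_lattice v \<in> coord_cone C' UNIV"
    using full_cone_exists by blast
  define \<sigma> where "\<sigma> = coord_cone C' UNIV"
  have "\<sigma> \<in> \<Delta>" using B' cone_hull_eq_coord_cone[of B' C' UNIV]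
    by (simp add: chart_bases_def \<sigma>_def)
  moreover have "\<alpha> \<subseteq> \<sigma>"
    unfolding BC(2) cone_hull_eq_coord_cone[OF BC(1), symmetric] \<sigma>_def
    by (rule hull_minimal) (use in_cone v in \<open>auto simp: convex_cone_coord_cone\<close>)
  moreover have "\<alpha> \<in> \<Delta>" using \<alpha>(1) by (simp add: rays_def)
  ultimately have face: "\<alpha> face_of \<sigma>"
    using fan unfolding fan_def by (metis inf.absorb_iff1)
  let ?c = "\<lambda>l. real_of_lattice v \<bullet> real_of_lattice (C' $ l)"
  have "\<exists>l. ?c l \<noteq> 0"
  proof (rule ccontr)
    assume "\<nexists>l. ?c l \<noteq> 0"
    then have "real_of_lattice v = 0" by (subst lattice_dual_expand[OF B'(2)]) simp
    then show False using v lattice_dual_nonzero(1)[OF BC(1)] by simp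
  qed
  then obtain l where l: "?c l > 0" using in_cone by (auto simp: coord_cone_def order_less_le)
  \<comment> \<open>Twice the part of \<open>v\<close> along \<open>B' $ l\<close>, and twice the
    rest: both lie in the big cone and \<open>v\<close> is their midpoint, so the face property puts
    \<open>?a\<close> on the ray. If the two points coincide the open segment is empty, but then
    \<open>?a\<close> is \<open>v\<close> itself.\<close>
  let ?a = "(2 * ?c l) *\<^sub>R real_of_lattice (B' $ l)" and ?b = "2 *\<^sub>R real_of_lattice v - (2 * ?c l) *\<^sub>R real_of_lattice (B' $ l)"
  have v_in: "real_of_lattice v \<in> \<alpha>"
    by (simp add: BC(2) v coord_cone_def lattice_dual_inner[OF BC(1)])
  have "?a \<in> \<alpha>"
  proof (cases "?a = ?b")
    case True
    then have "?a + ?a = ?b + ?a" by (rule arg_cong[where f = "\<lambda>x. x + ?a"])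
    then have "2 *\<^sub>R ?a = 2 *\<^sub>R real_of_lattice v"
      by (simp only: diff_add_cancel scaleR_2)
    then have "?a = real_of_lattice v" by (simp only: scaleR_cancel_left) simp
    then show ?thesis using v_in by simp
  next
    case False
    have "?a \<in> \<sigma>" "?b \<in> \<sigma>"
      using l in_cone by (auto simp: \<sigma>_def coord_cone_def lattice_dual_inner[OF B'(2)] inner_diff_left)
    moreover have "real_of_lattice v = (1 - 1/2) *\<^sub>R ?a + (1/2) *\<^sub>R ?b"
      by (simp add: scaleR_diff_right)
    then have "real_of_lattice v \<in> open_segment ?a ?b"
      using False unfolding in_segment by (intro conjI exI[of _ "1/2"]) auto
    ultimately show ?thesis using face v_in unfolding face_of_def by blast
  qed
  then have "(1 / (2 * ?c l)) *\<^sub>R ?a \<in> \<alpha>"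
    unfolding BC(2) using l by (intro convex_cone_scaleR[OF convex_cone_coord_cone, of "1 / (2 * ?c l)"]) auto
  moreover have "(1 / (2 * ?c l)) *\<^sub>R ?a = real_of_lattice (B' $ l)"
    using l by simp
  ultimately have "B' $ l \<in> {w. real_of_lattice w \<in> coord_cone C {j}}"
    by (simp only: BC(2) mem_Collect_eq)
  then obtain k where k: "B' $ l = int k *s v"
    unfolding lattice_points_ray[OF BC(1)] v by auto
  have "1 = real_of_lattice (B' $ l) \<bullet> real_of_lattice (C' $ l)"
    by (simp add: lattice_dual_inner[OF B'(2)])
  also have "\<dots> = of_int (int k * (\<Sum>i\<in>UNIV. v $ i * C' $ l $ i))"
    unfolding inner_real_of_lattice k by (simp add: sum_distrib_left mult.assoc)
  finally have "int k * (\<Sum>i\<in>UNIV. v $ i * C' $ l $ i) = 1" by linarith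
  then have "int k = 1" unfolding zmult_eq_1_iff by auto
  with k have "v = B' $ l" by simp
  then show thesis by (rule that[OF B'(1)])
qed

lemma finite_gens: "finite (gens \<Delta>)"
  using fan by (simp add: gens_def rays_def fan_def)

lemma finite_chart_bases: "finite (chart_bases \<Delta>)"
proof -
  have "vec_nth ` chart_bases \<Delta> \<subseteq> ((UNIV :: 'n set) \<rightarrow>\<^sub>E gens \<Delta>)"
    using chart_basis_row_in_gens by auto
  moreover have "finite ((UNIV :: 'n set) \<rightarrow>\<^sub>E gens \<Delta>)" by (intro finite_PiE) (auto simp: finite_gens)
  ultimately have "finite (vec_nth ` chart_bases \<Delta>)" by (rule finite_subset)
  moreover have "inj_on vec_nth (chart_bases \<Delta>)" by (simp add: inj_on_def vec_eq_iff)
  ultimately show ?thesis by (rule finite_imageD)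
qed

lemma zero_notin_gens: "v \<in> gens \<Delta> \<Longrightarrow> v \<noteq> 0"
  by (metis chart_basesD gens_chart_basis_row lattice_dual_nonzero(1))

text \<open>The form in which completeness is used for the boundedness of the polytope, for the
  covering of the torus by polydiscs, and for the existence of a chart.\<close>

lemma nonneg_combination:
  obtains B c where "B \<in> chart_bases \<Delta>" "\<And>j. 0 \<le> c j"
    "v = (\<Sum>j\<in>UNIV. c j *\<^sub>R real_of_lattice (B $ j))"
proof -
  obtain B C where BC: "B \<in> chart_bases \<Delta>" "lattice_dual B C" "v \<in> coord_cone C UNIV"
    using full_cone_exists by blast
  show thesis
  proof (rule that[OF BC(1)])
    show "v = (\<Sum>j\<in>UNIV. (v \<bullet> real_of_lattice (C $ j)) *\<^sub>R real_of_lattice (B $ j))"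
      by (rule lattice_dual_expand[OF BC(2)])
  qed (use BC(3) in \<open>simp add: coord_cone_def\<close>)
qed

end

section \<open>Faces of the polytope and weight spaces\<close>

definition active :: "'n::finite rvec set set \<Rightarrow> 'n ivec \<Rightarrow> 'n ivec set" where
  "active \<Delta> I = {b \<in> gens \<Delta>. real_of_lattice I \<bullet> real_of_lattice b = - 1}"

definition active_face :: "'n::finite rvec set set \<Rightarrow> 'n ivec \<Rightarrow> 'n rvec set" where
  "active_face \<Delta> I =
    {x \<in> polytope_of \<Delta>. \<forall>b\<in>active \<Delta> I. x \<bullet> real_of_lattice b = - 1}"

lemma polytope_of_gens:
  "polytope_of \<Delta> = {x. \<forall>b\<in>gens \<Delta>. - 1 \<le> x \<bullet> real_of_lattice b}"
  by (auto simp: polytope_of_def gens_def)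

lemma face_perp_active: "face_perp \<Delta> I = span (real_of_lattice ` active \<Delta> I)"
proof -
  have "{real_of_lattice (prim_gen \<alpha>) |\<alpha>.
      \<alpha> \<in> rays \<Delta> \<and> real_of_lattice I \<bullet> real_of_lattice (prim_gen \<alpha>) = - 1} =
      real_of_lattice ` active \<Delta> I"
    by (auto simp: active_def gens_def)
  then show ?thesis by (simp add: face_perp_def)
qed

lemma active_face_face_of: "active_face \<Delta> I face_of polytope_of \<Delta>"
proof -
  have "a \<in> active_face \<Delta> I \<and> b \<in> active_face \<Delta> I"
    if a: "a \<in> polytope_of \<Delta>" and b: "b \<in> polytope_of \<Delta>" and x: "x \<in> active_face \<Delta> I"
      and seg: "x \<in> open_segment a b" for a b x
  proof -
    obtain u where u: "0 < u" "u < 1" "x = (1 - u) *\<^sub>R a + u *\<^sub>R b"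
      using seg by (auto simp: in_segment)
    have "a \<bullet> real_of_lattice g = - 1 \<and> b \<bullet> real_of_lattice g = - 1" if g: "g \<in> active \<Delta> I" for g
    proof -
      have "0 \<le> a \<bullet> real_of_lattice g + 1" "0 \<le> b \<bullet> real_of_lattice g + 1"
        using a b g unfolding polytope_of_gens active_def by force+
      then have ge: "0 \<le> (1 - u) * (a \<bullet> real_of_lattice g + 1)" "0 \<le> u * (b \<bullet> real_of_lattice g + 1)"
        using u by auto
      have "(1 - u) * (a \<bullet> real_of_lattice g) + u * (b \<bullet> real_of_lattice g) = - 1"
        using x g by (simp add: u(3) active_face_def inner_add_left)
      then have "(1 - u) * (a \<bullet> real_of_lattice g + 1) + u * (b \<bullet> real_of_lattice g + 1) = 0"
        by (simp add: algebra_simps)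
      with ge have "(1 - u) * (a \<bullet> real_of_lattice g + 1) = 0"
        "u * (b \<bullet> real_of_lattice g + 1) = 0" by linarith+
      then show ?thesis using u by auto
    qed
    then show ?thesis using a b by (auto simp: active_face_def)
  qed
  moreover have "convex (active_face \<Delta> I)"
  proof -
    have "active_face \<Delta> I = (\<Inter>b\<in>gens \<Delta>. {x. real_of_lattice b \<bullet> x \<ge> - 1}) \<inter>
        (\<Inter>b\<in>active \<Delta> I. {x. real_of_lattice b \<bullet> x = - 1})"
      by (auto simp: active_face_def polytope_of_gens inner_commute)
    moreover have "convex \<dots>"
      by (intro convex_Int convex_INT convex_halfspace_ge convex_hyperplane)
    ultimately show ?thesis by simp
  qed
  moreover have "active_face \<Delta> I \<subseteq> polytope_of \<Delta>" by (auto simp: active_face_def)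
  ultimately show ?thesis unfolding face_of_def by blast
qed

section \<open>Complexification and dual bases\<close>

lemma cplx_of_real_lattice: "cplx_of_real (real_of_lattice v) = cplx_of_lattice v"
  by (simp add: cplx_of_real_def cplx_of_lattice_def vec_eq_iff)

lemma cdot_cplx_of_real: "cdot (cplx_of_real a) (cplx_of_real b) = of_real (a \<bullet> b)"
  by (simp add: cdot_def cplx_of_real_def inner_vec_def)

lemma cplx_of_real_add: "cplx_of_real (x + y) = cplx_of_real x + cplx_of_real y"
  by (simp add: cplx_of_real_def vec_eq_iff)

lemma cplx_of_real_scale: "cplx_of_real (c *\<^sub>R x) = of_real c *s cplx_of_real x"
  by (simp add: cplx_of_real_def vec_eq_iff)

lemma cplx_of_real_0 [simp]: "cplx_of_real 0 = 0"
  by (simp add: cplx_of_real_def vec_eq_iff)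

lemma cplx_of_real_span: "x \<in> span S \<Longrightarrow> cplx_of_real x \<in> vec.span (cplx_of_real ` S)"
proof (induction rule: span_induct_alt)
  case (step c x y)
  then have "cplx_of_real x \<in> vec.span (cplx_of_real ` S)" by (auto intro: vec.span_base)
  with step show ?case
    by (simp add: cplx_of_real_add cplx_of_real_scale vec.span_add vec.span_scale)
qed (simp add: vec.span_zero)

lemma real_dual_vector:
  fixes B :: "'a::euclidean_space set"
  assumes "independent B"
  obtains a where "\<And>x. x \<in> B \<Longrightarrow> a \<bullet> x = (if x = b then 1 else 0)"
proof -
  obtain g :: "'a \<Rightarrow> real" where g: "linear g" "\<And>x. x \<in> B \<Longrightarrow> g x = (if x = b then 1 else 0)"
    using linear_independent_extend[OF assms, of "\<lambda>x. if x = b then 1 else 0"] by blast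
  have "adjoint g 1 \<bullet> x = g x" for x
    using adjoint_works[OF g(1), of x 1] by (simp add: inner_commute)
  with g(2) show thesis by (intro that[of "adjoint g 1"]) simp
qed

text \<open>The basis and its dual are chosen over the reals, where the active generators live;
  complexification preserves the pairing, so duality survives.\<close>

lemma dual_basis:
  fixes S :: "'n::finite rvec set"
  obtains rs \<alpha>s where "set rs \<subseteq> S" "S \<subseteq> span (set rs)" "length rs = dim S"
    "dual_lists \<alpha>s (map cplx_of_real rs)"
proof -
  obtain B where B: "B \<subseteq> S" "independent B" "S \<subseteq> span B" "card B = dim S"
    using basis_exists by blast
  have "finite B" using B(2) independent_imp_finite by blast
  then obtain rs where rs: "set rs = B" "distinct rs" using finite_distinct_list by blast
  have "\<exists>a. \<forall>x\<in>B. a \<bullet> x = (if x = b then 1 else 0)" for b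
    using real_dual_vector[OF B(2), of b] by metis
  then obtain a where a: "\<And>b x. x \<in> B \<Longrightarrow> a b \<bullet> x = (if x = b then 1 else 0)" by metis
  have "dual_lists (map (cplx_of_real \<circ> a) rs) (map cplx_of_real rs)"
    unfolding dual_lists_def
    using rs by (auto simp: cdot_cplx_of_real a nth_eq_iff_index_eq)
  moreover have "length rs = dim S" using rs B(4) distinct_card by metis
  ultimately show thesis using that rs B by blast
qed

section \<open>The face through a lattice point of the polytope\<close>

context
  fixes \<Delta> :: "'n::finite rvec set set" and I :: "'n ivec"
  assumes complete: "smooth_complete_fan \<Delta>" and I: "I \<in> S_all \<Delta>"
begin

text \<open>The inactive inequalities are strict at \<open>I\<close> and finite in number, so they
  survive a small step; the active ones do not change along \<open>u\<close>. Thus every direction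
  orthogonal to the active generators is tangent to the face.\<close>

lemma active_face_move:
  assumes "\<And>b. b \<in> active \<Delta> I \<Longrightarrow> u \<bullet> real_of_lattice b = 0"
  obtains \<epsilon> where "0 < \<epsilon>" "real_of_lattice I + \<epsilon> *\<^sub>R u \<in> active_face \<Delta> I"
proof -
  let ?p = "real_of_lattice I"
  have "\<forall>\<^sub>F \<epsilon> in at_right 0. \<forall>b\<in>gens \<Delta>. - 1 \<le> (?p + \<epsilon> *\<^sub>R u) \<bullet> real_of_lattice b"
  proof (rule eventually_ball_finite[OF finite_gens[OF complete]], rule ballI)
    fix b assume b: "b \<in> gens \<Delta>"
    show "\<forall>\<^sub>F \<epsilon> in at_right 0. - 1 \<le> (?p + \<epsilon> *\<^sub>R u) \<bullet> real_of_lattice b"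
    proof (cases "b \<in> active \<Delta> I")
      case True
      then show ?thesis using assms by (simp add: inner_add_left active_def)
    next
      case False
      then have gt: "- 1 < ?p \<bullet> real_of_lattice b"
        using b I by (force simp: active_def S_all_def polytope_of_gens)
      have "((\<lambda>\<epsilon>. (?p + \<epsilon> *\<^sub>R u) \<bullet> real_of_lattice b) \<longlongrightarrow> (?p + 0 *\<^sub>R u) \<bullet> real_of_lattice b) (at_right 0)"
        by (intro tendsto_intros)
      then have "\<forall>\<^sub>F \<epsilon> in at_right 0. - 1 < (?p + \<epsilon> *\<^sub>R u) \<bullet> real_of_lattice b"
        using gt by (intro order_tendstoD(1)) auto
      then show ?thesis by (rule eventually_mono) simp
    qed
  qed
  then have "\<forall>\<^sub>F \<epsilon> in at_right 0. 0 < \<epsilon> \<and> (\<forall>b\<in>gens \<Delta>. - 1 \<le> (?p + \<epsilon> *\<^sub>R u) \<bullet> real_of_lattice b)"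
    by (intro eventually_conj eventually_at_right_less)
  then obtain \<epsilon> :: real where "0 < \<epsilon>" "\<forall>b\<in>gens \<Delta>. - 1 \<le> (?p + \<epsilon> *\<^sub>R u) \<bullet> real_of_lattice b"
    using eventually_happens'[OF trivial_limit_at_right_real] by blast
  then show thesis using assms
    by (intro that[of \<epsilon>]) (auto simp: active_face_def polytope_of_gens inner_add_left active_def)
qed

lemma mem_rel_interior_active_face: "real_of_lattice I \<in> rel_interior (active_face \<Delta> I)"
proof -
  let ?T = "{x. \<forall>b\<in>gens \<Delta> - active \<Delta> I. - 1 < x \<bullet> real_of_lattice b}"
  have "?T = (\<Inter>b\<in>gens \<Delta> - active \<Delta> I. {x. - 1 < x \<bullet> real_of_lattice b})" by auto
  moreover have "open {x. - 1 < x \<bullet> real_of_lattice b}" for b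
    by (intro open_Collect_less continuous_intros)
  ultimately have "open ?T" using finite_gens[OF complete] by (simp only:) (intro open_INT, auto)
  moreover have "real_of_lattice I \<in> ?T \<inter> active_face \<Delta> I"
    using I by (force simp: active_def S_all_def polytope_of_gens active_face_def)
  moreover have "?T \<inter> affine hull (active_face \<Delta> I) \<subseteq> active_face \<Delta> I"
  proof -
    have "affine hull (active_face \<Delta> I) \<subseteq> (\<Inter>b\<in>active \<Delta> I. {x. real_of_lattice b \<bullet> x = - 1})"
      by (intro hull_minimal affine_Inter)
        (auto simp: active_face_def inner_commute[of _ "real_of_lattice _"] affine_hyperplane)
    then show ?thesis
      by (force simp: active_face_def polytope_of_gens inner_commute)
  qed
  ultimately show ?thesis unfolding mem_rel_interior by blast
qed

lemma face_at_active_face: "face_at \<Delta> I = active_face \<Delta> I"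
  unfolding face_at_def
proof (rule the_equality)
  fix F assume "F face_of polytope_of \<Delta> \<and> real_of_lattice I \<in> rel_interior F"
  then show "F = active_face \<Delta> I"
    using face_of_eq[OF _ active_face_face_of] mem_rel_interior_active_face by blast
qed (simp add: active_face_face_of mem_rel_interior_active_face)

text \<open>After translation of \<open>I\<close> to the origin, the face spans the whole orthogonal
  complement of the active generators, by \<open>active_face_move\<close>.\<close>

lemma aff_dim_active_face:
  "aff_dim (active_face \<Delta> I) = int CARD('n) - int (dim (real_of_lattice ` active \<Delta> I))"
proof -
  let ?p = "real_of_lattice I" and ?V = "span (real_of_lattice ` active \<Delta> I)"
  define G where "G = (\<lambda>x. - ?p + x) ` active_face \<Delta> I"
  define P where "P = {y \<in> UNIV. \<forall>x\<in>?V. orthogonal x y}"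
  have p: "?p \<in> active_face \<Delta> I" using mem_rel_interior_active_face rel_interior_subset by blast
  have P: "u \<in> P \<longleftrightarrow> (\<forall>b\<in>active \<Delta> I. u \<bullet> real_of_lattice b = 0)" for u
  proof
    assume *: "\<forall>b\<in>active \<Delta> I. u \<bullet> real_of_lattice b = 0"
    have "?V \<subseteq> {x. u \<bullet> x = 0}"
      by (intro span_minimal subspace_hyperplane) (use * in auto)
    then show "u \<in> P" by (auto simp: P_def orthogonal_def inner_commute)
  next
    assume "u \<in> P"
    then have "x \<bullet> u = 0" if "x \<in> ?V" for x using that by (auto simp: P_def orthogonal_def)
    then show "\<forall>b\<in>active \<Delta> I. u \<bullet> real_of_lattice b = 0"
      by (simp add: inner_commute[of u] span_base)
  qed
  have "G \<subseteq> P" using p by (auto simp: P G_def inner_diff_left active_face_def)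
  moreover have "P \<subseteq> span G"
  proof
    fix u assume "u \<in> P"
    then obtain \<epsilon> where \<epsilon>: "0 < \<epsilon>" "?p + \<epsilon> *\<^sub>R u \<in> active_face \<Delta> I"
      using active_face_move P by metis
    then have "\<epsilon> *\<^sub>R u \<in> G" unfolding G_def by (intro rev_image_eqI[OF \<epsilon>(2)]) simp
    then have "(1 / \<epsilon>) *\<^sub>R (\<epsilon> *\<^sub>R u) \<in> span G" by (intro span_scale span_base)
    then show "u \<in> span G" using \<epsilon> by simp
  qed
  ultimately have "dim G = dim P" by (metis dim_mono dim_span order_antisym span_base subsetI span_mono)
  have "dim P + dim ?V = dim (UNIV :: 'n rvec set)"
    unfolding P_def by (rule dim_subspace_orthogonal_to_vectors) auto
  then have "dim P + dim (real_of_lattice ` active \<Delta> I) = CARD('n)" by simp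
  moreover have "aff_dim (active_face \<Delta> I) = aff_dim G"
    unfolding G_def by (rule aff_dim_translation_eq[symmetric])
  moreover have "aff_dim G = int (dim G)"
  proof (rule aff_dim_zero)
    show "0 \<in> affine hull G" using p by (intro hull_inc) (auto simp: G_def intro!: rev_image_eqI)
  qed
  ultimately show ?thesis using \<open>dim G = dim P\<close> by linarith
qed

lemma S_codim_iff: "I \<in> S_codim \<Delta> i \<longleftrightarrow> i = dim (real_of_lattice ` active \<Delta> I)"
proof
  assume "I \<in> S_codim \<Delta> i"
  then obtain F where F: "F face_of polytope_of \<Delta>" "aff_dim F = int CARD('n) - int i"
    "real_of_lattice I \<in> rel_interior F" by (auto simp: S_codim_def)
  then have "F = active_face \<Delta> I"
    using face_of_eq[OF F(1) active_face_face_of] mem_rel_interior_active_face by blast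
  with F(2) have "aff_dim (active_face \<Delta> I) = int CARD('n) - int i" by simp
  with aff_dim_active_face show "i = dim (real_of_lattice ` active \<Delta> I)" by simp
next
  assume "i = dim (real_of_lattice ` active \<Delta> I)"
  then show "I \<in> S_codim \<Delta> i"
    using active_face_face_of aff_dim_active_face mem_rel_interior_active_face
    by (auto simp: S_codim_def)
qed

lemma S_upto_iff: "I \<in> S_upto \<Delta> k \<longleftrightarrow> dim (real_of_lattice ` active \<Delta> I) \<le> k"
  by (auto simp: S_upto_def S_codim_iff)

text \<open>For the inclusion that needs work, the real and the imaginary part of \<delta> - I are
  both orthogonal to the active generators. A small step along each of them stays in the face, and
  complex affine combinations of \<open>I\<close> with these two points reach \<delta>.\<close>

lemma face_hat_iff:
  "\<delta> \<in> face_hat \<Delta> I \<longleftrightarrow> (\<forall>b\<in>active \<Delta> I. cdot (\<delta> - cplx_of_lattice I) (cplx_of_lattice b) = 0)"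
proof
  let ?R = "{\<delta>. \<forall>b\<in>active \<Delta> I. cdot (\<delta> - cplx_of_lattice I) (cplx_of_lattice b) = 0}"
  have act: "cdot (cplx_of_lattice I) (cplx_of_lattice b) = - 1" if "b \<in> active \<Delta> I" for b
    using that by (simp add: active_def cdot_cplx_of_real flip: cplx_of_real_lattice)
  have R: "?R = {\<delta>. \<forall>b\<in>active \<Delta> I. cdot \<delta> (cplx_of_lattice b) = - 1}"
    by (simp add: cdot_diff_left act eq_neg_iff_add_eq_0)
  have "complex_affine ?R"
    unfolding R complex_affine_def
  proof (intro ballI allI impI CollectI)
    fix x y b and u v :: complex
    assume *: "x \<in> {\<delta>. \<forall>b\<in>active \<Delta> I. cdot \<delta> (cplx_of_lattice b) = - 1}"
      "y \<in> {\<delta>. \<forall>b\<in>active \<Delta> I. cdot \<delta> (cplx_of_lattice b) = - 1}" "b \<in> active \<Delta> I" "u + v = 1"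
    then have "cdot (u *s x + v *s y) (cplx_of_lattice b) = u * (- 1) + v * (- 1)"
      by (simp add: cdot_add_left cdot_scale_left)
    also have "\<dots> = - (u + v)" by simp
    finally show "cdot (u *s x + v *s y) (cplx_of_lattice b) = - 1" using *(4) by simp
  qed
  moreover have "cplx_of_real ` face_at \<Delta> I \<subseteq> ?R"
    unfolding R face_at_active_face
    by (auto simp: active_face_def cdot_cplx_of_real simp flip: cplx_of_real_lattice)
  ultimately have sub: "face_hat \<Delta> I \<subseteq> ?R"
    unfolding face_hat_def by (intro hull_minimal)
  show "\<forall>b\<in>active \<Delta> I. cdot (\<delta> - cplx_of_lattice I) (cplx_of_lattice b) = 0"
    if "\<delta> \<in> face_hat \<Delta> I" using sub that by blast
  show "\<delta> \<in> face_hat \<Delta> I"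
    if \<delta>: "\<forall>b\<in>active \<Delta> I. cdot (\<delta> - cplx_of_lattice I) (cplx_of_lattice b) = 0"
  proof -
    let ?p = "real_of_lattice I"
    define a c :: "'n rvec" where "a = (\<chi> i. Re ((\<delta> - cplx_of_lattice I) $ i))"
      and "c = (\<chi> i. Im ((\<delta> - cplx_of_lattice I) $ i))"
    have dec: "\<delta> - cplx_of_lattice I = cplx_of_real a + \<i> *s cplx_of_real c"
      by (simp add: vec_eq_iff a_def c_def cplx_of_real_def complex_eq_iff)
    have zero: "a \<bullet> real_of_lattice b = 0 \<and> c \<bullet> real_of_lattice b = 0" if b: "b \<in> active \<Delta> I" for b
    proof -
      have "cdot (\<delta> - cplx_of_lattice I) (cplx_of_lattice b) = 0" using \<delta> b by blast
      then have "complex_of_real (a \<bullet> real_of_lattice b) + \<i> * complex_of_real (c \<bullet> real_of_lattice b) = 0"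
        unfolding dec by (simp add: cdot_add_left cdot_scale_left cdot_cplx_of_real flip: cplx_of_real_lattice)
      then show ?thesis by (simp add: complex_eq_iff)
    qed
    obtain \<epsilon> where \<epsilon>: "0 < \<epsilon>" "?p + \<epsilon> *\<^sub>R a \<in> active_face \<Delta> I"
      using active_face_move[of a] zero by blast
    obtain \<eta> where \<eta>: "0 < \<eta>" "?p + \<eta> *\<^sub>R c \<in> active_face \<Delta> I"
      using active_face_move[of c] zero by blast
    have H: "complex_affine (face_hat \<Delta> I)"
      unfolding face_hat_def by (rule hull_in) (auto simp: complex_affine_def)
    have inc: "cplx_of_real x \<in> face_hat \<Delta> I" if "x \<in> active_face \<Delta> I" for x
      unfolding face_hat_def face_at_active_face using that by (intro hull_inc) auto
    have aff: "u *s x + v *s y \<in> face_hat \<Delta> I"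
      if "x \<in> face_hat \<Delta> I" "y \<in> face_hat \<Delta> I" "u + v = 1" for x y u v
      using H that unfolding complex_affine_def by blast
    have p: "cplx_of_lattice I \<in> face_hat \<Delta> I"
      using inc[of ?p] mem_rel_interior_active_face rel_interior_subset
      by (auto simp: cplx_of_real_lattice)
    have move: "x + s *s cplx_of_real w \<in> face_hat \<Delta> I"
      if "x \<in> face_hat \<Delta> I" "?p + \<theta> *\<^sub>R w \<in> active_face \<Delta> I" "0 < \<theta>" for x s w \<theta>
    proof -
      \<comment> \<open>Moving by \<open>s\<close> along \<open>w\<close> means adding
        \<open>r\<close> times the difference of two points of the face. As
        \<open>complex_affine\<close> speaks of two points only, this combination of three is
        nested, with outer coefficients 2 and -1 and inner ones 1/2.\<close>
      define r where "r = s / of_real \<theta>"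
      have "x + s *s cplx_of_real w = 2 *s ((1/2) *s x + (1/2) *s ((1 - r) *s cplx_of_lattice I + r *s cplx_of_real (?p + \<theta> *\<^sub>R w)))
          + (- 1) *s cplx_of_lattice I"
        using that(3) by (simp add: vec_eq_iff r_def cplx_of_real_def cplx_of_lattice_def field_simps)
      also have "\<dots> \<in> face_hat \<Delta> I"
        by (intro aff that(1) p inc[OF that(2)]) auto
      finally show ?thesis .
    qed
    have "cplx_of_lattice I + 1 *s cplx_of_real a + \<i> *s cplx_of_real c \<in> face_hat \<Delta> I"
      by (intro move[OF move[OF p \<epsilon>(2,1)] \<eta>(2,1)])
    moreover have "cplx_of_lattice I + 1 *s cplx_of_real a + \<i> *s cplx_of_real c = \<delta>"
      using dec by (simp add: algebra_simps)
    ultimately show ?thesis by simp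
  qed
qed

end

text \<open>Every \<open>v\<close> is a nonnegative combination of generators, which bounds x
  \<bullet> v below on the polytope; plus and minus the unit vectors then confine each coordinate of
  \<open>I\<close> to a finite interval.\<close>

lemma finite_S_all:
  fixes \<Delta> :: "'n::finite rvec set set"
  assumes complete: "smooth_complete_fan \<Delta>"
  shows "finite (S_all \<Delta>)"
proof -
  have bound: "\<exists>m. \<forall>x\<in>polytope_of \<Delta>. - m \<le> x \<bullet> v" for v
  proof -
    obtain B c where B: "B \<in> chart_bases \<Delta>" "\<And>j. 0 \<le> c j"
      "v = (\<Sum>j\<in>UNIV. c j *\<^sub>R real_of_lattice (B $ j))"
      using nonneg_combination[OF complete, of v] by blast
    have "- (\<Sum>j\<in>UNIV. c j) \<le> x \<bullet> v" if "x \<in> polytope_of \<Delta>" for x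
    proof -
      have "c j * (- 1) \<le> c j * (x \<bullet> real_of_lattice (B $ j))" for j
        using that chart_basis_row_in_gens[OF complete B(1)] B(2)
        by (intro mult_left_mono) (auto simp: polytope_of_gens)
      then have "(\<Sum>j\<in>UNIV. c j * (- 1)) \<le> (\<Sum>j\<in>UNIV. c j * (x \<bullet> real_of_lattice (B $ j)))"
        by (intro sum_mono)
      then show ?thesis by (simp add: B(3) inner_sum_right sum_negf)
    qed
    then show ?thesis by blast
  qed
  then obtain m where m: "\<And>v x. x \<in> polytope_of \<Delta> \<Longrightarrow> - m v \<le> x \<bullet> v" by metis
  have "I $ i \<in> {\<lfloor>- m (axis i 1)\<rfloor>..\<lceil>m (- axis i 1)\<rceil>}" if "I \<in> S_all \<Delta>" for I i
    using m[of "real_of_lattice I" "axis i 1"] m[of "real_of_lattice I" "- axis i 1"] that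
    by (simp add: S_all_def inner_axis) linarith
  then have "vec_nth ` S_all \<Delta> \<subseteq> (\<Pi>\<^sub>E i\<in>UNIV. {\<lfloor>- m (axis i 1)\<rfloor>..\<lceil>m (- axis i 1)\<rceil>})"
    by auto
  moreover have "finite (\<Pi>\<^sub>E (i::'n)\<in>UNIV. {\<lfloor>- m (axis i 1)\<rfloor>..\<lceil>m (- axis i 1)\<rceil>})"
    by (intro finite_PiE) auto
  ultimately have "finite (vec_nth ` S_all \<Delta>)" by (rule finite_subset)
  moreover have "inj_on vec_nth (S_all \<Delta>)" by (simp add: inj_on_def vec_eq_iff)
  ultimately show ?thesis by (rule finite_imageD)
qed

text \<open>One linear condition for each divisor along which the character has a pole. The part of
  degree \<open>k\<close> is N_I^k (\<open>weight_ext_eq\<close>).\<close>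

definition annihilated :: "'n::{finite,linorder} rvec set set \<Rightarrow> 'n ivec \<Rightarrow> 'n ext set" where
  "annihilated \<Delta> I = {A. \<forall>b\<in>active \<Delta> I. ext_vector (cplx_of_lattice b) \<and>\<^sub>e A = 0}"

lemma annihilated_basis:
  fixes \<Delta> :: "'n::{finite,linorder} rvec set set"
  obtains bs \<alpha>s where "dual_lists \<alpha>s bs" "length bs = dim (real_of_lattice ` active \<Delta> I)"
    "complexify (face_perp \<Delta> I) = vec.span (set bs)"
    "annihilated \<Delta> I = {A. \<forall>b\<in>set bs. ext_vector b \<and>\<^sub>e A = 0}"
    "\<And>b. b \<in> active \<Delta> I \<Longrightarrow> cplx_of_lattice b \<in> vec.span (set bs)"
proof -
  let ?S = "real_of_lattice ` active \<Delta> I"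
  obtain rs \<alpha>s where rs: "set rs \<subseteq> ?S" "?S \<subseteq> span (set rs)" "length rs = dim ?S"
    "dual_lists \<alpha>s (map cplx_of_real rs)"
    using dual_basis[of ?S] by blast
  let ?bs = "map cplx_of_real rs"
  have span: "span ?S = span (set rs)"
    using rs(1,2) by (metis span_eq span_superset subset_trans)
  have "complexify (face_perp \<Delta> I) = vec.span (set ?bs)"
  proof (rule antisym)
    show "complexify (face_perp \<Delta> I) \<subseteq> vec.span (set ?bs)"
      unfolding complexify_def face_perp_active span
      by (rule vec.span_minimal) (auto intro: cplx_of_real_span)
    show "vec.span (set ?bs) \<subseteq> complexify (face_perp \<Delta> I)"
      unfolding complexify_def face_perp_active span
      by (rule vec.span_mono) (auto intro: span_base)
  qed
  moreover have in_span: "cplx_of_lattice b \<in> vec.span (set ?bs)" if "b \<in> active \<Delta> I" for b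
    using cplx_of_real_span[of "real_of_lattice b" "set rs"] that rs(2)
    by (auto simp: cplx_of_real_lattice)
  moreover have "annihilated \<Delta> I = {A. \<forall>b\<in>set ?bs. ext_vector b \<and>\<^sub>e A = 0}"
  proof (intro set_eqI iffI)
    fix A assume A: "A \<in> annihilated \<Delta> I"
    then show "A \<in> {A. \<forall>b\<in>set ?bs. ext_vector b \<and>\<^sub>e A = 0}"
      using rs(1) by (force simp: annihilated_def cplx_of_real_lattice)
  next
    fix A assume A: "A \<in> {A. \<forall>b\<in>set ?bs. ext_vector b \<and>\<^sub>e A = 0}"
    have "ext_vector x \<and>\<^sub>e A = 0" if "x \<in> vec.span (set ?bs)" for x
      using that
    proof (induction rule: vec.span_induct_alt)
      case (step c x y)
      then show ?case using A by (simp only: ext_vector_add ext_vector_scale wedge_add_left wedge_scale_left mem_Collect_eq) simp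
    qed simp
    then show "A \<in> annihilated \<Delta> I" using in_span by (simp add: annihilated_def)
  qed
  ultimately show thesis using that[of \<alpha>s ?bs] rs(3,4) by simp
qed

text \<open>The three cases of \<open>weight_ext\<close> collapse to one description: with no active
  generator there is no condition, and below the codimension only 0 is annihilated.\<close>

lemma weight_ext_eq:
  fixes \<Delta> :: "'n::{finite,linorder} rvec set set"
  assumes complete: "smooth_complete_fan \<Delta>" and I: "I \<in> S_all \<Delta>"
  shows "weight_ext \<Delta> k I = {A \<in> annihilated \<Delta> I. homog k A}"
proof -
  obtain bs \<alpha>s where bs: "dual_lists \<alpha>s bs" "length bs = dim (real_of_lattice ` active \<Delta> I)"
    "complexify (face_perp \<Delta> I) = vec.span (set bs)"
    "annihilated \<Delta> I = {A. \<forall>b\<in>set bs. ext_vector b \<and>\<^sub>e A = 0}"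
    "\<And>b. b \<in> active \<Delta> I \<Longrightarrow> cplx_of_lattice b \<in> vec.span (set bs)"
    by (rule annihilated_basis[of \<Delta> I]) (rule that, assumption+)
  have "(THE i. I \<in> S_codim \<Delta> i) = length bs"
    using S_codim_iff[OF complete I] bs(2) by simp
  then have *: "weight_ext \<Delta> k I =
      (if length bs = 0 then ext_power UNIV k
       else if length bs \<le> k then
         vec.span {A \<and>\<^sub>e B |A B. A \<in> ext_power (vec.span (set bs)) (length bs)
                                \<and> B \<in> ext_power UNIV (k - length bs)}
       else {0})"
    by (simp add: weight_ext_def bs(3) Let_def)
  consider "length bs = 0" | "0 < length bs" "length bs \<le> k" | "k < length bs" by linarith
  then show ?thesis
  proof cases
    case 1
    then show ?thesis by (simp add: * bs(4) ext_power_UNIV)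
  next
    case 2
    then show ?thesis
      unfolding * bs(4) span_wedge_ext_power[OF bs(1) 2(2)] by auto
  next
    case 3
    then have "{A \<in> annihilated \<Delta> I. homog k A} = {0}"
      using annihilated_low_degree[OF bs(1)] by (auto simp: bs(4))
    moreover have "length bs \<noteq> 0" "\<not> length bs \<le> k" using 3 by auto
    ultimately show ?thesis by (simp only: * if_False)
  qed
qed

lemma annihilated_low_codim:
  fixes \<Delta> :: "'n::{finite,linorder} rvec set set"
  assumes "A \<in> annihilated \<Delta> I" "homog k A" "k < dim (real_of_lattice ` active \<Delta> I)"
  shows "A = 0"
proof -
  obtain bs \<alpha>s where bs: "dual_lists \<alpha>s bs" "length bs = dim (real_of_lattice ` active \<Delta> I)"
    "complexify (face_perp \<Delta> I) = vec.span (set bs)"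
    "annihilated \<Delta> I = {A. \<forall>b\<in>set bs. ext_vector b \<and>\<^sub>e A = 0}"
    "\<And>b. b \<in> active \<Delta> I \<Longrightarrow> cplx_of_lattice b \<in> vec.span (set bs)"
    by (rule annihilated_basis[of \<Delta> I]) (rule that, assumption+)
  show ?thesis using assms annihilated_low_degree[OF bs(1), of A k] by (simp add: bs(2,4))
qed

section \<open>Weight fields and the generating operator\<close>

lemma torus_nonzero: "t \<in> torus \<Longrightarrow> t $ i \<noteq> 0"
  by (simp add: torus_def)

lemma rho_diag: "t \<in> torus \<Longrightarrow> rho A t = ext_map (diag_map t) A"
  unfolding rho_def diag_map_def by simp

lemma weight_field_nth:
  "t \<in> torus \<Longrightarrow> weight_field I A t $ K = character I t * (\<Prod>i\<in>K. t $ i) * A $ K"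
  by (simp add: weight_field_def rho_diag ext_map_diag)

lemma weight_field_off_torus [simp]: "t \<notin> torus \<Longrightarrow> weight_field I A t = 0"
  by (simp add: weight_field_def rho_def)

lemma weight_field_add: "weight_field I (A + B) t = weight_field I A t + weight_field I B t"
  by (cases "t \<in> torus") (auto intro!: ext_eqI simp: weight_field_nth algebra_simps)

lemma weight_field_scale: "weight_field I (c *s A) t = c *s weight_field I A t"
  by (cases "t \<in> torus") (auto intro!: ext_eqI simp: weight_field_nth)

lemma weight_field_zero [simp]: "weight_field I 0 t = 0"
  by (cases "t \<in> torus") (auto intro!: ext_eqI simp: weight_field_nth)

lemma homog_weight_field: "homog k A \<Longrightarrow> homog k (weight_field I A t)"
  by (cases "t \<in> torus") (auto simp: homog_def weight_field_nth)

lemma character_add: "t \<in> torus \<Longrightarrow> character (I + J) t = character I t * character J t"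
  by (simp add: character_def power_int_add torus_nonzero prod.distrib)

lemma character_0 [simp]: "character 0 t = 1"
  by (simp add: character_def)

lemma character_nonzero: "t \<in> torus \<Longrightarrow> character I t \<noteq> 0"
  by (simp add: character_def power_int_not_zero torus_nonzero)

lemma wedge_ext_map_diag:
  "ext_map (diag_map t) A \<and>\<^sub>e ext_map (diag_map t) B = ext_map (diag_map t) (A \<and>\<^sub>e B)"
proof (rule ext_eqI)
  fix K
  have eq: "shuffle_sign L (K - L) * ext_map (diag_map t) A $ L * ext_map (diag_map t) B $ (K - L) =
      (\<Prod>i\<in>K. t $ i) * (shuffle_sign L (K - L) * A $ L * B $ (K - L))" if "L \<in> Pow K" for L
  proof -
    have "(\<Prod>i\<in>K. t $ i) = (\<Prod>i\<in>L. t $ i) * (\<Prod>i\<in>K - L. t $ i)"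
      using that by (simp add: prod.subset_diff[of L K] mult.commute)
    then show ?thesis by (simp add: ext_map_diag mult_ac)
  qed
  show "(ext_map (diag_map t) A \<and>\<^sub>e ext_map (diag_map t) B) $ K =
      ext_map (diag_map t) (A \<and>\<^sub>e B) $ K"
    unfolding wedge_nth[of "ext_map (diag_map t) A"] ext_map_diag[of t "A \<and>\<^sub>e B"] wedge_nth[of A B]
      sum_distrib_left
    by (rule sum.cong[OF refl eq])
qed

lemma wedge_weight_field:
  "weight_field I A t \<and>\<^sub>e weight_field J B t = weight_field (I + J) (A \<and>\<^sub>e B) t"
proof (cases "t \<in> torus")
  case True
  then show ?thesis
    by (simp add: weight_field_def rho_diag wedge_ext_map_diag character_add vector_smult_assoc mult.commute)
qed simp

section \<open>Derivatives along the torus coordinates\<close>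

definition upd :: "'n::finite cvec \<Rightarrow> 'n \<Rightarrow> complex \<Rightarrow> 'n cvec" where
  "upd t i s = (\<chi> j. if j = i then s else t $ j)"

lemma upd_nth: "upd t i s $ j = (if j = i then s else t $ j)"
  by (simp add: upd_def)

lemma upd_same [simp]: "upd t i (t $ i) = t"
  by (simp add: upd_def vec_eq_iff)

lemma upd_torus: "t \<in> torus \<Longrightarrow> s \<noteq> 0 \<Longrightarrow> upd t i s \<in> torus"
  by (simp add: torus_def upd_nth)

text \<open>Relational counterpart of \<open>partial_deriv\<close>: it asserts differentiability,
  whereas \<open>deriv\<close> has some value in any case.\<close>

definition has_pderiv ::
    "'n::{finite,linorder} field \<Rightarrow> 'n cvec \<Rightarrow> 'n \<Rightarrow> 'n ext \<Rightarrow> bool" where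
  "has_pderiv f t i D \<longleftrightarrow>
    (\<forall>K. ((\<lambda>s. f (upd t i s) $ K) has_field_derivative D $ K) (at (t $ i)))"

definition torus_differentiable :: "'n::{finite,linorder} field \<Rightarrow> bool" where
  "torus_differentiable f \<longleftrightarrow> (\<forall>t\<in>torus. \<forall>i. \<exists>D. has_pderiv f t i D)"

lemma partial_deriv_eq: "has_pderiv f t i D \<Longrightarrow> partial_deriv i f t = D"
  by (rule ext_eqI) (simp add: partial_deriv_def has_pderiv_def DERIV_imp_deriv flip: upd_def)

lemma torus_differentiableD:
  "torus_differentiable f \<Longrightarrow> t \<in> torus \<Longrightarrow> has_pderiv f t i (partial_deriv i f t)"
  unfolding torus_differentiable_def using partial_deriv_eq by metis

lemma has_pderiv_add:
  "has_pderiv f t i D \<Longrightarrow> has_pderiv g t i E \<Longrightarrow> has_pderiv (\<lambda>t. f t + g t) t i (D + E)"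
  by (auto simp: has_pderiv_def intro!: derivative_intros)

lemma has_pderiv_scale: "has_pderiv f t i D \<Longrightarrow> has_pderiv (\<lambda>t. c *s f t) t i (c *s D)"
  by (auto simp: has_pderiv_def intro!: DERIV_cmult)

lemma has_pderiv_wedge:
  assumes "has_pderiv f t i D" "has_pderiv g t i E"
  shows "has_pderiv (field_wedge f g) t i (D \<and>\<^sub>e g t + f t \<and>\<^sub>e E)"
  unfolding has_pderiv_def
proof
  fix K
  have f: "((\<lambda>s. f (upd t i s) $ L) has_field_derivative D $ L) (at (t $ i))"
    and g: "((\<lambda>s. g (upd t i s) $ L) has_field_derivative E $ L) (at (t $ i))" for L
    using assms by (simp_all add: has_pderiv_def)
  have "((\<lambda>s. \<Sum>L\<in>Pow K. shuffle_sign L (K - L) * (f (upd t i s) $ L * g (upd t i s) $ (K - L)))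
      has_field_derivative (\<Sum>L\<in>Pow K. shuffle_sign L (K - L) *
        (D $ L * g (upd t i (t $ i)) $ (K - L) + E $ (K - L) * f (upd t i (t $ i)) $ L))) (at (t $ i))"
    by (intro DERIV_sum DERIV_cmult DERIV_mult f g)
  then show "((\<lambda>s. field_wedge f g (upd t i s) $ K) has_field_derivative
      (D \<and>\<^sub>e g t + f t \<and>\<^sub>e E) $ K) (at (t $ i))"
    by (simp add: field_wedge_def wedge_nth mult.assoc sum.distrib algebra_simps)
qed

text \<open>As a function of the i-th coordinate alone, the coefficient at \<open>K\<close> is a
  constant times a power. Its exponent exceeds I_i by 1 when i is in \<open>K\<close>, the
  contribution of the frame vector t_i \<partial>/\<partial>t_i.\<close>

lemma has_pderiv_weight_field:
  assumes "t \<in> torus"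
  shows "has_pderiv (weight_field I A) t i
    (\<chi> K. ((of_int (I $ i) + (if i \<in> K then 1 else 0)) / t $ i) * weight_field I A t $ K)"
  unfolding has_pderiv_def
proof
  fix K
  define e where "e = I $ i + (if i \<in> K then 1 else 0)"
  have e: "of_int e = of_int (I $ i) + (if i \<in> K then 1 else 0 :: complex)"
    by (simp add: e_def)
  define c where "c = (\<Prod>j\<in>- {i}. (t $ j) powi (I $ j)) * (\<Prod>j\<in>K - {i}. t $ j) * A $ K"
  have eq: "weight_field I A (upd t i s) $ K = c * s powi e" if "s \<noteq> 0" for s
  proof -
    have "character I (upd t i s) = s powi (I $ i) * (\<Prod>j\<in>- {i}. (t $ j) powi (I $ j))"
      unfolding character_def
      by (subst prod.remove[of UNIV i]) (auto simp: upd_nth Compl_eq_Diff_UNIV intro!: prod.cong)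
    moreover have "(\<Prod>j\<in>K. upd t i s $ j) = (if i \<in> K then s else 1) * (\<Prod>j\<in>K - {i}. t $ j)"
    proof (cases "i \<in> K")
      case True
      then show ?thesis
        by (subst prod.remove[of K i]) (auto simp: upd_nth intro!: prod.cong)
    next
      case False
      then show ?thesis by (auto simp: upd_nth intro!: prod.cong)
    qed
    moreover have "s powi e = s powi (I $ i) * (if i \<in> K then s else 1)"
      using that by (simp add: e_def power_int_add)
    ultimately show ?thesis
      using upd_torus[OF assms that] by (simp add: weight_field_nth c_def mult_ac)
  qed
  have ti: "t $ i \<noteq> 0" using assms by (rule torus_nonzero)
  have "((\<lambda>s. c * s powi e) has_field_derivative c * (of_int e * (t $ i) powi (e - 1) * 1)) (at (t $ i))"
    using ti by (intro DERIV_cmult DERIV_power_int DERIV_ident) auto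
  moreover have "\<forall>\<^sub>F s in nhds (t $ i). s \<in> - {0}"
    by (rule eventually_nhds_in_open) (use ti in auto)
  then have "\<forall>\<^sub>F s in nhds (t $ i). weight_field I A (upd t i s) $ K = c * s powi e"
    by (rule eventually_mono) (use eq in auto)
  ultimately have "((\<lambda>s. weight_field I A (upd t i s) $ K) has_field_derivative
      c * (of_int e * (t $ i) powi (e - 1) * 1)) (at (t $ i))"
    by (subst DERIV_cong_ev[OF refl _ refl]) auto
  moreover have "c * (of_int e * (t $ i) powi (e - 1) * 1) = (of_int e / t $ i) * weight_field I A t $ K"
    using eq[OF ti] ti by (simp add: power_int_diff)
  ultimately show "((\<lambda>s. weight_field I A (upd t i s) $ K) has_field_derivative
      (\<chi> K. ((of_int (I $ i) + (if i \<in> K then 1 else 0)) / t $ i) * weight_field I A t $ K) $ K)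
      (at (t $ i))"
    by (simp only: e vec_lambda_beta)
qed

lemma torus_differentiable_weight_field: "torus_differentiable (weight_field I A)"
  unfolding torus_differentiable_def using has_pderiv_weight_field by blast

lemma torus_differentiable_add:
  "torus_differentiable f \<Longrightarrow> torus_differentiable g \<Longrightarrow> torus_differentiable (\<lambda>t. f t + g t)"
  unfolding torus_differentiable_def using has_pderiv_add by blast

lemma torus_differentiable_zero: "torus_differentiable (\<lambda>t. 0)"
  unfolding torus_differentiable_def has_pderiv_def
  by (intro ballI allI exI[of _ 0]) simp

lemma torus_differentiable_sum:
  "(\<And>I. I \<in> S \<Longrightarrow> torus_differentiable (f I)) \<Longrightarrow> torus_differentiable (\<lambda>t. \<Sum>I\<in>S. f I t)"
  by (induction S rule: infinite_finite_induct)
    (auto intro: torus_differentiable_add torus_differentiable_zero)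

text \<open>
  On weight fields this is \<open>\<chi>\<^sup>I \<rho>(A) \<mapsto> \<chi>\<^sup>I \<rho>(\<iota>\<^bsub>\<delta>-I\<^esub> A)\<close>; as a differential operator it is visibly
  independent of how a field is written as a sum of weight fields. The summand \<open>1\<close> in
  \<open>\<delta>\<^sub>i + 1\<close> comes from \<open>\<partial>\<^sub>i\<close> acting on the frame \<open>t\<^sub>i \<partial>/\<partial>t\<^sub>i\<close>.
\<close>

definition bv_op :: "'n::{finite,linorder} cvec \<Rightarrow> 'n field \<Rightarrow> 'n field" where
  "bv_op \<delta> f t =
    (if t \<in> torus then
       \<Sum>i\<in>UNIV. ((\<delta> $ i + 1) / t $ i) *s contract (axis i 1) (f t)
                 - contract (axis i 1) (partial_deriv i f t)
     else 0)"

section \<open>Linearity of \<open>bv_op\<close>, its weights, and its bracket\<close>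

lemma bv_op_add:
  assumes "torus_differentiable f" "torus_differentiable g"
  shows "bv_op \<delta> (\<lambda>t. f t + g t) = (\<lambda>t. bv_op \<delta> f t + bv_op \<delta> g t)"
proof
  fix t
  have "partial_deriv i (\<lambda>t. f t + g t) t = partial_deriv i f t + partial_deriv i g t"
    if "t \<in> torus" for i
    using has_pderiv_add torus_differentiableD assms that by (blast intro: partial_deriv_eq)
  then show "bv_op \<delta> (\<lambda>t. f t + g t) t = bv_op \<delta> f t + bv_op \<delta> g t"
    by (auto simp: bv_op_def vec.scale_right_distrib algebra_simps simp flip: sum.distrib intro!: sum.cong)
qed

lemma bv_op_scale:
  assumes "torus_differentiable f"
  shows "bv_op \<delta> (\<lambda>t. c *s f t) = (\<lambda>t. c *s bv_op \<delta> f t)"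
proof
  fix t
  have "partial_deriv i (\<lambda>t. c *s f t) t = c *s partial_deriv i f t"
    if "t \<in> torus" for i
    using has_pderiv_scale torus_differentiableD assms that by (blast intro: partial_deriv_eq)
  then show "bv_op \<delta> (\<lambda>t. c *s f t) t = c *s bv_op \<delta> f t"
    by (simp add: bv_op_def vec.scale_sum_right vec.scale_right_diff_distrib vector_smult_assoc mult.commute)
qed

lemma bv_op_zero [simp]: "bv_op \<delta> (\<lambda>t. 0) = (\<lambda>t. 0)"
  using bv_op_scale[OF torus_differentiable_zero, of \<delta> 0] by simp

lemma bv_op_sum:
  "(\<And>I. I \<in> S \<Longrightarrow> torus_differentiable (f I)) \<Longrightarrow>
    bv_op \<delta> (\<lambda>t. \<Sum>I\<in>S. f I t) = (\<lambda>t. \<Sum>I\<in>S. bv_op \<delta> (f I) t)"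
  by (induction S rule: infinite_finite_induct)
    (auto simp: bv_op_add torus_differentiable_sum)

text \<open>Contraction in direction i reads only coefficients at sets containing i, where the
  derivative produces I_i + 1; the difference to \<delta>_i + 1 is \<delta>_i - I_i. The division by
  t_i removes the extra frame factor.\<close>

lemma bv_op_weight_field:
  "bv_op \<delta> (weight_field I A) = weight_field I (contract (\<delta> - cplx_of_lattice I) A)"
proof
  fix t
  show "bv_op \<delta> (weight_field I A) t = weight_field I (contract (\<delta> - cplx_of_lattice I) A) t"
  proof (cases "t \<in> torus")
    case t: True
    define c where "c = character I t"
    show ?thesis
    proof (rule ext_eqI)
      fix K
      have "bv_op \<delta> (weight_field I A) t $ K =
        (\<Sum>i\<in>UNIV. if i \<in> K then 0 else
          c * (\<Prod>j\<in>K. t $ j) * ((- 1) ^ card {j\<in>K. j < i} * (\<delta> - cplx_of_lattice I) $ i * A $ (insert i K)))"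
        unfolding bv_op_def if_P[OF t] sum_component
      proof (rule sum.cong[OF refl])
        fix i
        have "t $ i \<noteq> 0" using t by (rule torus_nonzero)
        moreover have "partial_deriv i (weight_field I A) t =
            (\<chi> K. ((of_int (I $ i) + (if i \<in> K then 1 else 0)) / t $ i) * weight_field I A t $ K)"
          by (rule partial_deriv_eq[OF has_pderiv_weight_field[OF t]])
        ultimately show "(((\<delta> $ i + 1) / t $ i) *s contract (axis i 1) (weight_field I A t)
              - contract (axis i 1) (partial_deriv i (weight_field I A) t)) $ K =
          (if i \<in> K then 0 else
            c * (\<Prod>j\<in>K. t $ j) * ((- 1) ^ card {j\<in>K. j < i} * (\<delta> - cplx_of_lattice I) $ i * A $ (insert i K)))"
          by (simp add: contract_axis_nth weight_field_nth[OF t] c_def cplx_of_lattice_def field_simps)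
      qed
      also have "\<dots> = (\<Sum>i\<in>- K. c * (\<Prod>j\<in>K. t $ j) *
          ((- 1) ^ card {j\<in>K. j < i} * (\<delta> - cplx_of_lattice I) $ i * A $ (insert i K)))"
        by (rule sum.mono_neutral_cong_right) auto
      also have "\<dots> = weight_field I (contract (\<delta> - cplx_of_lattice I) A) t $ K"
        by (simp add: weight_field_nth[OF t] c_def contract_nth sum_distrib_left)
      finally show "bv_op \<delta> (weight_field I A) t $ K =
          weight_field I (contract (\<delta> - cplx_of_lattice I) A) t $ K" .
    qed
  qed (simp add: bv_op_def)
qed

text \<open>In each direction i the terms of order zero, and those in which contraction and
  derivative hit the same factor, cancel by the derivation rule. Only the two crossed terms of the
  Schouten bracket survive, so the result does not depend on \<delta>.\<close>

lemma bv_op_wedge: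
  assumes f: "torus_differentiable f" "\<And>t. homog k (f t)" and g: "torus_differentiable g"
  shows "schouten f g t = (- 1) ^ k *s
    (bv_op \<delta> (field_wedge f g) t - field_wedge (bv_op \<delta> f) g t
      - (- 1) ^ k *s field_wedge f (bv_op \<delta> g) t)"
proof (cases "t \<in> torus")
  case t: True
  define a where "a i = (\<delta> $ i + 1) / t $ i" for i
  define C where "C i = contract (axis i (1::complex))" for i :: 'a
  define \<epsilon> :: complex where "\<epsilon> = (- 1) ^ k"
  define G where "G i = partial_deriv i f t" for i
  define H where "H i = partial_deriv i g t" for i
  have \<epsilon>: "\<epsilon> * \<epsilon> = 1" by (simp add: \<epsilon>_def flip: power_mult_distrib)
  have pd: "partial_deriv i (field_wedge f g) t = G i \<and>\<^sub>e g t + f t \<and>\<^sub>e H i" for i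
    unfolding G_def H_def
    by (intro partial_deriv_eq has_pderiv_wedge torus_differentiableD f g t)
  have hG: "homog k (G i)" for i
    using f(2) by (auto simp: G_def partial_deriv_def homog_def)
  have gi: "grade_inv (f t) = \<epsilon> *s f t" "grade_inv (G i) = \<epsilon> *s G i" for i
    using homog_grade_inv f(2) hG unfolding \<epsilon>_def by blast+
  \<comment> \<open>In degree 0 the truncated degree of the contraction would give the wrong sign,
    but there the contraction is 0.\<close>
  have gC: "grade_inv (C i (f t)) = - (\<epsilon> *s C i (f t))" for i
  proof (cases k)
    case 0
    then show ?thesis using f(2)[of t] homog_0_contract[of "f t"]
      by (auto simp: C_def intro!: ext_eqI simp: grade_inv_nth)
  next
    case (Suc l)
    then show ?thesis
      using homog_grade_inv[OF homog_contract[OF f(2)[of t], of "axis i 1"]]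
      by (simp add: C_def \<epsilon>_def vector_smult_lneg)
  qed
  have summand: "\<epsilon> *s (a i *s C i (f t \<and>\<^sub>e g t) - C i (G i \<and>\<^sub>e g t + f t \<and>\<^sub>e H i)
      - (a i *s C i (f t) - C i (G i)) \<and>\<^sub>e g t
      - \<epsilon> *s (f t \<and>\<^sub>e (a i *s C i (g t) - C i (H i)))) =
    grade_inv (C i (f t)) \<and>\<^sub>e H i - G i \<and>\<^sub>e C i (g t)" for i
  proof -
    have w: "C i (A \<and>\<^sub>e B) = C i A \<and>\<^sub>e B + grade_inv A \<and>\<^sub>e C i B" for A B
      by (simp add: C_def contract_wedge)
    have "a i *s C i (f t \<and>\<^sub>e g t) - C i (G i \<and>\<^sub>e g t + f t \<and>\<^sub>e H i)
      - (a i *s C i (f t) - C i (G i)) \<and>\<^sub>e g t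
      - \<epsilon> *s (f t \<and>\<^sub>e (a i *s C i (g t) - C i (H i))) =
      - (\<epsilon> *s (G i \<and>\<^sub>e C i (g t))) - C i (f t) \<and>\<^sub>e H i"
      unfolding w gi
      by (simp add: C_def[symmetric] w gi wedge_diff_left wedge_diff_right wedge_add_left wedge_add_right
          vec.scale_right_distrib vec.scale_right_diff_distrib vector_smult_assoc mult.commute
          contract_add[of "axis i 1", folded C_def])
    then show ?thesis
      by (simp add: gC vec.scale_right_diff_distrib vector_smult_assoc \<epsilon> vector_smult_rneg)
  qed
  define X where "X i = a i *s C i (f t \<and>\<^sub>e g t) - C i (G i \<and>\<^sub>e g t + f t \<and>\<^sub>e H i)" for i
  define Y where "Y i = a i *s C i (f t) - C i (G i)" for i
  define Z where "Z i = a i *s C i (g t) - C i (H i)" for i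
  have X: "bv_op \<delta> (field_wedge f g) t = (\<Sum>i\<in>UNIV. X i)"
    unfolding bv_op_def if_P[OF t] pd X_def a_def C_def by (simp add: field_wedge_def)
  have Y: "bv_op \<delta> f t = (\<Sum>i\<in>UNIV. Y i)" and Z: "bv_op \<delta> g t = (\<Sum>i\<in>UNIV. Z i)"
    unfolding bv_op_def if_P[OF t] Y_def Z_def a_def C_def G_def H_def by simp_all
  have "\<epsilon> *s (bv_op \<delta> (field_wedge f g) t - field_wedge (bv_op \<delta> f) g t
      - \<epsilon> *s field_wedge f (bv_op \<delta> g) t) =
    (\<Sum>i\<in>UNIV. \<epsilon> *s (X i - Y i \<and>\<^sub>e g t - \<epsilon> *s (f t \<and>\<^sub>e Z i)))"
    unfolding field_wedge_def[of _ g] field_wedge_def[of f] X[unfolded field_wedge_def] Y Z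
    by (simp add: wedge_sum_left wedge_sum_right vec.scale_sum_right sum_subtractf
        vec.scale_right_diff_distrib)
  also have "\<dots> = schouten f g t"
    unfolding X_def Y_def Z_def summand using t by (simp add: schouten_def G_def H_def C_def)
  finally show ?thesis by (simp add: \<epsilon>_def)
qed (simp add: bv_op_def schouten_def field_wedge_def)

section \<open>Holomorphic functions of polynomial growth on the torus\<close>

text \<open>The factor s^R makes the singularity at 0 removable, and the extended function grows at
  infinity at most like the power 2R: one \<open>R\<close> from the bound on g, one from the factor.
  Liouville's theorem then gives a polynomial.\<close>

lemma laurent_polynomial:
  fixes g :: "complex \<Rightarrow> complex"
  assumes hol: "g holomorphic_on - {0}"
    and bound: "\<And>s. s \<noteq> 0 \<Longrightarrow> norm (g s) \<le> C * (norm s + inverse (norm s)) ^ R"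
  shows "\<exists>p. degree p \<le> 2 * R \<and> (\<forall>s. s \<noteq> 0 \<longrightarrow> s ^ R * g s = poly p s)"
proof -
  define f where "f s = s ^ R * g s" for s
  have C: "0 \<le> C"
  proof -
    have "0 \<le> C * 2 ^ R" using bound[of 1] norm_ge_zero[of "g 1"] by (simp del: norm_ge_zero)
    moreover have "\<not> 2 ^ R \<le> (0::real)" by (simp add: not_le)
    ultimately show ?thesis by (simp add: zero_le_mult_iff)
  qed
  have fb: "norm (f s) \<le> C * ((norm s)\<^sup>2 + 1) ^ R" if "s \<noteq> 0" for s
  proof -
    have "norm (f s) \<le> norm s ^ R * (C * (norm s + inverse (norm s)) ^ R)"
      unfolding f_def norm_mult norm_power using bound[OF that] by (intro mult_left_mono) auto
    also have "\<dots> = C * (norm s * (norm s + inverse (norm s))) ^ R"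
      by (simp add: power_mult_distrib mult_ac)
    also have "norm s * (norm s + inverse (norm s)) = (norm s)\<^sup>2 + 1"
      using that by (simp add: distrib_left power2_eq_square)
    finally show ?thesis .
  qed
  have "f holomorphic_on (UNIV - {0})"
    unfolding f_def using hol by (intro holomorphic_intros) (simp add: Compl_eq_Diff_UNIV)
  moreover have "\<forall>\<^sub>F z in at 0. norm (f z) \<le> C * 2 ^ R"
  proof (rule eventually_at_ball'[THEN eventually_mono, of 1])
    fix z :: complex assume z: "z \<in> ball 0 1 \<and> z \<noteq> 0 \<and> z \<in> UNIV"
    have "norm (f z) \<le> C * ((norm z)\<^sup>2 + 1) ^ R" using fb z by blast
    also have "\<dots> \<le> C * 2 ^ R"
      using z C power_le_one[of "norm z" 2] by (intro mult_left_mono power_mono) auto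
    finally show "norm (f z) \<le> C * 2 ^ R" .
  qed simp
  ultimately obtain G where G: "G holomorphic_on UNIV" "\<And>z. z \<noteq> 0 \<Longrightarrow> G z = f z"
    using holomorphic_on_extend_bounded[of f UNIV 0] by auto
  have "norm (G z) \<le> (C * 2 ^ R) * norm z ^ (2 * R)" if "1 \<le> norm z" for z
  proof -
    have "z \<noteq> 0" using that by auto
    then have "norm (G z) \<le> C * ((norm z)\<^sup>2 + 1) ^ R" using fb G by simp
    also have "\<dots> \<le> C * (2 * (norm z)\<^sup>2) ^ R"
      using that C one_le_power[of "norm z" 2] by (intro mult_left_mono power_mono) auto
    finally show ?thesis by (simp add: power_mult_distrib mult_ac flip: power_mult)
  qed
  then have G_sum: "G z = (\<Sum>k\<le>2 * R. (deriv ^^ k) G 0 / fact k * z ^ k)" for z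
    by (rule Liouville_polynomial[OF G(1)])
  define p where "p = (\<Sum>k\<le>2 * R. monom ((deriv ^^ k) G 0 / fact k) k)"
  have "degree p \<le> 2 * R"
    unfolding p_def by (intro degree_sum_le) (auto intro: order_trans[OF degree_monom_le])
  moreover have "s ^ R * g s = poly p s" if "s \<noteq> 0" for s
    using G(2)[OF that] G_sum[of s] by (simp add: p_def f_def poly_sum poly_monom)
  ultimately show ?thesis by blast
qed

text \<open>The nodes \<open>1, \<dots>, d + 1\<close> avoid \<open>0\<close>, where Laurent polynomials are not defined.\<close>

lemma interpolation:
  obtains L :: "nat \<Rightarrow> complex poly" where
    "\<And>p. degree p \<le> d \<Longrightarrow> p = (\<Sum>m\<le>d. smult (poly p (of_nat (Suc m))) (L m))"
proof -
  define x :: "nat \<Rightarrow> complex" where "x m = of_nat (Suc m)" for m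
  define L where "L m = smult (inverse (\<Prod>q\<in>{..d} - {m}. x m - x q)) (\<Prod>q\<in>{..d} - {m}. [:- x q, 1:])" for m
  have inj: "inj x" by (simp add: x_def inj_def)
  have L_node: "poly (L m) (x l) = (if l = m then 1 else 0)" if "l \<le> d" "m \<le> d" for l m
  proof (cases "l = m")
    case True
    have "(\<Prod>q\<in>{..d} - {m}. x m - x q) \<noteq> 0" by (auto simp: inj_eq[OF inj])
    then show ?thesis using True by (simp add: L_def poly_prod)
  next
    case False
    have "(\<Prod>q\<in>{..d} - {m}. x l - x q) = 0"
      by (rule prod_zero) (use that False in auto)
    then show ?thesis using False by (simp add: L_def poly_prod)
  qed
  have L_degree: "degree (L m) \<le> d" if "m \<le> d" for m
  proof -
    have "degree (L m) \<le> degree (\<Prod>q\<in>{..d} - {m}. [:- x q, 1:])"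
      unfolding L_def by (rule degree_smult_le)
    also have "\<dots> \<le> sum (degree \<circ> (\<lambda>q. [:- x q, 1:])) ({..d} - {m})"
      by (rule degree_prod_sum_le) simp
    also have "\<dots> = d" using that by simp
    finally show ?thesis .
  qed
  have "p = (\<Sum>m\<le>d. smult (poly p (x m)) (L m))" if p: "degree p \<le> d" for p
  proof -
    show "p = (\<Sum>m\<le>d. smult (poly p (x m)) (L m))"
    proof (rule poly_eqI_degree[of "x ` {..d}"])
      fix z assume "z \<in> x ` {..d}"
      then obtain l where l: "l \<le> d" "z = x l" by auto
      have "poly (\<Sum>m\<le>d. smult (poly p (x m)) (L m)) z =
          (\<Sum>m\<le>d. if m = l then poly p (x l) else 0)"
        unfolding poly_sum l(2) by (rule sum.cong) (use l in \<open>auto simp: L_node\<close>)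
      then show "poly p z = poly (\<Sum>m\<le>d. smult (poly p (x m)) (L m)) z"
        using l by simp
    next
      have card: "card (x ` {..d}) = Suc d"
        using card_image[OF inj_on_subset[OF inj], of "{..d}"] by simp
      then show "degree p < card (x ` {..d})" using p by simp
      have "degree (\<Sum>m\<le>d. smult (poly p (x m)) (L m)) \<le> d"
        by (intro degree_sum_le) (auto intro: order_trans[OF degree_smult_le] L_degree)
      then show "degree (\<Sum>m\<le>d. smult (poly p (x m)) (L m)) < card (x ` {..d})"
        using card by simp
    qed
  qed
  then show thesis unfolding x_def by (rule that)
qed

section \<open>Laurent polynomials in several variables\<close>

definition char_sum :: "('n::finite cvec \<Rightarrow> complex) \<Rightarrow> bool" where
  "char_sum F \<longleftrightarrow> (\<exists>S c. finite S \<and> (\<forall>t\<in>torus. F t = (\<Sum>I\<in>S. c I * character I t)))"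

lemma char_sum_cong:
  "char_sum F \<Longrightarrow> (\<And>t. t \<in> torus \<Longrightarrow> G t = F t) \<Longrightarrow> char_sum G"
  by (auto simp: char_sum_def)

lemma char_sum_scale: "char_sum F \<Longrightarrow> char_sum (\<lambda>t. a * F t)"
proof -
  assume "char_sum F"
  then obtain S c where "finite S" "\<And>t. t \<in> torus \<Longrightarrow> F t = (\<Sum>I\<in>S. c I * character I t)"
    by (auto simp: char_sum_def)
  then show ?thesis unfolding char_sum_def
    by (intro exI[of _ S] exI[of _ "\<lambda>I. a * c I"]) (simp add: sum_distrib_left mult.assoc)
qed

lemma char_sum_add:
  assumes "char_sum F" "char_sum G"
  shows "char_sum (\<lambda>t. F t + G t)"
proof -
  obtain S c where F: "finite S" "\<And>t. t \<in> torus \<Longrightarrow> F t = (\<Sum>I\<in>S. c I * character I t)"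
    using assms(1) by (auto simp: char_sum_def)
  obtain T b where G: "finite T" "\<And>t. t \<in> torus \<Longrightarrow> G t = (\<Sum>I\<in>T. b I * character I t)"
    using assms(2) by (auto simp: char_sum_def)
  let ?c = "\<lambda>I. (if I \<in> S then c I else 0)" and ?b = "\<lambda>I. (if I \<in> T then b I else 0)"
  have "F t + G t = (\<Sum>I\<in>S \<union> T. (?c I + ?b I) * character I t)" if "t \<in> torus" for t
  proof -
    have "F t = (\<Sum>I\<in>S \<union> T. ?c I * character I t)"
      unfolding F(2)[OF that] by (rule sum.mono_neutral_cong_left) (use F G in auto)
    moreover have "G t = (\<Sum>I\<in>S \<union> T. ?b I * character I t)"
      unfolding G(2)[OF that] by (rule sum.mono_neutral_cong_left) (use F G in auto)
    ultimately show ?thesis by (simp add: sum.distrib distrib_right)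
  qed
  then show ?thesis unfolding char_sum_def using F(1) G(1)
    by (intro exI[of _ "S \<union> T"] exI[of _ "\<lambda>I. ?c I + ?b I"]) auto
qed

lemma char_sum_sum:
  "finite A \<Longrightarrow> (\<And>m. m \<in> A \<Longrightarrow> char_sum (F m)) \<Longrightarrow> char_sum (\<lambda>t. \<Sum>m\<in>A. F m t)"
proof (induction A rule: finite_induct)
  case empty
  show ?case unfolding char_sum_def by (intro exI[of _ "{}"]) simp
qed (auto intro: char_sum_add)

lemma char_sum_const: "char_sum (\<lambda>t. a)"
  unfolding char_sum_def by (intro exI[of _ "{0}"] exI[of _ "\<lambda>_. a"]) simp

lemma char_sum_character_mult:
  assumes "char_sum F"
  shows "char_sum (\<lambda>t. character J t * F t)"
proof -
  obtain S c where F: "finite S" "\<And>t. t \<in> torus \<Longrightarrow> F t = (\<Sum>I\<in>S. c I * character I t)"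
    using assms by (auto simp: char_sum_def)
  have "character J t * F t = (\<Sum>I\<in>(+) J ` S. c (I - J) * character I t)" if "t \<in> torus" for t
    using that by (subst sum.reindex) (auto simp: F(2) character_add sum_distrib_left mult_ac)
  then show ?thesis unfolding char_sum_def using F(1)
    by (intro exI[of _ "(+) J ` S"] exI[of _ "\<lambda>I. c (I - J)"]) auto
qed

lemma upd_upd:
  "upd (upd t i r) j s = (if i = j then upd t i s else upd (upd t j s) i r)"
  by (auto simp: upd_def vec_eq_iff)

lemma character_axis: "character (axis j k) t = (t $ j) powi k"
proof -
  have "character (axis j k) t = (\<Prod>i\<in>UNIV. if i = j then (t $ j) powi k else 1)"
    unfolding character_def by (rule prod.cong) (auto simp: axis_def)
  then show ?thesis by simp
qed

text \<open>A Laurent polynomial in each variable, with exponents between -R and d - R for all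
  values of the other variables. This uniformity is what permits interpolation at fixed
  nodes.\<close>

definition separately_laurent :: "nat \<Rightarrow> nat \<Rightarrow> ('n::finite cvec \<Rightarrow> complex) \<Rightarrow> bool" where
  "separately_laurent d R F \<longleftrightarrow>
    (\<forall>t\<in>torus. \<forall>i. \<exists>p. degree p \<le> d \<and> (\<forall>s. s \<noteq> 0 \<longrightarrow> s ^ R * F (upd t i s) = poly p s))"

text \<open>Induction on the set of variables on which \<open>F\<close> depends: interpolation in
  the j-th variable writes \<open>F\<close> as a combination of Laurent polynomials in that
  variable, with coefficients the values of \<open>F\<close> at the nodes, which no longer depend on
  it.\<close>

lemma separately_laurent_char_sum_aux:
  fixes F :: "'n::finite cvec \<Rightarrow> complex"
  assumes "finite S" "R \<le> d" "separately_laurent d R F"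
    and "\<And>t t'. t \<in> torus \<Longrightarrow> t' \<in> torus \<Longrightarrow> (\<And>i. i \<in> S \<Longrightarrow> t $ i = t' $ i) \<Longrightarrow> F t = F t'"
  shows "char_sum F"
  using assms(1,3,4)
proof (induction S arbitrary: F rule: finite_induct)
  case empty
  have "F t = F 1" if "t \<in> torus" for t
    by (rule empty.prems(2)[OF that]) (auto simp: torus_def)
  then show ?case using char_sum_cong[OF char_sum_const] by blast
next
  case (insert j S)
  obtain L :: "nat \<Rightarrow> complex poly" where
    L: "\<And>p. degree p \<le> d \<Longrightarrow> p = (\<Sum>m\<le>d. smult (poly p (of_nat (Suc m))) (L m))"
    using interpolation[of d] by blast
  define x :: "nat \<Rightarrow> complex" where "x m = of_nat (Suc m)" for m
  have x: "x m \<noteq> 0" for m by (simp add: x_def del: of_nat_Suc)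
  have F: "F t = (\<Sum>m\<le>d. (x m ^ R * (poly (L m) (t $ j) * (t $ j) powi (- int R))) * F (upd t j (x m)))"
    if t: "t \<in> torus" for t
  proof -
    obtain p where p: "degree p \<le> d" "\<And>s. s \<noteq> 0 \<Longrightarrow> s ^ R * F (upd t j s) = poly p s"
      using insert.prems(1) t unfolding separately_laurent_def by blast
    have tj: "t $ j \<noteq> 0" using t by (rule torus_nonzero)
    have "(t $ j) ^ R * F t = poly p (t $ j)" using p(2)[OF tj] by simp
    also have "\<dots> = (\<Sum>m\<le>d. x m ^ R * F (upd t j (x m)) * poly (L m) (t $ j))"
      by (subst L[OF p(1), folded x_def]) (simp add: poly_sum p(2)[OF x, symmetric])
    finally have "F t = (t $ j) powi (- int R) * (\<Sum>m\<le>d. x m ^ R * F (upd t j (x m)) * poly (L m) (t $ j))"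
      using tj by (simp add: power_int_minus field_simps)
    then show ?thesis by (simp add: sum_distrib_left mult_ac)
  qed
  have IH: "char_sum (\<lambda>t. F (upd t j a))" if a: "a \<noteq> 0" for a
  proof (rule insert.IH)
    show "separately_laurent d R (\<lambda>t. F (upd t j a))"
      unfolding separately_laurent_def
    proof (intro ballI allI)
      fix t :: "'n cvec" and i assume t: "t \<in> torus"
      show "\<exists>p. degree p \<le> d \<and> (\<forall>s. s \<noteq> 0 \<longrightarrow> s ^ R * F (upd (upd t i s) j a) = poly p s)"
      proof (cases "i = j")
        case True
        \<comment> \<open>A frozen variable leaves a constant, and after multiplication by s^R its
          degree is \<open>R\<close>; hence the assumption \<open>R \<le> d\<close>.\<close>
        have "degree (monom (F (upd t j a)) R) \<le> d"
          using degree_monom_le assms(2) by (rule order_trans)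
        then show ?thesis using True
          by (intro exI[of _ "monom (F (upd t j a)) R"]) (simp add: upd_upd poly_monom)
      next
        case False
        then show ?thesis
          using insert.prems(1) upd_torus[OF t a, of j]
          by (simp add: upd_upd[of t i _ j] separately_laurent_def)
      qed
    qed
    show "F (upd t j a) = F (upd t' j a)"
      if "t \<in> torus" "t' \<in> torus" "\<And>i. i \<in> S \<Longrightarrow> t $ i = t' $ i" for t t'
      by (rule insert.prems(2)) (use that a in \<open>auto intro: upd_torus simp: upd_nth\<close>)
  qed
  have mult: "char_sum (\<lambda>t. (a * (poly q (t $ j) * (t $ j) powi e)) * G t)" if "char_sum G" for a q e G
  proof (rule char_sum_cong)
    show "char_sum (\<lambda>t. \<Sum>k\<le>degree q. (a * coeff q k) * (character (axis j (int k + e)) t * G t))"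
      by (intro char_sum_sum char_sum_scale char_sum_character_mult that) simp
    show "(a * (poly q (t $ j) * (t $ j) powi e)) * G t =
        (\<Sum>k\<le>degree q. (a * coeff q k) * (character (axis j (int k + e)) t * G t))"
      if "t \<in> torus" for t
      using torus_nonzero[OF that, of j]
      by (simp add: poly_altdef character_axis power_int_add sum_distrib_left sum_distrib_right mult_ac)
  qed
  show ?case
  proof (rule char_sum_cong[OF _ F])
    show "char_sum (\<lambda>t. \<Sum>m\<le>d. (x m ^ R * (poly (L m) (t $ j) * (t $ j) powi (- int R))) * F (upd t j (x m)))"
      by (rule char_sum_sum) (use mult[OF IH[OF x]] in auto)
  qed
qed

lemma separately_laurent_char_sum:
  "R \<le> d \<Longrightarrow> separately_laurent d R F \<Longrightarrow> char_sum F"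
  by (rule separately_laurent_char_sum_aux[of UNIV R d]) (auto simp: vec_eq_iff intro: arg_cong[of _ _ F])

section \<open>Charts\<close>

definition ipair :: "'n::finite ivec \<Rightarrow> 'n ivec \<Rightarrow> int" where
  "ipair I b = (\<Sum>i\<in>UNIV. I $ i * b $ i)"

lemma inner_ipair: "real_of_lattice I \<bullet> real_of_lattice b = of_int (ipair I b)"
  by (simp add: inner_real_of_lattice ipair_def)

text \<open>The differential of \<open>chart_param B\<close> at the unit of the torus, sending the
  j-th unit vector to the j-th row of \<open>B\<close>.\<close>

definition mat_map :: "('n::finite ivec, 'n) vec \<Rightarrow> 'n cvec \<Rightarrow> 'n cvec" where
  "mat_map B x = (\<chi> i. \<Sum>j\<in>UNIV. of_int (B $ j $ i) * x $ j)"

lemma clinear_mat_map: "clinear (mat_map B)"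
  by (simp add: clinear_def mat_map_def vec_eq_iff algebra_simps sum.distrib sum_distrib_left)

lemma mat_mult_nth:
  assumes "B ** A = mat 1"
  shows "(\<Sum>j\<in>UNIV. B $ l $ j * A $ j $ i) = (if l = i then 1 else 0)"
proof -
  have "(B ** A) $ l $ i = mat 1 $ l $ i" by (simp only: assms)
  then show ?thesis unfolding matrix_matrix_mult_def mat_def by simp
qed

lemma mat_map_inverse:
  assumes "B ** A = mat 1"
  shows "mat_map A (mat_map B x) = x"
proof -
  have "mat_map A (mat_map B x) $ i = x $ i" for i
  proof -
    have "mat_map A (mat_map B x) $ i =
        (\<Sum>j\<in>UNIV. \<Sum>l\<in>UNIV. of_int (B $ l $ j * A $ j $ i) * x $ l)"
      by (simp add: mat_map_def sum_distrib_left mult_ac)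
    also have "\<dots> = (\<Sum>l\<in>UNIV. of_int (\<Sum>j\<in>UNIV. B $ l $ j * A $ j $ i) * x $ l)"
      by (subst sum.swap) (simp add: sum_distrib_right)
    also have "\<dots> = (\<Sum>l\<in>UNIV. if l = i then x $ l else 0)"
      by (rule sum.cong) (auto simp: mat_mult_nth[OF assms] simp del: of_int_sum of_int_mult)
    also have "\<dots> = x $ i" by simp
    finally show ?thesis .
  qed
  then show ?thesis by (simp add: vec_eq_iff)
qed

lemma mat_map_axis: "mat_map B (axis j 1) = cplx_of_lattice (B $ j)"
  by (simp add: mat_map_def cplx_of_lattice_def axis_def vec_eq_iff if_distrib cong: if_cong)

lemma ext_map_mat_inverse:
  "B ** A = mat 1 \<Longrightarrow> ext_map (mat_map A) (ext_map (mat_map B) X) = X"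
  by (simp add: ext_map_comp clinear_mat_map mat_map_inverse)

section \<open>Monomial maps of the torus and their differentials\<close>

definition vinv :: "'n::finite cvec \<Rightarrow> 'n cvec" where
  "vinv z = (\<chi> i. inverse (z $ i))"

lemma diag_map_vinv:
  "z \<in> torus \<Longrightarrow> diag_map z (diag_map (vinv z) x) = x"
  "z \<in> torus \<Longrightarrow> diag_map (vinv z) (diag_map z x) = x"
  by (simp_all add: diag_map_def vinv_def vec_eq_iff torus_nonzero flip: mult.assoc)

lemma ext_map_diag_vinv:
  "z \<in> torus \<Longrightarrow> ext_map (diag_map z) (ext_map (diag_map (vinv z)) X) = X"
  "z \<in> torus \<Longrightarrow> ext_map (diag_map (vinv z)) (ext_map (diag_map z) X) = X"
  by (simp_all add: ext_map_comp clinear_diag_map diag_map_vinv)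

lemma power_int_sum:
  fixes x :: "'a::field"
  shows "x \<noteq> 0 \<Longrightarrow> x powi (\<Sum>i\<in>S. f i) = (\<Prod>i\<in>S. x powi (f i))"
  by (induction S rule: infinite_finite_induct) (auto simp: power_int_add)

lemma prod_power_int: "(\<Prod>i\<in>S. f i) powi k = (\<Prod>i\<in>S. f i powi k)" for f :: "_ \<Rightarrow> 'a::field"
  by (induction S rule: infinite_finite_induct) (auto simp: power_int_mult_distrib)

lemma character_chart_param:
  assumes "z \<in> torus"
  shows "character I (chart_param B z) = character (\<chi> j. ipair I (B $ j)) z"
proof -
  have "character I (chart_param B z) =
      (\<Prod>i\<in>UNIV. \<Prod>j\<in>UNIV. (z $ j) powi (I $ i * B $ j $ i))"
    by (simp add: character_def chart_param_def prod_power_int mult.commute flip: power_int_mult)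
  also have "\<dots> = (\<Prod>j\<in>UNIV. \<Prod>i\<in>UNIV. (z $ j) powi (I $ i * B $ j $ i))"
    by (rule prod.swap)
  finally show ?thesis
    using assms by (simp add: character_def ipair_def power_int_sum torus_nonzero)
qed

lemma chart_param_nth: "chart_param B z $ i = character (\<chi> j. B $ j $ i) z"
  by (simp add: chart_param_def character_def)

lemma chart_param_torus: "z \<in> torus \<Longrightarrow> chart_param B z \<in> torus"
  by (simp add: torus_def[of] chart_param_nth character_nonzero)

lemma character_diag_map: "character I (diag_map s t) = character I s * character I t"
  by (simp add: character_def diag_map_def power_int_mult_distrib prod.distrib)

lemma chart_param_diag_map:
  "chart_param B (diag_map s t) = diag_map (chart_param B s) (chart_param B t)"
  by (simp add: vec_eq_iff chart_param_nth character_diag_map diag_map_def[of "chart_param B s"])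

lemma chart_param_inverse:
  assumes "A ** B = mat 1" "t \<in> torus"
  shows "chart_param B (chart_param A t) = t"
proof -
  have "chart_param B (chart_param A t) $ i = t $ i" for i
  proof -
    have "(\<chi> l. ipair (\<chi> j. B $ j $ i) (A $ l)) = axis i 1"
      using mat_mult_nth[OF assms(1)] by (simp add: ipair_def vec_eq_iff axis_def mult.commute)
    then show ?thesis
      by (simp add: chart_param_nth[of B] character_chart_param[OF assms(2)] character_axis)
  qed
  then show ?thesis by (simp add: vec_eq_iff)
qed

lemma has_derivative_vec_lambda:
  fixes f :: "'i::finite \<Rightarrow> 'a::real_normed_vector \<Rightarrow> 'b::real_normed_vector"
  assumes "\<And>i. (f i has_derivative f' i) (at x)"
  shows "((\<lambda>x. \<chi> i. f i x) has_derivative (\<lambda>v. \<chi> i. f' i v)) (at x)"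
proof -
  have norm_axis: "norm (axis i x :: 'b ^ 'i) = norm x" for i and x :: 'b
  proof -
    have "(\<Sum>j\<in>UNIV. (norm (axis i x $ j))\<^sup>2) = (\<Sum>j\<in>UNIV. if j = i then (norm x)\<^sup>2 else 0)"
      by (rule sum.cong) (auto simp: axis_def)
    then show ?thesis by (simp add: norm_vec_def L2_set_def)
  qed
  have axis: "bounded_linear (axis i :: 'b \<Rightarrow> 'b ^ 'i)" for i
    by (rule bounded_linear_intro[where K = 1])
      (auto simp: norm_axis, auto simp: vec_eq_iff axis_def)
  have expand: "(\<chi> i. g i) = (\<Sum>i\<in>UNIV. axis i (g i))" for g :: "'i \<Rightarrow> 'b"
    by (simp add: vec_eq_iff axis_def if_distrib cong: if_cong)
  show ?thesis
    unfolding expand by (intro has_derivative_sum bounded_linear.has_derivative[OF axis] assms)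
qed

text \<open>In logarithmic coordinates a monomial map is linear, so its differential is
  \<open>mat_map B\<close> between the invariant frames at the two points.\<close>

lemma chart_param_has_derivative:
  assumes z: "z \<in> torus"
  shows "(chart_param B has_derivative
    (\<lambda>v. diag_map (chart_param B z) (mat_map B (diag_map (vinv z) v)))) (at z)"
proof -
  have comp: "((\<lambda>z. \<Prod>j\<in>UNIV. (z $ j) powi (B $ j $ i)) has_derivative
      (\<lambda>v. diag_map (chart_param B z) (mat_map B (diag_map (vinv z) v)) $ i)) (at z)" for i
  proof -
    have d: "((\<lambda>z. (z $ j) powi (B $ j $ i)) has_derivative
        (\<lambda>v. v $ j * (of_int (B $ j $ i) * (z $ j) powi (B $ j $ i - 1)))) (at z)" for j
      using z by (intro has_derivative_power_int bounded_linear_vec_nth bounded_linear_imp_has_derivative)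
        (simp add: torus_nonzero)
    have eq: "(\<Sum>j\<in>UNIV. v $ j * (of_int (B $ j $ i) * (z $ j) powi (B $ j $ i - 1)) *
        (\<Prod>l\<in>UNIV - {j}. (z $ l) powi (B $ l $ i))) =
        diag_map (chart_param B z) (mat_map B (diag_map (vinv z) v)) $ i" for v
    proof -
      have "v $ j * (of_int (B $ j $ i) * (z $ j) powi (B $ j $ i - 1)) *
          (\<Prod>l\<in>UNIV - {j}. (z $ l) powi (B $ l $ i)) =
          (\<Prod>l\<in>UNIV. (z $ l) powi (B $ l $ i)) * (of_int (B $ j $ i) * (inverse (z $ j) * v $ j))" for j
        using torus_nonzero[OF z, of j]
        by (subst prod.remove[of UNIV j]) (auto simp: power_int_diff field_simps)
      then show ?thesis
        unfolding diag_map_def mat_map_def vinv_def chart_param_def vec_lambda_beta sum_distrib_left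
        by (intro sum.cong refl)
    qed
    have "((\<lambda>z. \<Prod>j\<in>UNIV. (z $ j) powi (B $ j $ i)) has_derivative
        (\<lambda>v. \<Sum>j\<in>UNIV. v $ j * (of_int (B $ j $ i) * (z $ j) powi (B $ j $ i - 1)) *
          (\<Prod>l\<in>UNIV - {j}. (z $ l) powi (B $ l $ i)))) (at z)"
      by (rule has_derivative_prod) (rule d)
    then show ?thesis by (simp only: eq)
  qed
  have "((\<lambda>z. \<chi> i. \<Prod>j\<in>UNIV. (z $ j) powi (B $ j $ i)) has_derivative
      (\<lambda>v. \<chi> i. diag_map (chart_param B z) (mat_map B (diag_map (vinv z) v)) $ i)) (at z)"
    by (rule has_derivative_vec_lambda) (rule comp)
  then show ?thesis by (simp add: chart_param_def[abs_def])
qed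

lemma frechet_chart_param:
  "z \<in> torus \<Longrightarrow> frechet_derivative (chart_param B) (at z) =
    (\<lambda>v. diag_map (chart_param B z) (mat_map B (diag_map (vinv z) v)))"
  using frechet_derivative_at[OF chart_param_has_derivative] by metis

text \<open>
  The field on \<open>\<complex>\<^sup>n\<close> whose push-forward along \<open>chart_param B\<close> is \<open>f\<close>, where \<open>A\<close> is the
  inverse matrix of \<open>B\<close>.
\<close>

definition chart_field ::
    "('n::{finite,linorder} ivec, 'n) vec \<Rightarrow> ('n ivec, 'n) vec \<Rightarrow> 'n field \<Rightarrow> 'n field" where
  "chart_field B A f z = ext_map (diag_map z) (ext_map (mat_map A)
     (ext_map (diag_map (vinv (chart_param B z))) (f (chart_param B z))))"

lemma chart_field_iff:
  assumes "z \<in> torus" "B ** A = mat 1" "A ** B = mat 1"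
  shows "f (chart_param B z) = ext_map (frechet_derivative (chart_param B) (at z)) H \<longleftrightarrow>
    H = chart_field B A f z"
proof -
  let ?w = "chart_param B z"
  have w: "?w \<in> torus" using assms(1) by (rule chart_param_torus)
  have "clinear (\<lambda>v. mat_map B (diag_map (vinv z) v))"
    using clinear_mat_map[of B] clinear_diag_map[of "vinv z"] by (simp add: clinear_def)
  then have fd: "ext_map (frechet_derivative (chart_param B) (at z)) H =
      ext_map (diag_map ?w) (ext_map (mat_map B) (ext_map (diag_map (vinv z)) H))" for H
    by (simp add: frechet_chart_param[OF assms(1)] ext_map_comp clinear_mat_map clinear_diag_map)
  show ?thesis
  proof
    assume "f ?w = ext_map (frechet_derivative (chart_param B) (at z)) H"
    then show "H = chart_field B A f z"
      unfolding fd by (simp add: chart_field_def ext_map_diag_vinv w ext_map_mat_inverse assms)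
  next
    assume H: "H = chart_field B A f z"
    show "f ?w = ext_map (frechet_derivative (chart_param B) (at z)) H"
      unfolding fd H by (simp add: chart_field_def ext_map_diag_vinv w ext_map_mat_inverse assms)
  qed
qed

text \<open>A weight field stays monomial in every chart: the exponents are the pairings of
  \<open>I\<close> with the rows of \<open>B\<close>, raised by 1 for indices in \<open>K\<close>.
  All conditions along the toric divisors are read off here.\<close>

lemma chart_field_weight_field_nth:
  assumes "z \<in> torus"
  shows "chart_field B A (weight_field I M) z $ K =
    character (\<chi> j. ipair I (B $ j)) z * (\<Prod>k\<in>K. z $ k) * ext_map (mat_map A) M $ K"
  using chart_param_torus[OF assms, of B]
  by (simp add: chart_field_def weight_field_def rho_diag ext_map_scale ext_map_diag_vinv
      ext_map_diag[of z] character_chart_param[OF assms])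

lemma chart_basis_inverse:
  assumes "B \<in> chart_bases \<Delta>"
  obtains A where "B ** A = mat 1" "A ** B = mat 1"
  using assms unfolding chart_bases_def invertible_def by auto

lemma axis_wedge_eq_0_iff:
  "ext_vector (axis j 1) \<and>\<^sub>e N = 0 \<longleftrightarrow> (\<forall>K. j \<notin> K \<longrightarrow> N $ K = 0)"
proof -
  have nth: "(ext_vector (axis j 1) \<and>\<^sub>e N) $ K =
      (if j \<in> K then (- 1) ^ card {i \<in> K. i < j} * N $ (K - {j}) else 0)" for K
  proof -
    have "(ext_vector (axis j 1) \<and>\<^sub>e N) $ K =
        (\<Sum>i\<in>K. if i = j then (- 1) ^ card {i \<in> K. i < j} * N $ (K - {j}) else 0)"
      unfolding vec_wedge_nth by (rule sum.cong) (auto simp: axis_def)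
    then show ?thesis by simp
  qed
  show ?thesis
  proof
    assume *: "ext_vector (axis j 1) \<and>\<^sub>e N = 0"
    show "\<forall>K. j \<notin> K \<longrightarrow> N $ K = 0"
    proof (intro allI impI)
      fix K assume "j \<notin> K"
      then show "N $ K = 0" using nth[of "insert j K"] * by simp
    qed
  next
    assume "\<forall>K. j \<notin> K \<longrightarrow> N $ K = 0"
    then show "ext_vector (axis j 1) \<and>\<^sub>e N = 0" by (intro ext_eqI) (simp add: nth)
  qed
qed

text \<open>The inverse matrix turns the j-th row into the j-th unit vector, and annihilation by a
  unit vector means that all nonzero coefficients sit at sets containing j.\<close>

lemma row_wedge_eq_0_iff:
  assumes "B ** A = mat 1" "A ** B = mat 1"
  shows "ext_vector (cplx_of_lattice (B $ j)) \<and>\<^sub>e M = 0 \<longleftrightarrow>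
    (\<forall>K. j \<notin> K \<longrightarrow> ext_map (mat_map A) M $ K = 0)"
proof -
  have row: "mat_map A (cplx_of_lattice (B $ j)) = axis j 1"
    by (simp add: mat_map_inverse[OF assms(1)] flip: mat_map_axis)
  have "ext_map (mat_map A) (ext_vector (cplx_of_lattice (B $ j)) \<and>\<^sub>e M) =
      ext_vector (axis j 1) \<and>\<^sub>e ext_map (mat_map A) M"
    by (simp add: ext_map_vec_wedge clinear_mat_map row)
  moreover have "X = 0 \<longleftrightarrow> ext_map (mat_map A) X = 0" for X
    using ext_map_mat_inverse[OF assms(2), of X] by (metis ext_map_zero)
  ultimately show ?thesis by (metis axis_wedge_eq_0_iff)
qed

section \<open>Weight fields as holomorphic polyvector fields\<close>

lemma entire_monomials:
  "entire (\<lambda>z. \<chi> K. N $ K * (\<Prod>j\<in>UNIV. (z $ j) ^ e K j) :: 'n::finite ext)"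
  unfolding entire_def
proof
  fix z :: "'n cvec"
  let ?D = "\<lambda>v. \<chi> K. N $ K * (\<Sum>j\<in>UNIV. (of_nat (e K j) * v $ j * (z $ j) ^ (e K j - 1)) *
      (\<Prod>l\<in>UNIV - {j}. (z $ l) ^ e K l))"
  have "((\<lambda>z. N $ K * (\<Prod>j\<in>UNIV. (z $ j) ^ e K j)) has_derivative (\<lambda>v. ?D v $ K)) (at z)" for K
    unfolding vec_lambda_beta
    by (intro has_derivative_mult_right has_derivative_prod has_derivative_power
        bounded_linear_imp_has_derivative bounded_linear_vec_nth)
  then have "((\<lambda>z. \<chi> K. N $ K * (\<Prod>j\<in>UNIV. (z $ j) ^ e K j)) has_derivative (\<lambda>v. \<chi> K. ?D v $ K)) (at z)"
    by (rule has_derivative_vec_lambda)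
  then have "((\<lambda>z. \<chi> K. N $ K * (\<Prod>j\<in>UNIV. (z $ j) ^ e K j)) has_derivative ?D) (at z)"
    by (simp only: vec_nth_inverse)
  moreover have "?D (c *s v) = c *s ?D v" for c v
    by (simp add: vec_eq_iff sum_distrib_left mult_ac)
  ultimately show "\<exists>h'. ((\<lambda>z. \<chi> K. N $ K * (\<Prod>j\<in>UNIV. (z $ j) ^ e K j)) has_derivative h') (at z) \<and>
      (\<forall>c v. h' (c *s v) = c *s h' v)" by blast
qed

lemma active_ipair: "b \<in> active \<Delta> I \<longleftrightarrow> b \<in> gens \<Delta> \<and> ipair I b = - 1"
proof -
  have "real_of_int (ipair I b) = - 1 \<longleftrightarrow> ipair I b = - 1"
    by (metis of_int_eq_iff of_int_minus of_int_1)
  then show ?thesis by (simp add: active_def inner_ipair)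
qed

lemma S_all_ipair: "I \<in> S_all \<Delta> \<longleftrightarrow> (\<forall>b\<in>gens \<Delta>. - 1 \<le> ipair I b)"
proof -
  have "- 1 \<le> real_of_int (ipair I b) \<longleftrightarrow> - 1 \<le> ipair I b" for b
    by (metis of_int_le_iff of_int_minus of_int_1)
  then show ?thesis by (simp add: S_all_def polytope_of_gens inner_ipair)
qed

text \<open>An exponent in a chart is negative only where the pairing with the row is -1 and the
  index is missing from \<open>K\<close>; exactly these coefficients are killed by the annihilation
  condition.\<close>

lemma weight_field_holo:
  fixes \<Delta> :: "'n::{finite,linorder} rvec set set"
  assumes complete: "smooth_complete_fan \<Delta>" and I: "I \<in> S_all \<Delta>"
    and M: "M \<in> annihilated \<Delta> I" and hom: "homog k M"
  shows "weight_field I M \<in> holo_fields \<Delta> k"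
  unfolding holo_fields_def
proof (intro CollectI conjI allI impI ballI)
  fix B assume B: "B \<in> chart_bases \<Delta>"
  obtain A where A: "B ** A = mat 1" "A ** B = mat 1" using chart_basis_inverse[OF B] .
  define N where "N = ext_map (mat_map A) M"
  define e where "e K j = ipair I (B $ j) + (if j \<in> K then 1 else 0)" for K j
  have nonneg: "0 \<le> e K j" if "N $ K \<noteq> 0" for K j
  proof (cases "ipair I (B $ j) = - 1")
    case True
    have "B $ j \<in> gens \<Delta>" using chart_basis_row_in_gens[OF complete B] .
    then have "B $ j \<in> active \<Delta> I" using True by (simp add: active_ipair)
    then have "ext_vector (cplx_of_lattice (B $ j)) \<and>\<^sub>e M = 0"
      using M by (simp add: annihilated_def)
    then have "j \<in> K" using that row_wedge_eq_0_iff[OF A, of j M] by (auto simp: N_def)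
    then show ?thesis using True by (simp add: e_def)
  next
    case False
    have "- 1 \<le> ipair I (B $ j)"
      using I chart_basis_row_in_gens[OF complete B, of j] unfolding S_all_ipair by blast
    then show ?thesis using False by (auto simp: e_def)
  qed
  \<comment> \<open>Truncation by \<open>nat\<close> is harmless: an exponent can be negative only
    where the coefficient of \<open>N\<close> is 0.\<close>
  define h where "h z = (\<chi> K. N $ K * (\<Prod>j\<in>UNIV. (z $ j) ^ nat (e K j)))" for z :: "'n cvec"
  have "h z = chart_field B A (weight_field I M) z" if z: "z \<in> torus" for z
  proof (rule ext_eqI)
    fix K
    show "h z $ K = chart_field B A (weight_field I M) z $ K"
    proof (cases "N $ K = 0")
      case True
      then show ?thesis by (simp add: h_def chart_field_weight_field_nth[OF z] N_def)
    next
      case False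
      have "(z $ j) ^ nat (e K j) = (z $ j) powi ipair I (B $ j) * (if j \<in> K then z $ j else 1)" for j
      proof -
        have "(z $ j) ^ nat (e K j) = (z $ j) powi e K j"
          using nonneg[OF False, of j] by (simp add: power_int_def)
        then show ?thesis using torus_nonzero[OF z, of j] by (simp add: e_def power_int_add)
      qed
      then have "(\<Prod>j\<in>UNIV. (z $ j) ^ nat (e K j)) =
          character (\<chi> j. ipair I (B $ j)) z * (\<Prod>j\<in>UNIV. if j \<in> K then z $ j else 1)"
        by (simp add: character_def prod.distrib)
      also have "(\<Prod>j\<in>UNIV. if j \<in> K then z $ j else 1) = (\<Prod>j\<in>K. z $ j)"
        by (rule prod.mono_neutral_cong_right) auto
      finally show ?thesis
        by (simp add: h_def chart_field_weight_field_nth[OF z] N_def)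
    qed
  qed
  moreover have "entire h" unfolding h_def by (rule entire_monomials)
  moreover have "h z \<in> ext_power UNIV k" for z
    using homog_ext_map[OF hom, of "mat_map A"] by (simp add: ext_power_UNIV homog_def h_def N_def)
  ultimately show "\<exists>h. entire h \<and> (\<forall>z. h z \<in> ext_power UNIV k) \<and>
      (\<forall>z\<in>torus. weight_field I M (chart_param B z) =
        ext_map (frechet_derivative (chart_param B) (at z)) (h z))"
    using chart_field_iff[OF _ A] by (intro exI[of _ h]) simp
qed simp

lemma entire_add: "entire f \<Longrightarrow> entire g \<Longrightarrow> entire (\<lambda>z. f z + g z)"
  unfolding entire_def
proof
  fix z assume "\<forall>z. \<exists>h'. (f has_derivative h') (at z) \<and> (\<forall>c v. h' (c *s v) = c *s h' v)"
    and "\<forall>z. \<exists>h'. (g has_derivative h') (at z) \<and> (\<forall>c v. h' (c *s v) = c *s h' v)"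
  then obtain f' g' where "(f has_derivative f') (at z)" "\<And>c v. f' (c *s v) = c *s f' v"
    "(g has_derivative g') (at z)" "\<And>c v. g' (c *s v) = c *s g' v" by meson
  then show "\<exists>h'. ((\<lambda>z. f z + g z) has_derivative h') (at z) \<and> (\<forall>c v. h' (c *s v) = c *s h' v)"
    by (intro exI[of _ "\<lambda>v. f' v + g' v"]) (auto intro: has_derivative_add simp: vec.scale_right_distrib)
qed

lemma entire_zero: "entire (\<lambda>z. 0)"
  unfolding entire_def by (intro allI exI[of _ "\<lambda>_. 0"]) auto

lemma holo_fields_add:
  assumes "f \<in> holo_fields \<Delta> k" "g \<in> holo_fields \<Delta> k"
  shows "(\<lambda>t. f t + g t) \<in> holo_fields \<Delta> k"
  unfolding holo_fields_def
proof (intro CollectI conjI allI impI ballI)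
  fix B assume B: "B \<in> chart_bases \<Delta>"
  let ?D = "\<lambda>z. frechet_derivative (chart_param B) (at z)"
  obtain h where "entire h" "\<forall>z. h z \<in> ext_power UNIV k"
    "\<forall>z\<in>torus. f (chart_param B z) = ext_map (?D z) (h z)"
    using assms(1) B unfolding holo_fields_def by blast
  moreover obtain h' where "entire h'" "\<forall>z. h' z \<in> ext_power UNIV k"
    "\<forall>z\<in>torus. g (chart_param B z) = ext_map (?D z) (h' z)"
    using assms(2) B unfolding holo_fields_def by blast
  ultimately show "\<exists>h. entire h \<and> (\<forall>z. h z \<in> ext_power UNIV k) \<and>
      (\<forall>z\<in>torus. f (chart_param B z) + g (chart_param B z) =
        ext_map (frechet_derivative (chart_param B) (at z)) (h z))"
    by (intro exI[of _ "\<lambda>z. h z + h' z"])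
      (auto simp: entire_add ext_map_add ext_power_UNIV homog_add)
qed (use assms in \<open>auto simp: holo_fields_def\<close>)

lemma holo_fields_zero: "(\<lambda>t. 0) \<in> holo_fields \<Delta> k"
  unfolding holo_fields_def
  by (intro CollectI conjI allI impI ballI exI[of _ "\<lambda>z. 0"])
    (auto simp: entire_zero ext_power_UNIV)

lemma holo_fields_sum:
  "finite S \<Longrightarrow> (\<And>I. I \<in> S \<Longrightarrow> f I \<in> holo_fields \<Delta> k) \<Longrightarrow> (\<lambda>t. \<Sum>I\<in>S. f I t) \<in> holo_fields \<Delta> k"
  by (induction S rule: finite_induct) (auto intro: holo_fields_add holo_fields_zero)

section \<open>Fields bounded on polydiscs of the charts\<close>

text \<open>What the exponent estimate needs of a holomorphic extension, in a form visibly stable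
  under sums, scalars and translations by the torus. Every radius \<open>r\<close> is allowed
  because a translation rescales the polydisc.\<close>

definition bounded_field :: "'n::{finite,linorder} rvec set set \<Rightarrow> nat \<Rightarrow> 'n field \<Rightarrow> bool" where
  "bounded_field \<Delta> k f \<longleftrightarrow> (\<forall>t. t \<notin> torus \<longrightarrow> f t = 0) \<and> (\<forall>t. homog k (f t)) \<and>
    (\<forall>B\<in>chart_bases \<Delta>. \<forall>A. B ** A = mat 1 \<longrightarrow> A ** B = mat 1 \<longrightarrow>
      (\<forall>r. \<exists>C. \<forall>z\<in>torus. (\<forall>j. norm (z $ j) \<le> r) \<longrightarrow> (\<forall>K. norm (chart_field B A f z $ K) \<le> C)))"

lemma bounded_fieldD:
  assumes "bounded_field \<Delta> k f" "B \<in> chart_bases \<Delta>" "B ** A = mat 1" "A ** B = mat 1"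
  obtains C where "0 \<le> C"
    "\<And>z K. z \<in> torus \<Longrightarrow> (\<And>j. norm (z $ j) \<le> r) \<Longrightarrow> norm (chart_field B A f z $ K) \<le> C"
proof -
  obtain C where "\<And>z K. z \<in> torus \<Longrightarrow> (\<And>j. norm (z $ j) \<le> r) \<Longrightarrow> norm (chart_field B A f z $ K) \<le> C"
    using assms unfolding bounded_field_def by meson
  then show thesis by (intro that[of "max 0 C"]) (auto intro: max.coboundedI2)
qed

lemma chart_field_add: "chart_field B A (\<lambda>t. f t + g t) z = chart_field B A f z + chart_field B A g z"
  by (simp add: chart_field_def ext_map_add)

lemma chart_field_scale: "chart_field B A (\<lambda>t. c *s f t) z = c *s chart_field B A f z"
  by (simp add: chart_field_def ext_map_scale)

lemma bounded_field_add:
  assumes "bounded_field \<Delta> k f" "bounded_field \<Delta> k g"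
  shows "bounded_field \<Delta> k (\<lambda>t. f t + g t)"
  unfolding bounded_field_def
proof (intro conjI allI ballI impI)
  fix B A r assume BA: "B \<in> chart_bases \<Delta>" "B ** A = mat 1" "A ** B = mat 1"
  obtain C where C: "\<And>z K. z \<in> torus \<Longrightarrow> (\<And>j. norm (z $ j) \<le> r) \<Longrightarrow> norm (chart_field B A f z $ K) \<le> C"
    using bounded_fieldD[OF assms(1) BA] by metis
  obtain D where D: "\<And>z K. z \<in> torus \<Longrightarrow> (\<And>j. norm (z $ j) \<le> r) \<Longrightarrow> norm (chart_field B A g z $ K) \<le> D"
    using bounded_fieldD[OF assms(2) BA] by metis
  show "\<exists>C. \<forall>z\<in>torus. (\<forall>j. norm (z $ j) \<le> r) \<longrightarrow>
      (\<forall>K. norm (chart_field B A (\<lambda>t. f t + g t) z $ K) \<le> C)"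
    by (intro exI[of _ "C + D"] ballI impI allI)
      (simp add: chart_field_add, rule norm_triangle_mono, auto intro: C D)
qed (use assms in \<open>auto simp: bounded_field_def intro: homog_add\<close>)

lemma bounded_field_scale:
  assumes "bounded_field \<Delta> k f"
  shows "bounded_field \<Delta> k (\<lambda>t. c *s f t)"
  unfolding bounded_field_def
proof (intro conjI allI ballI impI)
  fix B A r assume BA: "B \<in> chart_bases \<Delta>" "B ** A = mat 1" "A ** B = mat 1"
  obtain C where C: "\<And>z K. z \<in> torus \<Longrightarrow> (\<And>j. norm (z $ j) \<le> r) \<Longrightarrow> norm (chart_field B A f z $ K) \<le> C"
    using bounded_fieldD[OF assms(1) BA] by metis
  show "\<exists>C. \<forall>z\<in>torus. (\<forall>j. norm (z $ j) \<le> r) \<longrightarrow>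
      (\<forall>K. norm (chart_field B A (\<lambda>t. c *s f t) z $ K) \<le> C)"
    by (intro exI[of _ "norm c * C"] ballI impI allI)
      (auto simp: chart_field_scale norm_mult intro!: mult_left_mono C)
qed (use assms in \<open>auto simp: bounded_field_def intro: homog_scale\<close>)

lemma holo_bounded_field:
  fixes \<Delta> :: "'n::{finite,linorder} rvec set set"
  assumes complete: "smooth_complete_fan \<Delta>" and f: "f \<in> holo_fields \<Delta> k"
  shows "bounded_field \<Delta> k f"
  unfolding bounded_field_def
proof (intro conjI allI ballI impI)
  show f0: "f t = 0" if "t \<notin> torus" for t using f that by (simp add: holo_fields_def)
  show "homog k (f t)" for t
  proof (cases "t \<in> torus")
    case t: True
    \<comment> \<open>The vector 0 is arbitrary here; only the existence of some chart
      matters.\<close>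
    obtain B where B: "B \<in> chart_bases \<Delta>"
      using nonneg_combination[OF complete, of 0] by blast
    obtain A where A: "B ** A = mat 1" "A ** B = mat 1" using chart_basis_inverse[OF B] .
    obtain h where h: "\<And>z. h z \<in> ext_power UNIV k" "\<And>z. z \<in> torus \<Longrightarrow> f (chart_param B z) =
        ext_map (frechet_derivative (chart_param B) (at z)) (h z)"
      using f B unfolding holo_fields_def by blast
    have "f t = ext_map (frechet_derivative (chart_param B) (at (chart_param A t))) (h (chart_param A t))"
      using h(2)[OF chart_param_torus[OF t, of A]] chart_param_inverse[OF A(2) t] by simp
    moreover have "homog k (h (chart_param A t))" using h(1) by (simp add: ext_power_UNIV)
    ultimately show ?thesis by (simp add: homog_ext_map)
  qed (simp add: f0)
  fix B A and r :: real
  assume BA: "B \<in> chart_bases \<Delta>" "B ** A = mat 1" "A ** B = mat 1"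
  obtain h where h: "entire h" "\<And>z. z \<in> torus \<Longrightarrow> f (chart_param B z) =
      ext_map (frechet_derivative (chart_param B) (at z)) (h z)"
    using f BA(1) unfolding holo_fields_def by blast
  have "continuous_on (cball 0 (real CARD('n) * r)) h"
    using h(1) unfolding entire_def
    by (intro continuous_at_imp_continuous_on ballI) (meson has_derivative_continuous)
  then have "bounded (h ` cball 0 (real CARD('n) * r))"
    by (intro compact_imp_bounded compact_continuous_image compact_cball)
  then obtain C where C: "\<forall>x\<in>h ` cball 0 (real CARD('n) * r). norm x \<le> C"
    unfolding bounded_iff by blast
  have "norm (chart_field B A f z $ K) \<le> C" if z: "z \<in> torus" "\<forall>j. norm (z $ j) \<le> r" for z K
  proof -
    have "norm z \<le> (\<Sum>j\<in>UNIV. norm (z $ j))"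
      unfolding norm_vec_def by (rule L2_set_le_sum) simp
    also have "\<dots> \<le> real CARD('n) * r"
      using sum_bounded_above[of UNIV "\<lambda>j. norm (z $ j)" r] z(2) by simp
    finally have "norm (h z) \<le> C" using C by simp
    moreover have "chart_field B A f z = h z"
      using chart_field_iff[OF z(1) BA(2,3), of f "h z"] h(2)[OF z(1)] by simp
    ultimately show ?thesis
      using Finite_Cartesian_Product.norm_nth_le[of "h z" K] by simp
  qed
  then show "\<exists>C. \<forall>z\<in>torus. (\<forall>j. norm (z $ j) \<le> r) \<longrightarrow> (\<forall>K. norm (chart_field B A f z $ K) \<le> C)"
    by blast
qed

text \<open>Pull-back of the field along multiplication by \<open>s\<close>; weight fields are
  eigenvectors, with the character of \<open>s\<close> as eigenvalue.\<close>

definition translate :: "'n::{finite,linorder} cvec \<Rightarrow> 'n field \<Rightarrow> 'n field" where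
  "translate s f t = ext_map (diag_map (vinv s)) (f (diag_map s t))"

lemma diag_map_torus_iff: "s \<in> torus \<Longrightarrow> diag_map s t \<in> torus \<longleftrightarrow> t \<in> torus"
  by (simp add: torus_def diag_map_def)

lemma ext_map_diag_diag:
  "ext_map (diag_map a) (ext_map (diag_map b) X) = ext_map (diag_map (diag_map a b)) X"
proof -
  have "(\<lambda>x. diag_map a (diag_map b x)) = diag_map (diag_map a b)"
    by (simp add: fun_eq_iff diag_map_def vec_eq_iff)
  then show ?thesis by (simp add: ext_map_comp clinear_diag_map)
qed

lemma translate_weight_field:
  assumes s: "s \<in> torus"
  shows "translate s (weight_field I M) t = character I s *s weight_field I M t"
proof (cases "t \<in> torus")
  case t: True
  have st: "diag_map s t \<in> torus" using s t by (simp add: diag_map_torus_iff)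
  have "diag_map (vinv s) (diag_map s t) = t" using s by (rule diag_map_vinv)
  then show ?thesis
    by (simp add: translate_def weight_field_def rho_diag st t ext_map_scale ext_map_diag_diag
        character_diag_map vector_smult_assoc)
qed (simp add: translate_def diag_map_torus_iff s)

lemma chart_field_translate:
  assumes "A ** B = mat 1" "s \<in> torus"
  shows "chart_field B A (translate s f) z =
    ext_map (diag_map (vinv (chart_param A s))) (chart_field B A f (diag_map (chart_param A s) z))"
proof -
  have s: "chart_param B (chart_param A s) = s" using assms by (rule chart_param_inverse)
  have "diag_map (vinv (chart_param A s)) (diag_map (chart_param A s) z) = z"
    by (rule diag_map_vinv) (rule chart_param_torus[OF assms(2)])
  moreover have "diag_map (vinv (chart_param B z)) (vinv s) = vinv (diag_map s (chart_param B z))"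
    by (simp add: diag_map_def vinv_def vec_eq_iff mult.commute)
  ultimately show ?thesis
    by (simp add: chart_field_def translate_def ext_map_diag_diag chart_param_diag_map s)
qed

lemma bounded_field_translate:
  assumes f: "bounded_field \<Delta> k f" and s: "s \<in> torus"
  shows "bounded_field \<Delta> k (translate s f)"
  unfolding bounded_field_def
proof (intro conjI allI ballI impI)
  show "translate s f t = 0" if "t \<notin> torus" for t
    using f that s by (simp add: translate_def bounded_field_def diag_map_torus_iff)
  show "homog k (translate s f t)" for t
    using f by (simp add: translate_def bounded_field_def homog_ext_map)
  fix B A and r :: real
  assume BA: "B \<in> chart_bases \<Delta>" "B ** A = mat 1" "A ** B = mat 1"
  define s' where "s' = chart_param A s"
  have s': "s' \<in> torus" unfolding s'_def using s by (rule chart_param_torus)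
  obtain C where C: "0 \<le> C" "\<And>z K. z \<in> torus \<Longrightarrow> (\<And>j. norm (z $ j) \<le> (\<Sum>j\<in>UNIV. norm (s' $ j)) * r)
      \<Longrightarrow> norm (chart_field B A f z $ K) \<le> C"
    using bounded_fieldD[OF f BA] by metis
  have "norm (chart_field B A (translate s f) z $ K) \<le> (\<Sum>K\<in>UNIV. norm (\<Prod>i\<in>K. vinv s' $ i)) * C"
    if z: "z \<in> torus" "\<forall>j. norm (z $ j) \<le> r" for z K
  proof -
    have "norm (diag_map s' z $ j) \<le> (\<Sum>j\<in>UNIV. norm (s' $ j)) * r" for j
      unfolding diag_map_def vec_lambda_beta norm_mult
      by (intro mult_mono sum_nonneg member_le_sum) (use z in auto)
    then have "norm (chart_field B A f (diag_map s' z) $ K) \<le> C"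
      using z s' by (intro C(2)) (simp_all add: diag_map_torus_iff)
    then show ?thesis
      unfolding chart_field_translate[OF BA(3) s] s'_def[symmetric] ext_map_diag norm_mult
      by (intro mult_mono member_le_sum sum_nonneg) (use C(1) in auto)
  qed
  then show "\<exists>C. \<forall>z\<in>torus. (\<forall>j. norm (z $ j) \<le> r) \<longrightarrow>
      (\<forall>K. norm (chart_field B A (translate s f) z $ K) \<le> C)" by blast
qed

text \<open>
  Dedekind's argument: a translation that separates two characters lets us eliminate one of them
  without leaving a space of fields stable under translations.
\<close>

lemma bounded_weight_component:
  assumes "finite S" "bounded_field \<Delta> k (\<lambda>t. \<Sum>I\<in>S. weight_field I (M I) t)" "I \<in> S"
  shows "bounded_field \<Delta> k (weight_field I (M I))"
  using assms
proof (induction "card S" arbitrary: S M rule: less_induct)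
  case less
  show ?case
  proof (cases "S = {I}")
    case True
    then show ?thesis using less.prems(2) by simp
  next
    case False
    then obtain J where J: "J \<in> S" "J \<noteq> I" using less.prems(3) by auto
    then obtain j where j: "J $ j \<noteq> I $ j" by (auto simp: vec_eq_iff)
    \<comment> \<open>With 2 in the j-th place and 1 elsewhere, the character of L has the value 2
      to the power L_j, and different powers of 2 are different.\<close>
    define s :: "'a cvec" where "s = upd 1 j 2"
    have s: "s \<in> torus" by (simp add: s_def torus_def upd_nth)
    have char: "character L s = 2 powi (L $ j)" for L
    proof -
      have "character L s = (\<Prod>i\<in>UNIV. if i = j then 2 powi (L $ j) else 1)"
        unfolding character_def by (rule prod.cong) (auto simp: s_def upd_nth)
      then show ?thesis by simp
    qed
    define c where "c L = character L s - character J s" for L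
    have "c I \<noteq> 0"
    proof
      assume "c I = 0"
      then have "(2::complex) powi (I $ j) = 2 powi (J $ j)" by (simp add: c_def char)
      then have "norm ((2::complex) powi (I $ j)) = norm ((2::complex) powi (J $ j))" by simp
      then have "(2::real) powi (I $ j) = 2 powi (J $ j)" by (simp add: norm_power_int)
      then show False
        using j power_int_strict_increasing[of "I $ j" "J $ j" "2::real"]
          power_int_strict_increasing[of "J $ j" "I $ j" "2::real"]
        by (cases "I $ j" "J $ j" rule: linorder_cases) auto
    qed
    let ?f = "\<lambda>t. \<Sum>I\<in>S. weight_field I (M I) t"
    have "bounded_field \<Delta> k (\<lambda>t. translate s ?f t + (- character J s) *s ?f t)"
      by (intro bounded_field_add bounded_field_scale bounded_field_translate less.prems s)
    moreover have "translate s ?f t + (- character J s) *s ?f t =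
        (\<Sum>L\<in>S - {J}. weight_field L (c L *s M L) t)" for t
    proof -
      have w: "character L s *s weight_field L (M L) t + (- character J s) *s weight_field L (M L) t =
          weight_field L (c L *s M L) t" for L
        unfolding weight_field_scale by (simp add: c_def vec.scale_left_diff_distrib)
      have "translate s ?f t = (\<Sum>L\<in>S. character L s *s weight_field L (M L) t)"
        using translate_weight_field[OF s] by (simp add: translate_def ext_map_sum)
      then have "translate s ?f t + (- character J s) *s ?f t =
          (\<Sum>L\<in>S. weight_field L (c L *s M L) t)"
        by (simp only: vec.scale_sum_right w flip: sum.distrib)
      also have "\<dots> = (\<Sum>L\<in>S - {J}. weight_field L (c L *s M L) t)"
        using less.prems(1) by (intro sum.mono_neutral_right) (auto simp: c_def)
      finally show ?thesis .
    qed
    ultimately have "bounded_field \<Delta> k (\<lambda>t. \<Sum>L\<in>S - {J}. weight_field L (c L *s M L) t)"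
      by simp
    moreover have "card (S - {J}) < card S" using less.prems(1) J(1) by (rule card_Diff1_less)
    ultimately have "bounded_field \<Delta> k (weight_field I (c I *s M I))"
      using less.hyps[of "S - {J}" "\<lambda>L. c L *s M L"] less.prems J by auto
    then have "bounded_field \<Delta> k (\<lambda>t. (1 / c I) *s weight_field I (c I *s M I) t)"
      by (rule bounded_field_scale)
    moreover have "(\<lambda>t. (1 / c I) *s weight_field I (c I *s M I) t) = weight_field I (M I)"
      using \<open>c I \<noteq> 0\<close> by (simp add: fun_eq_iff weight_field_scale vector_smult_assoc)
    ultimately show ?thesis by simp
  qed
qed

text \<open>Approach the divisor z_j = 0 with all other coordinates equal to 1: the coefficient is
  then a fixed nonzero number times a power of z_j, unbounded if the exponent is negative.\<close>

lemma bounded_weight_field_exponent: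
  assumes f: "bounded_field \<Delta> k (weight_field I M)"
    and BA: "B \<in> chart_bases \<Delta>" "B ** A = mat 1" "A ** B = mat 1"
    and N: "ext_map (mat_map A) M $ K \<noteq> 0"
  shows "0 \<le> ipair I (B $ j) + (if j \<in> K then 1 else 0)"
proof (rule ccontr)
  define e where "e = ipair I (B $ j) + (if j \<in> K then 1 else 0)"
  define n where "n = norm (ext_map (mat_map A) M $ K)"
  assume "\<not> ?thesis"
  then have e: "e < 0" by (simp add: e_def)
  obtain C where C: "0 \<le> C" "\<And>z K. z \<in> torus \<Longrightarrow> (\<And>j. norm (z $ j) \<le> 1) \<Longrightarrow>
      norm (chart_field B A (weight_field I M) z $ K) \<le> C"
    using bounded_fieldD[OF f BA] by metis
  have n: "0 < n" using N by (simp add: n_def)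
  \<comment> \<open>Chosen so that n / s = n + C + 1, which exceeds the bound C, while s stays in
    the unit disc.\<close>
  define s where "s = n / (n + C + 1)"
  have s: "0 < s" "s \<le> 1" using n C(1) by (simp_all add: s_def)
  define z :: "'a cvec" where "z = upd 1 j (of_real s)"
  have z: "z \<in> torus" using s by (simp add: z_def torus_def upd_nth)
  have "character (\<chi> j. ipair I (B $ j)) z = of_real s powi ipair I (B $ j)"
  proof -
    have "character (\<chi> j. ipair I (B $ j)) z =
        (\<Prod>i\<in>UNIV. if i = j then of_real s powi ipair I (B $ j) else 1)"
      unfolding character_def by (rule prod.cong) (auto simp: z_def upd_nth)
    then show ?thesis by simp
  qed
  moreover have "(\<Prod>k\<in>K. z $ k) = (if j \<in> K then of_real s else 1)"
  proof -
    have "(\<Prod>k\<in>K. z $ k) = (\<Prod>k\<in>K. if k = j then of_real s else 1)"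
      by (rule prod.cong) (auto simp: z_def upd_nth)
    then show ?thesis by simp
  qed
  ultimately have "chart_field B A (weight_field I M) z $ K =
      of_real s powi e * ext_map (mat_map A) M $ K"
    using s by (simp add: chart_field_weight_field_nth[OF z] e_def power_int_add)
  moreover have "norm (chart_field B A (weight_field I M) z $ K) \<le> C"
    using s by (intro C(2) z) (simp add: z_def upd_nth)
  ultimately have le: "s powi e * n \<le> C"
    using s by (simp add: norm_mult norm_power_int n_def)
  have "inverse s \<le> inverse s ^ nat (- e)"
    using s e by (intro self_le_power) (auto simp: one_le_inverse)
  also have "\<dots> = s powi e" using e by (simp add: power_int_def)
  finally have "inverse s * n \<le> C" using le n by (meson mult_right_mono less_imp_le order_trans)
  moreover have "inverse s * n = n + C + 1" using n C(1) by (simp add: s_def field_simps)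
  ultimately show False using n by linarith
qed

text \<open>A nonzero \<open>M\<close> has a nonzero coefficient in each chart, and its exponents
  are nonnegative, so no pairing is below -1. Where the pairing equals -1, nonzero coefficients must
  contain the index, which is annihilation by that generator.\<close>

lemma bounded_weight_field:
  fixes \<Delta> :: "'n::{finite,linorder} rvec set set"
  assumes complete: "smooth_complete_fan \<Delta>" and f: "bounded_field \<Delta> k (weight_field I M)"
    and "M \<noteq> 0"
  shows "I \<in> S_all \<Delta>" "M \<in> annihilated \<Delta> I" "homog k M"
proof -
  note exponent = bounded_weight_field_exponent[OF f]
  show "I \<in> S_all \<Delta>"
    unfolding S_all_ipair
  proof
    fix b assume "b \<in> gens \<Delta>"
    then obtain B j where B: "B \<in> chart_bases \<Delta>" "b = B $ j"
      using gens_chart_basis_row[OF complete] by blast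
    obtain A where A: "B ** A = mat 1" "A ** B = mat 1" using chart_basis_inverse[OF B(1)] .
    have "ext_map (mat_map A) M \<noteq> 0"
      using ext_map_mat_inverse[OF A(2), of M] \<open>M \<noteq> 0\<close> by auto
    then obtain K where "ext_map (mat_map A) M $ K \<noteq> 0" by (auto simp: vec_eq_iff)
    from exponent[OF B(1) A this, of j] show "- 1 \<le> ipair I b"
      by (simp add: B(2) split: if_splits)
  qed
  show "M \<in> annihilated \<Delta> I"
    unfolding annihilated_def
  proof (intro CollectI ballI)
    fix b assume b: "b \<in> active \<Delta> I"
    then obtain B j where B: "B \<in> chart_bases \<Delta>" "b = B $ j"
      using gens_chart_basis_row[OF complete] by (auto simp: active_def)
    obtain A where A: "B ** A = mat 1" "A ** B = mat 1" using chart_basis_inverse[OF B(1)] .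
    have "ext_map (mat_map A) M $ K = 0" if "j \<notin> K" for K
      using exponent[OF B(1) A, of K j] that b by (auto simp: active_ipair B(2))
    then show "ext_vector (cplx_of_lattice b) \<and>\<^sub>e M = 0"
      unfolding B(2) row_wedge_eq_0_iff[OF A] by blast
  qed
  have "(1 :: 'n cvec) \<in> torus" by (simp add: torus_def)
  then have "weight_field I M 1 $ K = M $ K" for K
    by (simp add: weight_field_nth character_def)
  moreover have "homog k (weight_field I M 1)" using f by (simp add: bounded_field_def)
  ultimately show "homog k M" by (simp add: homog_def)
qed

section \<open>Weight decomposition of holomorphic polyvector fields\<close>

text \<open>Symmetric under inversion of each coordinate and at least 1 on the torus, so that its
  powers dominate characters with exponents of either sign.\<close>

definition growth :: "'n::finite cvec \<Rightarrow> real" where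
  "growth t = (\<Prod>i\<in>UNIV. norm (t $ i) + inverse (norm (t $ i)))"

lemma add_inverse_ge_1: "0 < x \<Longrightarrow> 1 \<le> x + inverse x" for x :: real
proof (cases "1 \<le> x")
  case True
  then have "0 < inverse x" by simp
  with True show ?thesis by linarith
next
  case False
  assume "0 < x"
  with False have "1 \<le> inverse x" by (simp add: one_le_inverse)
  with \<open>0 < x\<close> show ?thesis by linarith
qed

lemma growth_factor_ge_1: "t \<in> torus \<Longrightarrow> 1 \<le> norm (t $ i) + inverse (norm (t $ i))"
  by (rule add_inverse_ge_1) (simp add: torus_nonzero)

lemma growth_ge_1: "t \<in> torus \<Longrightarrow> 1 \<le> growth t"
  unfolding growth_def by (rule prod_ge_1) (simp add: growth_factor_ge_1)

lemma power_int_le_growth: "0 < x \<Longrightarrow> x powi a \<le> (x + inverse x) ^ nat \<bar>a\<bar>" for x :: real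
  by (cases "0 \<le> a") (auto simp: power_int_def intro!: power_mono)

lemma norm_character_le:
  assumes t: "t \<in> torus"
  shows "norm (character I t) \<le> growth t ^ (\<Sum>i\<in>UNIV. nat \<bar>I $ i\<bar>)"
proof -
  let ?q = "\<lambda>i. norm (t $ i) + inverse (norm (t $ i))"
  have "norm (character I t) = (\<Prod>i\<in>UNIV. norm (t $ i) powi (I $ i))"
    by (simp add: character_def norm_power_int flip: prod_norm)
  also have "\<dots> \<le> (\<Prod>i\<in>UNIV. ?q i ^ (\<Sum>i\<in>UNIV. nat \<bar>I $ i\<bar>))"
  proof (rule prod_mono, intro conjI)
    fix i
    have "norm (t $ i) powi (I $ i) \<le> ?q i ^ nat \<bar>I $ i\<bar>"
      by (rule power_int_le_growth) (simp add: torus_nonzero t)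
    also have "\<dots> \<le> ?q i ^ (\<Sum>i\<in>UNIV. nat \<bar>I $ i\<bar>)"
      using growth_factor_ge_1[OF t, of i] by (intro power_increasing member_le_sum) auto
    finally show "norm (t $ i) powi (I $ i) \<le> ?q i ^ (\<Sum>i\<in>UNIV. nat \<bar>I $ i\<bar>)" .
  qed simp
  finally show ?thesis by (simp add: growth_def prod_power_distrib)
qed

lemma ext_map_nth:
  "ext_map L X $ K =
    (\<Sum>M\<in>UNIV. X $ M * wedge_list (map (\<lambda>i. L (axis i 1)) (sorted_list_of_set M)) $ K)"
  by (simp add: ext_map_def)

text \<open>The vector -log|t| lies in a full-dimensional cone. Its coordinates there are
  nonnegative, and they are minus the logarithms of the moduli of the chart coordinates.\<close>

lemma chart_polydisc:
  fixes \<Delta> :: "'n::{finite,linorder} rvec set set"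
  assumes complete: "smooth_complete_fan \<Delta>" and t: "t \<in> torus"
  obtains B where "B \<in> chart_bases \<Delta>"
    "\<And>A j. B ** A = mat 1 \<Longrightarrow> norm (chart_param A t $ j) \<le> 1"
proof -
  define v :: "'n rvec" where "v = (\<chi> i. - ln (norm (t $ i)))"
  obtain B c where B: "B \<in> chart_bases \<Delta>" "\<And>j. 0 \<le> c j"
    "v = (\<Sum>j\<in>UNIV. c j *\<^sub>R real_of_lattice (B $ j))"
    using nonneg_combination[OF complete, of v] by blast
  have "norm (chart_param A t $ j) \<le> 1" if A: "B ** A = mat 1" for A j
  proof -
    have "norm (chart_param A t $ j) = (\<Prod>i\<in>UNIV. norm (t $ i) powi (A $ i $ j))"
      by (simp add: chart_param_def norm_power_int flip: prod_norm)
    also have "\<dots> = (\<Prod>i\<in>UNIV. exp (- (of_int (A $ i $ j) * v $ i)))"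
    proof (rule prod.cong[OF refl])
      fix i
      have "norm (t $ i) = exp (- v $ i)"
        using torus_nonzero[OF t, of i] by (simp add: v_def)
      then show "norm (t $ i) powi (A $ i $ j) = exp (- (of_int (A $ i $ j) * v $ i))"
        by (simp only: exp_power_int) simp
    qed
    also have "\<dots> = exp (- (\<Sum>i\<in>UNIV. of_int (A $ i $ j) * v $ i))"
      by (simp add: exp_sum sum_negf[symmetric])
    also have "(\<Sum>i\<in>UNIV. of_int (A $ i $ j) * v $ i) =
        (\<Sum>i\<in>UNIV. \<Sum>l\<in>UNIV. c l * of_int (B $ l $ i * A $ i $ j))"
      by (simp add: B(3) sum_distrib_left mult_ac)
    also have "\<dots> = (\<Sum>l\<in>UNIV. c l * of_int (\<Sum>i\<in>UNIV. B $ l $ i * A $ i $ j))"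
      by (subst sum.swap) (simp add: sum_distrib_left)
    also have "\<dots> = (\<Sum>l\<in>UNIV. if l = j then c j else 0)"
      by (rule sum.cong) (auto simp: mat_mult_nth[OF A] simp del: of_int_sum of_int_mult)
    also have "\<dots> = c j" by simp
    finally show ?thesis using B(2)[of j] by simp
  qed
  with B(1) show thesis by (rule that)
qed

text \<open>Coefficients in the invariant frame t_i \<partial>/\<partial>t_i. For a weight field
  they are the constant \<open>A\<close> times the character, so proving them Laurent polynomials
  yields the weight decomposition.\<close>

definition torus_coeff :: "'n::{finite,linorder} field \<Rightarrow> 'n field" where
  "torus_coeff f t = ext_map (diag_map (vinv t)) (f t)"

lemma torus_coeff_chart:
  assumes "B ** A = mat 1" "A ** B = mat 1" "t \<in> torus"
  shows "torus_coeff f t = ext_map (mat_map B)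
    (ext_map (diag_map (vinv (chart_param A t))) (chart_field B A f (chart_param A t)))"
  using assms chart_param_torus[of t A]
  by (simp add: torus_coeff_def chart_field_def chart_param_inverse ext_map_diag_vinv ext_map_mat_inverse)

text \<open>Each point of the torus lies in the unit polydisc of one of finitely many charts, where
  the chart coefficients are bounded. Passing to the invariant frame costs inverses of chart
  coordinates; these are characters, hence bounded by powers of \<open>growth\<close>.\<close>

lemma torus_coeff_growth:
  fixes \<Delta> :: "'n::{finite,linorder} rvec set set"
  assumes complete: "smooth_complete_fan \<Delta>" and f: "bounded_field \<Delta> k f"
  obtains C R where "\<And>t K. t \<in> torus \<Longrightarrow> norm (torus_coeff f t $ K) \<le> C * growth t ^ R"
proof -
  have "\<exists>C R. 0 \<le> C \<and> (\<forall>t\<in>torus. (\<forall>A j. B ** A = mat 1 \<longrightarrow> norm (chart_param A t $ j) \<le> 1) \<longrightarrow>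
      (\<forall>K. norm (torus_coeff f t $ K) \<le> C * growth t ^ R))" if B: "B \<in> chart_bases \<Delta>" for B
  proof -
    obtain A where A: "B ** A = mat 1" "A ** B = mat 1" using chart_basis_inverse[OF B] .
    obtain C where C: "0 \<le> C" "\<And>z K. z \<in> torus \<Longrightarrow> (\<And>j. norm (z $ j) \<le> 1) \<Longrightarrow>
        norm (chart_field B A f z $ K) \<le> C"
      using bounded_fieldD[OF f B A] by metis
    define w where "w M = wedge_list (map (\<lambda>i. mat_map B (axis i 1)) (sorted_list_of_set M))" for M
    define D where "D = (\<Sum>K\<in>UNIV. \<Sum>M\<in>UNIV. norm (w M $ K))"
    define r where "r m = (\<Sum>i\<in>UNIV. nat \<bar>A $ i $ m\<bar>)" for m
    define R where "R = (\<Sum>m\<in>UNIV. r m)"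
    have "norm (torus_coeff f t $ K) \<le> (C * D) * growth t ^ R"
      if t: "t \<in> torus" and le: "\<And>j. norm (chart_param A t $ j) \<le> 1" for t K
    proof -
      define z where "z = chart_param A t"
      have z: "z \<in> torus" unfolding z_def using t by (rule chart_param_torus)
      have inv: "norm (vinv z $ m) \<le> growth t ^ r m" for m
      proof -
        have "vinv z $ m = character (\<chi> i. - A $ i $ m) t"
          by (simp add: vinv_def z_def chart_param_nth character_def power_int_minus prod_inversef[symmetric])
        then show ?thesis using norm_character_le[OF t, of "\<chi> i. - A $ i $ m"] by (simp add: r_def)
      qed
      have bound: "norm ((\<Prod>m\<in>M. vinv z $ m) * chart_field B A f z $ M * w M $ K) \<le>
          growth t ^ R * C * norm (w M $ K)" for M
      proof -
        have "norm (\<Prod>m\<in>M. vinv z $ m) \<le> (\<Prod>m\<in>M. growth t ^ r m)"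
          unfolding prod_norm[symmetric] by (intro prod_mono) (simp add: inv)
        also have "\<dots> = growth t ^ (\<Sum>m\<in>M. r m)" by (simp add: power_sum)
        also have "\<dots> \<le> growth t ^ R"
          unfolding R_def by (intro power_increasing sum_mono2 growth_ge_1 t) auto
        finally have "norm (\<Prod>m\<in>M. vinv z $ m) \<le> growth t ^ R" .
        moreover have "norm (chart_field B A f z $ M) \<le> C"
          using C(2)[OF z] le by (simp add: z_def)
        ultimately show ?thesis
          unfolding norm_mult using growth_ge_1[OF t] C(1)
          by (intro mult_mono mult_nonneg_nonneg) auto
      qed
      have "torus_coeff f t $ K =
          (\<Sum>M\<in>UNIV. (\<Prod>m\<in>M. vinv z $ m) * chart_field B A f z $ M * w M $ K)"
        unfolding torus_coeff_chart[OF A t] by (simp add: ext_map_nth[of "mat_map B"] ext_map_diag w_def z_def)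
      then have "norm (torus_coeff f t $ K) \<le> (\<Sum>M\<in>UNIV. growth t ^ R * C * norm (w M $ K))"
        by (simp only:) (intro sum_norm_le bound)
      also have "\<dots> = growth t ^ R * C * (\<Sum>M\<in>UNIV. norm (w M $ K))"
        by (simp add: sum_distrib_left)
      also have "\<dots> \<le> growth t ^ R * C * D"
      proof (rule mult_left_mono)
        show "(\<Sum>M\<in>UNIV. norm (w M $ K)) \<le> D"
          unfolding D_def by (rule member_le_sum) (auto intro: sum_nonneg)
        show "0 \<le> growth t ^ R * C" using growth_ge_1[OF t] C(1) by auto
      qed
      finally show ?thesis by (simp add: mult_ac)
    qed
    moreover have "0 \<le> C * D" unfolding D_def using C(1) by (intro mult_nonneg_nonneg sum_nonneg) auto
    ultimately show ?thesis using A(1) by (intro exI[of _ "C * D"] exI[of _ R]) blast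
  qed
  then obtain C R where CR: "\<And>B. B \<in> chart_bases \<Delta> \<Longrightarrow> 0 \<le> C B"
    "\<And>B t K. B \<in> chart_bases \<Delta> \<Longrightarrow> t \<in> torus \<Longrightarrow>
      (\<And>A j. B ** A = mat 1 \<Longrightarrow> norm (chart_param A t $ j) \<le> 1) \<Longrightarrow>
      norm (torus_coeff f t $ K) \<le> C B * growth t ^ R B"
    by metis
  have fin: "finite (chart_bases \<Delta>)" using finite_chart_bases[OF complete] .
  show thesis
  proof (rule that)
    fix t :: "'n cvec" and K assume t: "t \<in> torus"
    obtain B where B: "B \<in> chart_bases \<Delta>"
      "\<And>A j. B ** A = mat 1 \<Longrightarrow> norm (chart_param A t $ j) \<le> 1"
      using chart_polydisc[OF complete t] by blast
    have "norm (torus_coeff f t $ K) \<le> C B * growth t ^ R B" by (rule CR(2)[OF B(1) t B(2)])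
    \<comment> \<open>Sums over the finitely many charts give a constant and an exponent that serve
      for all of them, since \<open>growth\<close> is at least 1.\<close>
    also have "\<dots> \<le> (\<Sum>B\<in>chart_bases \<Delta>. C B) * growth t ^ (\<Sum>B\<in>chart_bases \<Delta>. R B)"
      using growth_ge_1[OF t] CR(1) fin B(1)
      by (intro mult_mono power_increasing member_le_sum sum_nonneg) auto
    finally show "norm (torus_coeff f t $ K) \<le>
        (\<Sum>B\<in>chart_bases \<Delta>. C B) * growth t ^ (\<Sum>B\<in>chart_bases \<Delta>. R B)" .
  qed
qed

text \<open>Along a punctured coordinate line the coordinates of a fixed chart are constants times
  powers of \<open>s\<close>, and the chart field is the entire \<open>h\<close> composed with this
  curve.\<close>

lemma torus_coeff_holomorphic:
  fixes \<Delta> :: "'n::{finite,linorder} rvec set set"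
  assumes complete: "smooth_complete_fan \<Delta>" and f: "f \<in> holo_fields \<Delta> k" and t: "t \<in> torus"
  shows "(\<lambda>s. torus_coeff f (upd t i s) $ K) holomorphic_on - {0}"
proof -
  obtain B where B: "B \<in> chart_bases \<Delta>" using nonneg_combination[OF complete, of 0] by blast
  obtain A where A: "B ** A = mat 1" "A ** B = mat 1" using chart_basis_inverse[OF B] .
  obtain h where h: "entire h" "\<And>z. z \<in> torus \<Longrightarrow> f (chart_param B z) =
      ext_map (frechet_derivative (chart_param B) (at z)) (h z)"
    using f B unfolding holo_fields_def by blast
  define c where "c j = (\<Prod>l\<in>- {i}. (t $ l) powi (A $ l $ j))" for j
  define z where "z s = (\<chi> j. c j * s powi (A $ i $ j))" for s
  have c: "c j \<noteq> 0" for j using t by (simp add: c_def torus_nonzero)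
  have z: "chart_param A (upd t i s) = z s" if "s \<noteq> 0" for s
  proof -
    have "(\<Prod>l\<in>UNIV. (upd t i s $ l) powi (A $ l $ j)) = s powi (A $ i $ j) * c j" for j
      unfolding c_def
      by (subst prod.remove[of UNIV i]) (auto simp: upd_nth Compl_eq_Diff_UNIV intro!: prod.cong)
    then show ?thesis by (simp add: chart_param_def z_def mult.commute)
  qed
  have hz: "(\<lambda>s. h (z s) $ M) holomorphic_on - {0}" for M
    unfolding holomorphic_on_def
  proof
    fix s :: complex assume "s \<in> - {0}"
    then have s: "s \<noteq> 0" by simp
    define z' where "z' = (\<chi> j. c j * (of_int (A $ i $ j) * s powi (A $ i $ j - 1)))"
    have "((\<lambda>s. c j * s powi (A $ i $ j)) has_derivative (\<lambda>u. c j * (of_int (A $ i $ j) * s powi (A $ i $ j - 1)) * u)) (at s)" for j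
    proof -
      have "((\<lambda>s. c j * s powi (A $ i $ j)) has_field_derivative
          c j * (of_int (A $ i $ j) * s powi (A $ i $ j - 1) * 1)) (at s)"
        using s by (intro DERIV_cmult DERIV_power_int DERIV_ident) auto
      then show ?thesis by (simp add: has_field_derivative_def)
    qed
    then have "(z has_derivative (\<lambda>u. \<chi> j. c j * (of_int (A $ i $ j) * s powi (A $ i $ j - 1)) * u)) (at s)"
      unfolding z_def by (rule has_derivative_vec_lambda)
    moreover have "(\<lambda>u. \<chi> j. c j * (of_int (A $ i $ j) * s powi (A $ i $ j - 1)) * u) = (\<lambda>u. u *s z')"
      by (simp add: fun_eq_iff vec_eq_iff z'_def mult_ac)
    ultimately have dz: "(z has_derivative (\<lambda>u. u *s z')) (at s)" by simp
    obtain h' where h': "(h has_derivative h') (at (z s))" "\<And>c v. h' (c *s v) = c *s h' v"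
      using h(1) unfolding entire_def by meson
    have "(h \<circ> z has_derivative h' \<circ> (\<lambda>u. u *s z')) (at s)"
      by (rule diff_chain_at[OF dz h'(1)])
    from bounded_linear.has_derivative[OF bounded_linear_vec_nth this, of M]
    have "((\<lambda>s. h (z s) $ M) has_derivative (\<lambda>u. h' z' $ M * u)) (at s)"
      by (simp add: o_def h'(2) mult.commute)
    then have "((\<lambda>s. h (z s) $ M) has_field_derivative h' z' $ M) (at s)"
      by (simp add: has_field_derivative_def)
    then show "(\<lambda>s. h (z s) $ M) field_differentiable at s within - {0}"
      using field_differentiable_at_within field_differentiable_def by blast
  qed
  define w where "w M = wedge_list (map (\<lambda>i. mat_map B (axis i 1)) (sorted_list_of_set M))" for M
  have hol: "(\<lambda>s. \<Sum>M\<in>UNIV. (\<Prod>m\<in>M. inverse (c m * s powi (A $ i $ m))) * h (z s) $ M * w M $ K)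
      holomorphic_on - {0}"
    by (intro holomorphic_intros hz) (auto simp: c)
  have eq: "torus_coeff f (upd t i s) $ K =
      (\<Sum>M\<in>UNIV. (\<Prod>m\<in>M. inverse (c m * s powi (A $ i $ m))) * h (z s) $ M * w M $ K)"
    if "s \<in> - {0}" for s
  proof -
    have s: "s \<noteq> 0" using that by simp
    have u: "upd t i s \<in> torus" using t s by (rule upd_torus)
    have "z s \<in> torus" using chart_param_torus[OF u, of A] z[OF s] by simp
    then have "chart_field B A f (z s) = h (z s)"
      using chart_field_iff[OF _ A, of "z s" f "h (z s)"] h(2) by simp
    then show ?thesis
      unfolding torus_coeff_chart[OF A u] z[OF s]
      by (simp add: ext_map_nth[of "mat_map B"] ext_map_diag w_def vinv_def z_def)
  qed
  show ?thesis by (rule holomorphic_transform[OF hol]) (simp only: eq)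
qed

lemma torus_coeff_char_sum:
  fixes \<Delta> :: "'n::{finite,linorder} rvec set set"
  assumes complete: "smooth_complete_fan \<Delta>" and f: "f \<in> holo_fields \<Delta> k"
  shows "char_sum (\<lambda>t. torus_coeff f t $ K)"
proof -
  obtain C R where CR: "\<And>t K. t \<in> torus \<Longrightarrow> norm (torus_coeff f t $ K) \<le> C * growth t ^ R"
    using torus_coeff_growth[OF complete holo_bounded_field[OF complete f]] by blast
  have "separately_laurent (2 * R) R (\<lambda>t. torus_coeff f t $ K)"
    unfolding separately_laurent_def
  proof (intro ballI allI)
    fix t :: "'n cvec" and i assume t: "t \<in> torus"
    let ?q = "\<Prod>j\<in>- {i}. norm (t $ j) + inverse (norm (t $ j))"
    show "\<exists>p. degree p \<le> 2 * R \<and> (\<forall>s. s \<noteq> 0 \<longrightarrow> s ^ R * torus_coeff f (upd t i s) $ K = poly p s)"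
    proof (rule laurent_polynomial)
      show "(\<lambda>s. torus_coeff f (upd t i s) $ K) holomorphic_on - {0}"
        by (rule torus_coeff_holomorphic[OF complete f t])
      show "norm (torus_coeff f (upd t i s) $ K) \<le> (C * ?q ^ R) * (norm s + inverse (norm s)) ^ R"
        if "s \<noteq> 0" for s
      proof -
        have "growth (upd t i s) = (norm s + inverse (norm s)) * ?q"
          unfolding growth_def
          by (subst prod.remove[of UNIV i]) (auto simp: upd_nth Compl_eq_Diff_UNIV intro!: prod.cong)
        then show ?thesis using CR[OF upd_torus[OF t that, of i], of K]
          by (simp add: power_mult_distrib mult_ac)
      qed
    qed
  qed
  then show ?thesis by (rule separately_laurent_char_sum[rotated]) simp
qed

lemma holo_fields_weight_sum:
  fixes \<Delta> :: "'n::{finite,linorder} rvec set set"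
  assumes complete: "smooth_complete_fan \<Delta>" and f: "f \<in> holo_fields \<Delta> k"
  obtains S M where "finite S" "f = (\<lambda>t. \<Sum>I\<in>S. weight_field I (M I) t)"
proof -
  have "\<forall>K. \<exists>S c. finite S \<and> (\<forall>t\<in>torus. torus_coeff f t $ K = (\<Sum>I\<in>S. c I * character I t))"
    using torus_coeff_char_sum[OF complete f] by (simp add: char_sum_def)
  then obtain S c where Sc: "\<And>K. finite (S K)"
    "\<And>K t. t \<in> torus \<Longrightarrow> torus_coeff f t $ K = (\<Sum>I\<in>S K. c K I * character I t)" by metis
  define T where "T = (\<Union>K. S K)"
  define M where "M I = (\<chi> K. if I \<in> S K then c K I else 0)" for I
  have fin: "finite T" using Sc(1) by (simp add: T_def)
  have "f t = (\<Sum>I\<in>T. weight_field I (M I) t)" for t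
  proof (cases "t \<in> torus")
    case t: True
    have "torus_coeff f t = (\<Sum>I\<in>T. character I t *s M I)"
    proof (rule ext_eqI)
      fix K
      have "(\<Sum>I\<in>S K. c K I * character I t) = (\<Sum>I\<in>T. character I t * (if I \<in> S K then c K I else 0))"
        by (rule sum.mono_neutral_cong_left) (use fin in \<open>auto simp: T_def\<close>)
      then show "torus_coeff f t $ K = (\<Sum>I\<in>T. character I t *s M I) $ K"
        using Sc(2)[OF t, of K] by (simp add: M_def)
    qed
    then have "ext_map (diag_map t) (torus_coeff f t) = (\<Sum>I\<in>T. weight_field I (M I) t)"
      by (simp add: ext_map_sum ext_map_scale weight_field_def rho_diag t)
    then show ?thesis by (simp add: torus_coeff_def ext_map_diag_vinv t)
  qed (use f in \<open>simp add: holo_fields_def\<close>)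
  with fin show thesis by (intro that[of T M]) auto
qed

lemma holo_fields_eq:
  fixes \<Delta> :: "'n::{finite,linorder} rvec set set"
  assumes complete: "smooth_complete_fan \<Delta>"
  shows "f \<in> holo_fields \<Delta> k \<longleftrightarrow>
    (\<exists>M. (\<forall>I\<in>S_all \<Delta>. M I \<in> annihilated \<Delta> I \<and> homog k (M I)) \<and>
      f = (\<lambda>t. \<Sum>I\<in>S_all \<Delta>. weight_field I (M I) t))"
proof
  assume f: "f \<in> holo_fields \<Delta> k"
  obtain S M where SM: "finite S" "f = (\<lambda>t. \<Sum>I\<in>S. weight_field I (M I) t)"
    using holo_fields_weight_sum[OF complete f] .
  have bounded: "bounded_field \<Delta> k (weight_field I (M I))" if "I \<in> S" for I
    using bounded_weight_component[OF SM(1) _ that] holo_bounded_field[OF complete f] SM(2) by simp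
  note props = bounded_weight_field[OF complete bounded]
  define M' where "M' I = (if I \<in> S then M I else 0)" for I
  have "(\<Sum>I\<in>S. weight_field I (M I) t) = (\<Sum>I\<in>S_all \<Delta>. weight_field I (M' I) t)" for t
  proof -
    have "(\<Sum>I\<in>S. weight_field I (M I) t) = (\<Sum>I\<in>S \<union> S_all \<Delta>. weight_field I (M' I) t)"
      by (rule sum.mono_neutral_cong_left) (use SM(1) finite_S_all[OF complete] in \<open>auto simp: M'_def\<close>)
    also have "\<dots> = (\<Sum>I\<in>S_all \<Delta>. weight_field I (M' I) t)"
    proof (rule sum.mono_neutral_right)
      show "\<forall>I\<in>S \<union> S_all \<Delta> - S_all \<Delta>. weight_field I (M' I) t = 0"
      proof
        fix I assume "I \<in> S \<union> S_all \<Delta> - S_all \<Delta>"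
        then have "M I = 0" using props(1) by blast
        then show "weight_field I (M' I) t = 0" by (simp add: M'_def)
      qed
    qed (use SM(1) finite_S_all[OF complete] in auto)
    finally show ?thesis .
  qed
  moreover have "M' I \<in> annihilated \<Delta> I \<and> homog k (M' I)" for I
    using props(2,3)[of I] by (cases "M' I = 0") (auto simp: M'_def annihilated_def split: if_splits)
  ultimately show "\<exists>M. (\<forall>I\<in>S_all \<Delta>. M I \<in> annihilated \<Delta> I \<and> homog k (M I)) \<and>
      f = (\<lambda>t. \<Sum>I\<in>S_all \<Delta>. weight_field I (M I) t)"
    using SM(2) by auto
next
  assume "\<exists>M. (\<forall>I\<in>S_all \<Delta>. M I \<in> annihilated \<Delta> I \<and> homog k (M I)) \<and>
      f = (\<lambda>t. \<Sum>I\<in>S_all \<Delta>. weight_field I (M I) t)"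
  then show "f \<in> holo_fields \<Delta> k"
    using finite_S_all[OF complete] by (auto intro!: holo_fields_sum weight_field_holo[OF complete])
qed

section \<open>BV operators\<close>

lemma weight_field_sum: "weight_field I (\<Sum>i\<in>S. A i) t = (\<Sum>i\<in>S. weight_field I (A i) t)"
  by (induction S rule: infinite_finite_induct) (auto simp: weight_field_add)

lemma annihilated_scale: "A \<in> annihilated \<Delta> I \<Longrightarrow> c *s A \<in> annihilated \<Delta> I"
  by (simp add: annihilated_def)

lemma annihilated_zero [simp]: "0 \<in> annihilated \<Delta> I"
  by (simp add: annihilated_def)

text \<open>By the derivation rule, b \<and> \<iota>A is <\<alpha>, b> A up to the contraction of b
  \<and> A. With \<open>\<alpha> = \<delta> - I\<close> this is where membership of \<delta> in
  \<open>face_hat\<close> keeps the operator holomorphic.\<close>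

lemma annihilated_contract:
  assumes "A \<in> annihilated \<Delta> I"
    and "\<And>b. b \<in> active \<Delta> I \<Longrightarrow> cdot \<alpha> (cplx_of_lattice b) = 0"
  shows "contract \<alpha> A \<in> annihilated \<Delta> I"
  unfolding annihilated_def
proof (intro CollectI ballI)
  fix b assume b: "b \<in> active \<Delta> I"
  have "contract \<alpha> (ext_vector (cplx_of_lattice b) \<and>\<^sub>e A) = 0"
    using assms(1) b by (simp add: annihilated_def)
  then show "ext_vector (cplx_of_lattice b) \<and>\<^sub>e contract \<alpha> A = 0"
    using assms(2)[OF b] by (simp add: contract_vec_wedge)
qed

lemma vec_wedge_commute: "ext_vector x \<and>\<^sub>e A = grade_inv A \<and>\<^sub>e ext_vector x"
  by (induction A rule: ext_induct)
    (simp_all add: wedge_add_left wedge_add_right grade_inv_vec_wedge wedge_assoc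
      vec_wedge_anticommute[of x])

lemma wedge_list_append_Cons:
  "wedge_list (bs @ x # ys) = (- 1) ^ length bs *s (ext_vector x \<and>\<^sub>e wedge_list (bs @ ys))"
proof (induction bs)
  case (Cons b bs)
  have "wedge_list ((b # bs) @ x # ys) =
      (- 1) ^ length bs *s (ext_vector b \<and>\<^sub>e (ext_vector x \<and>\<^sub>e wedge_list (bs @ ys)))"
    using Cons by simp
  also have "\<dots> = (- 1) ^ length bs *s (- (ext_vector x \<and>\<^sub>e (ext_vector b \<and>\<^sub>e wedge_list (bs @ ys))))"
    by (simp only: vec_wedge_anticommute[of b x])
  finally show ?case by (simp add: vector_smult_lneg vector_smult_rneg)
qed simp

lemma wedge_list_append: "wedge_list (xs @ ys) = wedge_list xs \<and>\<^sub>e wedge_list ys"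
  by (induction xs) (simp_all add: wedge_assoc)

lemma S_upto_S_all: "I \<in> S_upto \<Delta> k \<Longrightarrow> I \<in> S_all \<Delta>"
proof -
  assume "I \<in> S_upto \<Delta> k"
  then obtain F where "F face_of polytope_of \<Delta>" "real_of_lattice I \<in> rel_interior F"
    by (auto simp: S_upto_def S_codim_def)
  then show ?thesis
    using rel_interior_subset face_of_imp_subset unfolding S_all_def by blast
qed

section \<open>Graded pieces of the algebra and closure under the wedge product\<close>

context
  fixes \<Delta> :: "'n::{finite,linorder} rvec set set"
  assumes complete: "smooth_complete_fan \<Delta>"
begin

lemma alg_piece_off: "\<not> (0 \<le> k \<and> k \<le> int CARD('n)) \<Longrightarrow> alg_piece \<Delta> k = {\<lambda>t. 0}"
  by (auto simp: alg_piece_def)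

text \<open>Outside the degrees 0 to n the only element is 0, written with all coefficients 0. The
  absolute value makes one statement serve all integers k and leaves the parity of the degree
  intact.\<close>

lemma alg_pieceE:
  assumes "f \<in> alg_piece \<Delta> k"
  obtains M where "\<And>I. I \<in> S_all \<Delta> \<Longrightarrow> M I \<in> annihilated \<Delta> I"
    "\<And>I. I \<in> S_all \<Delta> \<Longrightarrow> homog (nat \<bar>k\<bar>) (M I)"
    "f = (\<lambda>t. \<Sum>I\<in>S_all \<Delta>. weight_field I (M I) t)"
proof (cases "0 \<le> k \<and> k \<le> int CARD('n)")
  case True
  then have "f \<in> holo_fields \<Delta> (nat \<bar>k\<bar>)" using assms by (simp add: alg_piece_def)
  then show thesis unfolding holo_fields_eq[OF complete] using that by blast
next
  case False
  then show thesis using that[of "\<lambda>_. 0"] assms by (simp add: alg_piece_off)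
qed

lemma weight_field_in_alg_piece:
  assumes "I \<in> S_all \<Delta>" "M \<in> annihilated \<Delta> I" "homog k M"
  shows "weight_field I M \<in> alg_piece \<Delta> (int k)"
proof (cases "k \<le> CARD('n)")
  case True
  then show ?thesis using weight_field_holo[OF complete assms] by (simp add: alg_piece_def)
next
  case False
  then have "M = 0" using homog_gt[OF assms(3)] by simp
  then have "weight_field I M = (\<lambda>t. 0)" by (simp add: fun_eq_iff)
  then show ?thesis using False by (simp add: alg_piece_def)
qed

lemma alg_piece_zero: "(\<lambda>t. 0) \<in> alg_piece \<Delta> k"
  by (simp add: alg_piece_def holo_fields_zero)

lemma alg_piece_add:
  "f \<in> alg_piece \<Delta> k \<Longrightarrow> g \<in> alg_piece \<Delta> k \<Longrightarrow> (\<lambda>t. f t + g t) \<in> alg_piece \<Delta> k"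
  by (auto simp: alg_piece_def holo_fields_add split: if_splits)

lemma alg_piece_sum:
  "finite S \<Longrightarrow> (\<And>I. I \<in> S \<Longrightarrow> f I \<in> alg_piece \<Delta> k) \<Longrightarrow> (\<lambda>t. \<Sum>I\<in>S. f I t) \<in> alg_piece \<Delta> k"
  by (induction S rule: finite_induct) (auto intro: alg_piece_add alg_piece_zero)

lemma alg_piece_scale:
  assumes "f \<in> alg_piece \<Delta> k"
  shows "(\<lambda>t. c *s f t) \<in> alg_piece \<Delta> k"
proof (cases "0 \<le> k \<and> k \<le> int CARD('n)")
  case True
  obtain M where M: "\<And>I. I \<in> S_all \<Delta> \<Longrightarrow> M I \<in> annihilated \<Delta> I"
    "\<And>I. I \<in> S_all \<Delta> \<Longrightarrow> homog (nat \<bar>k\<bar>) (M I)"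
    "f = (\<lambda>t. \<Sum>I\<in>S_all \<Delta>. weight_field I (M I) t)"
    by (rule alg_pieceE[OF assms]) (rule that, assumption+)
  have "(\<lambda>t. \<Sum>I\<in>S_all \<Delta>. weight_field I (c *s M I) t) \<in> alg_piece \<Delta> (int (nat \<bar>k\<bar>))"
    by (intro alg_piece_sum weight_field_in_alg_piece annihilated_scale homog_scale M
        finite_S_all[OF complete])
  then show ?thesis using True by (simp add: M(3) vec.scale_sum_right weight_field_scale)
qed (use assms in \<open>simp add: alg_piece_off\<close>)

lemma alg_piece_subset_alg:
  assumes "f \<in> alg_piece \<Delta> k"
  shows "f \<in> alg \<Delta>"
  unfolding alg_def
proof (intro CollectI exI[of _ "\<lambda>j. if j = k then f else (\<lambda>t. 0)"] conjI allI)
  show "(if j = k then f else (\<lambda>t. 0)) \<in> alg_piece \<Delta> j" for j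
    using assms by (simp add: alg_piece_zero)
  have "(\<Sum>j\<in>{0..int CARD('n)}. (if j = k then f else (\<lambda>t. 0)) t) = f t" for t
  proof (cases "k \<in> {0..int CARD('n)}")
    case True
    have "(\<Sum>j\<in>{0..int CARD('n)}. (if j = k then f else (\<lambda>t. 0)) t) =
        (\<Sum>j\<in>{0..int CARD('n)}. if j = k then f t else 0)"
      by (rule sum.cong) auto
    then show ?thesis using True by simp
  next
    case False
    then have "f = (\<lambda>t. 0)" using assms by (simp add: alg_piece_off)
    then have "(if j = k then f else (\<lambda>t. 0)) t = 0" for j by simp
    then show ?thesis using \<open>f = (\<lambda>t. 0)\<close> by simp
  qed
  then show "f = (\<lambda>t. \<Sum>j\<in>{0..int CARD('n)}. (if j = k then f else (\<lambda>t. 0)) t)" by auto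
qed

lemma algE:
  assumes "f \<in> alg \<Delta>"
  obtains c where "\<forall>k. c k \<in> alg_piece \<Delta> k" "f = (\<lambda>t. \<Sum>k\<in>{0..int CARD('n)}. c k t)"
  using assms unfolding alg_def by blast

lemma alg_add:
  assumes "f \<in> alg \<Delta>" "g \<in> alg \<Delta>"
  shows "(\<lambda>t. f t + g t) \<in> alg \<Delta>"
proof -
  obtain c where c: "\<forall>k. c k \<in> alg_piece \<Delta> k" "f = (\<lambda>t. \<Sum>k\<in>{0..int CARD('n)}. c k t)"
    using assms(1) by (rule algE)
  obtain d where d: "\<forall>k. d k \<in> alg_piece \<Delta> k" "g = (\<lambda>t. \<Sum>k\<in>{0..int CARD('n)}. d k t)"
    using assms(2) by (rule algE)
  show ?thesis unfolding alg_def c(2) d(2)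
    by (intro CollectI exI[of _ "\<lambda>k t. c k t + d k t"]) (simp add: sum.distrib alg_piece_add c(1) d(1))
qed

lemma alg_scale:
  assumes "f \<in> alg \<Delta>"
  shows "(\<lambda>t. a *s f t) \<in> alg \<Delta>"
proof -
  obtain c where c: "\<forall>k. c k \<in> alg_piece \<Delta> k" "f = (\<lambda>t. \<Sum>k\<in>{0..int CARD('n)}. c k t)"
    using assms by (rule algE)
  show ?thesis unfolding alg_def c(2)
    by (intro CollectI exI[of _ "\<lambda>k t. a *s c k t"]) (simp add: vec.scale_sum_right alg_piece_scale c(1))
qed

lemma alg_zero: "(\<lambda>t. 0) \<in> alg \<Delta>"
  using alg_piece_subset_alg[OF alg_piece_zero] .

lemma alg_sum:
  "finite S \<Longrightarrow> (\<And>I. I \<in> S \<Longrightarrow> f I \<in> alg \<Delta>) \<Longrightarrow> (\<lambda>t. \<Sum>I\<in>S. f I t) \<in> alg \<Delta>"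
  by (induction S rule: finite_induct) (auto intro: alg_add alg_zero)

lemma alg_weight_sum:
  assumes "f \<in> alg \<Delta>"
  obtains M where "f = (\<lambda>t. \<Sum>I\<in>S_all \<Delta>. weight_field I (M I) t)"
proof -
  obtain c where c: "\<forall>k. c k \<in> alg_piece \<Delta> k" "f = (\<lambda>t. \<Sum>k\<in>{0..int CARD('n)}. c k t)"
    using assms by (rule algE)
  have "\<exists>M. c k = (\<lambda>t. \<Sum>I\<in>S_all \<Delta>. weight_field I (M I) t)" for k
    by (rule alg_pieceE[OF c(1)[rule_format, of k]]) (rule exI)
  then obtain M where M: "\<And>k. c k = (\<lambda>t. \<Sum>I\<in>S_all \<Delta>. weight_field I (M k I) t)" by metis
  have "f = (\<lambda>t. \<Sum>I\<in>S_all \<Delta>. weight_field I (\<Sum>k\<in>{0..int CARD('n)}. M k I) t)"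
    unfolding c(2) M weight_field_sum by (rule ext, rule sum.swap)
  then show thesis by (rule that)
qed

lemma torus_differentiable_alg: "f \<in> alg \<Delta> \<Longrightarrow> torus_differentiable f"
  by (erule alg_weight_sum)
    (simp add: torus_differentiable_sum torus_differentiable_weight_field)

lemma homog_alg_piece: "f \<in> alg_piece \<Delta> k \<Longrightarrow> homog (nat \<bar>k\<bar>) (f t)"
  by (erule alg_pieceE) (auto intro!: homog_sum homog_weight_field)

text \<open>If a generator b is active for both \<open>I\<close> and \<open>J\<close>, both factors
  are divisible by b and the product is 0. Otherwise all pairings of I + J are at least -1, and a
  generator active for I + J is active for one of the two, so it annihilates the product.\<close>

lemma wedge_annihilated_in_alg:
  assumes I: "I \<in> S_all \<Delta>" "M \<in> annihilated \<Delta> I" "homog k M"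
    and J: "J \<in> S_all \<Delta>" "N \<in> annihilated \<Delta> J" "homog l N"
  shows "weight_field (I + J) (M \<and>\<^sub>e N) \<in> alg \<Delta>"
proof (cases "M \<and>\<^sub>e N = 0")
  case True
  then have "weight_field (I + J) (M \<and>\<^sub>e N) = (\<lambda>t. 0)" by (simp add: fun_eq_iff)
  then show ?thesis by (simp add: alg_zero)
next
  case False
  have add: "ipair (I + J) b = ipair I b + ipair J b" for b
    by (simp add: ipair_def distrib_right sum.distrib)
  have kill: "ext_vector (cplx_of_lattice b) \<and>\<^sub>e (M \<and>\<^sub>e N) = 0"
    if b: "b \<in> active \<Delta> I \<or> b \<in> active \<Delta> J" for b
  proof -
    let ?x = "ext_vector (cplx_of_lattice b)"
    have "?x \<and>\<^sub>e (M \<and>\<^sub>e N) = (?x \<and>\<^sub>e M) \<and>\<^sub>e N" by (simp add: wedge_assoc)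
    moreover have "?x \<and>\<^sub>e (M \<and>\<^sub>e N) = grade_inv M \<and>\<^sub>e (?x \<and>\<^sub>e N)"
      by (metis wedge_assoc vec_wedge_commute)
    ultimately show ?thesis using b I(2) J(2) by (auto simp: annihilated_def)
  qed
  have not_both: "\<not> (b \<in> active \<Delta> I \<and> b \<in> active \<Delta> J)" for b
  proof
    assume b: "b \<in> active \<Delta> I \<and> b \<in> active \<Delta> J"
    let ?x = "cplx_of_lattice b"
    \<comment> \<open>As \<open>I\<close> pairs to -1 with an active generator, its negative is a
      covector with value 1, ready for division.\<close>
    define \<alpha> where "\<alpha> = (- 1) *s cplx_of_lattice I"
    have "cdot (cplx_of_lattice I) ?x = - 1"
      using b by (simp add: active_def cdot_cplx_of_real flip: cplx_of_real_lattice)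
    then have \<alpha>: "cdot \<alpha> ?x = 1" unfolding \<alpha>_def cdot_scale_left by simp
    have M': "ext_vector ?x \<and>\<^sub>e M = 0" and N': "ext_vector ?x \<and>\<^sub>e N = 0"
      using b I(2) J(2) by (auto simp: annihilated_def)
    have M: "M = ext_vector ?x \<and>\<^sub>e contract \<alpha> M"
      using contract_vec_wedge[of \<alpha> ?x M] M' \<alpha> by simp
    have "M \<and>\<^sub>e N = (ext_vector ?x \<and>\<^sub>e contract \<alpha> M) \<and>\<^sub>e N" using M by simp
    also have "\<dots> = grade_inv (contract \<alpha> M) \<and>\<^sub>e (ext_vector ?x \<and>\<^sub>e N)"
      by (simp add: vec_wedge_commute[of ?x "contract \<alpha> M"] wedge_assoc)
    finally show False using False N' by simp
  qed
  have "I + J \<in> S_all \<Delta>"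
    unfolding S_all_ipair
  proof
    fix b assume b: "b \<in> gens \<Delta>"
    have "- 1 \<le> ipair I b" "- 1 \<le> ipair J b" using I(1) J(1) b by (auto simp: S_all_ipair)
    moreover have "ipair I b \<noteq> - 1 \<or> ipair J b \<noteq> - 1"
      using not_both[of b] b by (auto simp: active_ipair)
    ultimately show "- 1 \<le> ipair (I + J) b" unfolding add by presburger
  qed
  moreover have "M \<and>\<^sub>e N \<in> annihilated \<Delta> (I + J)"
    unfolding annihilated_def
  proof (intro CollectI ballI kill)
    fix b assume "b \<in> active \<Delta> (I + J)"
    then have b: "b \<in> gens \<Delta>" "ipair I b + ipair J b = - 1" by (auto simp: active_ipair add)
    have "- 1 \<le> ipair I b" "- 1 \<le> ipair J b" using I(1) J(1) b by (auto simp: S_all_ipair)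
    then show "b \<in> active \<Delta> I \<or> b \<in> active \<Delta> J"
      using b by (auto simp: active_ipair)
  qed
  moreover have "homog (k + l) (M \<and>\<^sub>e N)" using I(3) J(3) by (rule homog_wedge)
  ultimately show ?thesis using weight_field_in_alg_piece alg_piece_subset_alg by blast
qed

lemma field_wedge_alg_piece:
  assumes a: "a \<in> alg_piece \<Delta> k" and b: "b \<in> alg_piece \<Delta> l"
  shows "field_wedge a b \<in> alg \<Delta>"
proof -
  obtain M where M: "\<And>I. I \<in> S_all \<Delta> \<Longrightarrow> M I \<in> annihilated \<Delta> I"
    "\<And>I. I \<in> S_all \<Delta> \<Longrightarrow> homog (nat \<bar>k\<bar>) (M I)"
    "a = (\<lambda>t. \<Sum>I\<in>S_all \<Delta>. weight_field I (M I) t)" by (rule alg_pieceE[OF a]) (rule that, assumption+)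
  obtain N where N: "\<And>I. I \<in> S_all \<Delta> \<Longrightarrow> N I \<in> annihilated \<Delta> I"
    "\<And>I. I \<in> S_all \<Delta> \<Longrightarrow> homog (nat \<bar>l\<bar>) (N I)"
    "b = (\<lambda>t. \<Sum>I\<in>S_all \<Delta>. weight_field I (N I) t)" by (rule alg_pieceE[OF b]) (rule that, assumption+)
  have "weight_field (I + J) (M I \<and>\<^sub>e N J) \<in> alg \<Delta>" if I: "I \<in> S_all \<Delta>" and J: "J \<in> S_all \<Delta>" for I J
    using wedge_annihilated_in_alg[OF I M(1)[OF I] M(2)[OF I] J N(1)[OF J] N(2)[OF J]] .
  then have "(\<lambda>t. \<Sum>I\<in>S_all \<Delta>. \<Sum>J\<in>S_all \<Delta>. weight_field (I + J) (M I \<and>\<^sub>e N J) t) \<in> alg \<Delta>"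
    by (intro alg_sum finite_S_all[OF complete])
  then show ?thesis
    by (subst (asm) sum.swap) (simp add: field_wedge_def M(3) N(3) wedge_sum_left wedge_sum_right wedge_weight_field)
qed

section \<open>Degree -1 operators, and \<open>bv_op\<close> as one of them\<close>

lemma degree_minus_one_add:
  "degree_minus_one_operator \<Delta> D \<Longrightarrow> f \<in> alg \<Delta> \<Longrightarrow> g \<in> alg \<Delta> \<Longrightarrow>
    D (\<lambda>t. f t + g t) = (\<lambda>t. D f t + D g t)"
  by (simp add: degree_minus_one_operator_def)

lemma degree_minus_one_scale:
  "degree_minus_one_operator \<Delta> D \<Longrightarrow> f \<in> alg \<Delta> \<Longrightarrow> D (\<lambda>t. c *s f t) = (\<lambda>t. c *s D f t)"
  by (simp add: degree_minus_one_operator_def)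

lemma degree_minus_one_zero: "degree_minus_one_operator \<Delta> D \<Longrightarrow> D (\<lambda>t. 0) = (\<lambda>t. 0)"
  using degree_minus_one_scale[OF _ alg_zero, of D 0] by simp

lemma degree_minus_one_sum:
  assumes "degree_minus_one_operator \<Delta> D" "finite S" "\<And>I. I \<in> S \<Longrightarrow> f I \<in> alg \<Delta>"
  shows "D (\<lambda>t. \<Sum>I\<in>S. f I t) = (\<lambda>t. \<Sum>I\<in>S. D (f I) t)"
  using assms(2,3)
  by (induction S rule: finite_induct)
    (auto simp: degree_minus_one_zero[OF assms(1)] degree_minus_one_add[OF assms(1)] alg_sum)

lemma degree_minus_one_piece:
  "degree_minus_one_operator \<Delta> D \<Longrightarrow> f \<in> alg_piece \<Delta> k \<Longrightarrow> D f \<in> alg_piece \<Delta> (k - 1)"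
  unfolding degree_minus_one_operator_def by blast

lemma bv_op_degree_0:
  assumes "f \<in> alg_piece \<Delta> 0"
  shows "bv_op \<delta> f = (\<lambda>t. 0)"
proof -
  obtain M where M: "\<And>I. I \<in> S_all \<Delta> \<Longrightarrow> M I \<in> annihilated \<Delta> I"
    "\<And>I. I \<in> S_all \<Delta> \<Longrightarrow> homog (nat \<bar>0\<bar>) (M I)"
    "f = (\<lambda>t. \<Sum>I\<in>S_all \<Delta>. weight_field I (M I) t)" by (rule alg_pieceE[OF assms]) (rule that, assumption+)
  have "homog 0 (M I)" if "I \<in> S_all \<Delta>" for I using M(2)[OF that] by simp
  then show ?thesis
    by (simp add: M(3) bv_op_sum torus_differentiable_weight_field bv_op_weight_field homog_0_contract)
qed

text \<open>The fields in the hypothesis span all positive degrees, since a weight of codimension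
  above \<open>k\<close> has coefficient 0. In degree 0 both operators vanish, the target being the
  zero space.\<close>

lemma eq_bv_op:
  assumes D: "degree_minus_one_operator \<Delta> D"
    and weight: "\<And>k I M. 1 \<le> k \<Longrightarrow> k \<le> CARD('n) \<Longrightarrow> I \<in> S_upto \<Delta> k \<Longrightarrow> M \<in> weight_ext \<Delta> k I \<Longrightarrow>
      D (weight_field I M) = bv_op \<delta> (weight_field I M)"
    and f: "f \<in> alg \<Delta>"
  shows "D f = bv_op \<delta> f"
proof -
  have piece: "D g = bv_op \<delta> g" if g: "g \<in> alg_piece \<Delta> k" and k: "k \<in> {0..int CARD('n)}" for g k
  proof (cases "k = 0")
    case True
    have "D g \<in> alg_piece \<Delta> (- 1)" using degree_minus_one_piece[OF D g] True by simp
    then show ?thesis using bv_op_degree_0 g True by (simp add: alg_piece_off)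
  next
    case False
    obtain M where M: "\<And>I. I \<in> S_all \<Delta> \<Longrightarrow> M I \<in> annihilated \<Delta> I"
      "\<And>I. I \<in> S_all \<Delta> \<Longrightarrow> homog (nat \<bar>k\<bar>) (M I)"
      "g = (\<lambda>t. \<Sum>I\<in>S_all \<Delta>. weight_field I (M I) t)" by (rule alg_pieceE[OF g]) (rule that, assumption+)
    have w: "weight_field I (M I) \<in> alg \<Delta>" if "I \<in> S_all \<Delta>" for I
      using alg_piece_subset_alg weight_field_in_alg_piece M that by blast
    have "D (weight_field I (M I)) = bv_op \<delta> (weight_field I (M I))" if I: "I \<in> S_all \<Delta>" for I
    proof (cases "I \<in> S_upto \<Delta> (nat \<bar>k\<bar>)")
      case True
      moreover have "M I \<in> weight_ext \<Delta> (nat \<bar>k\<bar>) I"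
        using M I by (simp add: weight_ext_eq[OF complete I])
      ultimately show ?thesis using k False by (intro weight[of "nat \<bar>k\<bar>"]) auto
    next
      case False
      then have "M I = 0"
        using annihilated_low_codim[OF M(1,2)[OF I]] S_upto_iff[OF complete I] by auto
      then have "weight_field I (M I) = (\<lambda>t. 0)" by (simp add: fun_eq_iff)
      then show ?thesis by (simp add: degree_minus_one_zero[OF D])
    qed
    then show ?thesis
      using w by (simp add: M(3) bv_op_sum torus_differentiable_weight_field
          degree_minus_one_sum[OF D finite_S_all[OF complete]])
  qed
  obtain c where "\<forall>k. c k \<in> alg_piece \<Delta> k" and c2: "f = (\<lambda>t. \<Sum>k\<in>{0..int CARD('n)}. c k t)"
    using f by (rule algE)
  then have c1: "c k \<in> alg_piece \<Delta> k" for k by blast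
  note c = c1 c2
  have "c k \<in> alg \<Delta>" for k using c(1) by (rule alg_piece_subset_alg)
  then show ?thesis
    using piece[OF c(1)]
    by (simp add: c(2) bv_op_sum torus_differentiable_alg degree_minus_one_sum[OF D])
qed

lemma bv_op_piece:
  assumes \<delta>: "\<And>I. I \<in> S_all \<Delta> \<Longrightarrow> \<delta> \<in> face_hat \<Delta> I" and f: "f \<in> alg_piece \<Delta> k"
  shows "bv_op \<delta> f \<in> alg_piece \<Delta> (k - 1)"
proof (cases "1 \<le> k \<and> k \<le> int CARD('n)")
  case True
  obtain M where M: "\<And>I. I \<in> S_all \<Delta> \<Longrightarrow> M I \<in> annihilated \<Delta> I"
    "\<And>I. I \<in> S_all \<Delta> \<Longrightarrow> homog (nat \<bar>k\<bar>) (M I)"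
    "f = (\<lambda>t. \<Sum>I\<in>S_all \<Delta>. weight_field I (M I) t)" by (rule alg_pieceE[OF f]) (rule that, assumption+)
  have "weight_field I (contract (\<delta> - cplx_of_lattice I) (M I)) \<in> alg_piece \<Delta> (int (nat \<bar>k\<bar> - 1))"
    if I: "I \<in> S_all \<Delta>" for I
    using \<delta>[OF I] M(1)[OF I] M(2)[OF I] face_hat_iff[OF complete I]
    by (intro weight_field_in_alg_piece I annihilated_contract homog_contract) auto
  then have "(\<lambda>t. \<Sum>I\<in>S_all \<Delta>. weight_field I (contract (\<delta> - cplx_of_lattice I) (M I)) t)
      \<in> alg_piece \<Delta> (int (nat \<bar>k\<bar> - 1))"
    by (intro alg_piece_sum finite_S_all[OF complete])
  moreover have "int (nat \<bar>k\<bar> - 1) = k - 1" using True by auto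
  ultimately show ?thesis
    by (simp add: M(3) bv_op_sum torus_differentiable_weight_field bv_op_weight_field)
next
  case False
  have "bv_op \<delta> f = (\<lambda>t. 0)"
  proof (cases "k = 0")
    case True
    then show ?thesis using bv_op_degree_0 f by simp
  next
    case False
    then have "f = (\<lambda>t. 0)" using f \<open>\<not> (1 \<le> k \<and> k \<le> int CARD('n))\<close> by (simp add: alg_piece_off)
    then show ?thesis by simp
  qed
  then show ?thesis by (simp add: alg_piece_zero)
qed

lemma bv_op_alg:
  assumes \<delta>: "\<And>I. I \<in> S_all \<Delta> \<Longrightarrow> \<delta> \<in> face_hat \<Delta> I" and f: "f \<in> alg \<Delta>"
  shows "bv_op \<delta> f \<in> alg \<Delta>"
proof -
  obtain c where "\<forall>k. c k \<in> alg_piece \<Delta> k" and c2: "f = (\<lambda>t. \<Sum>k\<in>{0..int CARD('n)}. c k t)"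
    using f by (rule algE)
  then have c1: "c k \<in> alg_piece \<Delta> k" for k by blast
  note c = c1 c2
  have "bv_op \<delta> f = (\<lambda>t. \<Sum>k\<in>{0..int CARD('n)}. bv_op \<delta> (c k) t)"
    unfolding c(2) using torus_differentiable_alg alg_piece_subset_alg[OF c(1)]
    by (intro bv_op_sum) blast
  also have "\<dots> \<in> alg \<Delta>"
    using alg_piece_subset_alg[OF bv_op_piece[OF \<delta> c(1)]] by (intro alg_sum) auto
  finally show ?thesis .
qed

text \<open>Weight by weight this is twice the contraction with the same covector \<delta> -
  I.\<close>

lemma bv_op_bv_op:
  assumes "f \<in> alg \<Delta>"
  shows "bv_op \<delta> (bv_op \<delta> f) = (\<lambda>t. 0)"
proof -
  obtain M where "f = (\<lambda>t. \<Sum>I\<in>S_all \<Delta>. weight_field I (M I) t)" using alg_weight_sum[OF assms] .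
  then show ?thesis
    by (simp add: bv_op_sum torus_differentiable_weight_field bv_op_weight_field)
qed

lemma schouten_bv_op:
  assumes a: "a \<in> alg_piece \<Delta> k" and b: "b \<in> alg_piece \<Delta> l"
  shows "schouten a b = (\<lambda>t. (- 1) powi k *s (bv_op \<delta> (field_wedge a b) t -
    field_wedge (bv_op \<delta> a) b t - (- 1) powi k *s field_wedge a (bv_op \<delta> b) t))"
proof
  fix t
  have "(- 1 :: complex) powi k = (- 1) ^ nat \<bar>k\<bar>"
    by (cases "0 \<le> k") (auto simp: power_int_def)
  then show "schouten a b t = (- 1) powi k *s (bv_op \<delta> (field_wedge a b) t -
      field_wedge (bv_op \<delta> a) b t - (- 1) powi k *s field_wedge a (bv_op \<delta> b) t)"
    using bv_op_wedge[of a "nat \<bar>k\<bar>" b t \<delta>] homog_alg_piece[OF a]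
      torus_differentiable_alg[OF alg_piece_subset_alg[OF a]]
      torus_differentiable_alg[OF alg_piece_subset_alg[OF b]] by simp
qed

lemma degree_minus_one_restrict_bv_op:
  assumes \<delta>: "\<And>I. I \<in> S_all \<Delta> \<Longrightarrow> \<delta> \<in> face_hat \<Delta> I"
  shows "degree_minus_one_operator \<Delta> (restrict (bv_op \<delta>) (alg \<Delta>))"
  unfolding degree_minus_one_operator_def
proof (intro conjI ballI allI)
  show "restrict (bv_op \<delta>) (alg \<Delta>) \<in> alg \<Delta> \<rightarrow>\<^sub>E alg \<Delta>"
    using bv_op_alg[OF \<delta>] by auto
  show "restrict (bv_op \<delta>) (alg \<Delta>) (\<lambda>t. a t + b t) =
      (\<lambda>t. restrict (bv_op \<delta>) (alg \<Delta>) a t + restrict (bv_op \<delta>) (alg \<Delta>) b t)"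
    if "a \<in> alg \<Delta>" "b \<in> alg \<Delta>" for a b
    using that by (simp add: alg_add bv_op_add torus_differentiable_alg)
  show "restrict (bv_op \<delta>) (alg \<Delta>) (\<lambda>t. c *s a t) = (\<lambda>t. c *s restrict (bv_op \<delta>) (alg \<Delta>) a t)"
    if "a \<in> alg \<Delta>" for a c
    using that by (simp add: alg_scale bv_op_scale torus_differentiable_alg)
  show "restrict (bv_op \<delta>) (alg \<Delta>) ` alg_piece \<Delta> k \<subseteq> alg_piece \<Delta> (k - 1)" for k
    using bv_op_piece[OF \<delta>] alg_piece_subset_alg by auto
qed

lemma given_by_restrict_bv_op:
  assumes \<delta>: "\<And>I. I \<in> S_all \<Delta> \<Longrightarrow> \<delta> \<in> face_hat \<Delta> I"
  shows "given_by \<Delta> \<delta> (restrict (bv_op \<delta>) (alg \<Delta>))"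
  unfolding given_by_def
proof (intro conjI ballI degree_minus_one_restrict_bv_op[OF \<delta>])
  fix k I A assume "I \<in> S_upto \<Delta> k" "A \<in> weight_ext \<Delta> k I"
  moreover from this have "I \<in> S_all \<Delta>" by (simp add: S_upto_S_all)
  ultimately have "weight_field I A \<in> alg \<Delta>"
    using weight_field_in_alg_piece alg_piece_subset_alg weight_ext_eq[OF complete] by blast
  then show "restrict (bv_op \<delta>) (alg \<Delta>) (weight_field I A) =
      weight_field I (contract (\<delta> - cplx_of_lattice I) A)"
    by (simp add: bv_op_weight_field)
qed

text \<open>Linearity fixes the operator on the algebra, extensionality off it.\<close>

lemma given_by_eq_restrict:
  assumes "given_by \<Delta> \<delta> D"
  shows "D = restrict (bv_op \<delta>) (alg \<Delta>)"
proof
  fix f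
  have D: "degree_minus_one_operator \<Delta> D" using assms by (simp add: given_by_def)
  show "D f = restrict (bv_op \<delta>) (alg \<Delta>) f"
  proof (cases "f \<in> alg \<Delta>")
    case True
    have "D f = bv_op \<delta> f"
    proof (rule eq_bv_op[OF D _ True])
      fix k I M assume "1 \<le> k" "k \<le> CARD('n)" "I \<in> S_upto \<Delta> k" "M \<in> weight_ext \<Delta> k I"
      then show "D (weight_field I M) = bv_op \<delta> (weight_field I M)"
        using assms unfolding given_by_def bv_op_weight_field by simp
    qed
    then show ?thesis using True by simp
  next
    case False
    have "D \<in> alg \<Delta> \<rightarrow>\<^sub>E alg \<Delta>" using D by (simp add: degree_minus_one_operator_def)
    then have "D f = undefined" using False by (rule PiE_arb)
    then show ?thesis using False by simp
  qed
qed

lemma BV_operator_restrict_bv_op: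
  assumes \<delta>: "\<And>I. I \<in> S_all \<Delta> \<Longrightarrow> \<delta> \<in> face_hat \<Delta> I"
  shows "BV_operator \<Delta> (restrict (bv_op \<delta>) (alg \<Delta>))"
  unfolding BV_operator_def
proof (intro conjI allI ballI degree_minus_one_restrict_bv_op[OF \<delta>])
  show "schouten a b = (\<lambda>t. (- 1) powi k *s (restrict (bv_op \<delta>) (alg \<Delta>) (field_wedge a b) t -
      field_wedge (restrict (bv_op \<delta>) (alg \<Delta>) a) b t -
      (- 1) powi k *s field_wedge a (restrict (bv_op \<delta>) (alg \<Delta>) b) t))"
    if "a \<in> alg_piece \<Delta> k" "b \<in> alg_piece \<Delta> l" for a b k l
    using schouten_bv_op[OF that, of \<delta>] field_wedge_alg_piece[OF that] alg_piece_subset_alg that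
    by (metis (no_types, lifting) restrict_apply')
  show "restrict (bv_op \<delta>) (alg \<Delta>) (restrict (bv_op \<delta>) (alg \<Delta>) f) = (\<lambda>t. 0)" if "f \<in> alg \<Delta>" for f
    using that bv_op_alg[OF \<delta> that] by (simp add: bv_op_bv_op)
qed

section \<open>Invariant vector fields and constants\<close>

lemma zero_in_S_all: "0 \<in> S_all \<Delta>"
  by (simp add: S_all_ipair ipair_def)

lemma active_zero: "active \<Delta> 0 = {}"
  by (auto simp: active_ipair ipair_def)

lemma annihilated_0 [simp]: "A \<in> annihilated \<Delta> 0"
  by (simp add: annihilated_def active_zero)

lemma homog_ext_vector: "homog 1 (ext_vector x)"
  using homog_vec_wedge[of 0 "axis {} 1" x] homog_axis[of "{}"] by simp

lemma invariant_field_piece: "weight_field 0 (ext_vector x) \<in> alg_piece \<Delta> 1"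
  using weight_field_in_alg_piece[OF zero_in_S_all annihilated_0 homog_ext_vector] by simp

text \<open>With no active generator, integrality makes all pairings nonnegative. Expanding -I as a
  nonnegative combination of generators gives 0 \<le> - (I \<bullet> I).\<close>

lemma active_empty:
  assumes "I \<in> S_all \<Delta>" "active \<Delta> I = {}"
  shows "I = 0"
proof -
  let ?p = "real_of_lattice I"
  obtain B c where B: "B \<in> chart_bases \<Delta>" "\<And>j. 0 \<le> c j"
    "- ?p = (\<Sum>j\<in>UNIV. c j *\<^sub>R real_of_lattice (B $ j))"
    using nonneg_combination[OF complete, of "- ?p"] by blast
  have "0 \<le> ?p \<bullet> real_of_lattice (B $ j)" for j
  proof -
    have "B $ j \<in> gens \<Delta>" using chart_basis_row_in_gens[OF complete B(1)] .
    then have "- 1 \<le> ipair I (B $ j)" "ipair I (B $ j) \<noteq> - 1"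
      using assms by (auto simp: S_all_ipair active_ipair)
    then show ?thesis by (simp add: inner_ipair)
  qed
  then have "0 \<le> ?p \<bullet> (- ?p)"
    unfolding B(3) inner_sum_right inner_scaleR_right using B(2) by (intro sum_nonneg) auto
  then have "?p \<bullet> ?p \<le> 0" by simp
  then have "?p = 0" using inner_gt_zero_iff[of ?p] by linarith
  then show ?thesis by simp
qed

text \<open>A nonzero weight has an active generator, hence positive codimension, which leaves no
  room in degree 0. This is the constancy of global functions on a complete variety.\<close>

lemma alg_piece_0_constant:
  assumes "f \<in> alg_piece \<Delta> 0"
  obtains c where "f = weight_field 0 (c *s axis {} 1)"
proof -
  obtain M where M: "\<And>I. I \<in> S_all \<Delta> \<Longrightarrow> M I \<in> annihilated \<Delta> I"
    "\<And>I. I \<in> S_all \<Delta> \<Longrightarrow> homog (nat \<bar>0\<bar>) (M I)"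
    "f = (\<lambda>t. \<Sum>I\<in>S_all \<Delta>. weight_field I (M I) t)" by (rule alg_pieceE[OF assms]) (rule that, assumption+)
  have zero: "M I = 0" if I: "I \<in> S_all \<Delta>" "I \<noteq> 0" for I
  proof -
    obtain b where b: "b \<in> active \<Delta> I" using active_empty[OF I(1)] I(2) by auto
    then have "real_of_lattice b \<noteq> 0"
      using zero_notin_gens[OF complete, of b] by (simp add: active_def)
    then have "\<not> real_of_lattice ` active \<Delta> I \<subseteq> {0}" using b by auto
    then have "0 < dim (real_of_lattice ` active \<Delta> I)" by (metis dim_eq_0 gr0I)
    then show ?thesis using annihilated_low_codim[OF M(1,2)[OF I(1)]] by simp
  qed
  have "f t = weight_field 0 (M 0) t" for t
  proof -
    have "f t = (\<Sum>I\<in>{0}. weight_field I (M I) t)"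
      unfolding M(3) using zero zero_in_S_all finite_S_all[OF complete]
      by (intro sum.mono_neutral_right) auto
    then show ?thesis by simp
  qed
  moreover have "M 0 = M 0 $ {} *s axis {} 1"
    using M(2)[OF zero_in_S_all] by (intro homog_0_imp) simp
  ultimately show thesis by (intro that[of "M 0 $ {}"]) auto
qed

section \<open>From a BV operator to its vector \<delta>\<close>

context
  fixes D
  assumes BV: "BV_operator \<Delta> D"
begin

lemma degree_D: "degree_minus_one_operator \<Delta> D"
  using BV by (simp add: BV_operator_def)

lemma divergence_vector:
  obtains \<delta> where "\<And>x. D (weight_field 0 (ext_vector x)) = bv_op \<delta> (weight_field 0 (ext_vector x))"
proof -
  have "\<exists>c. D (weight_field 0 (ext_vector (axis i 1))) = weight_field 0 (c *s axis {} 1)" for i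
  proof -
    have "D (weight_field 0 (ext_vector (axis i 1))) \<in> alg_piece \<Delta> 0"
      using degree_minus_one_piece[OF degree_D invariant_field_piece] by simp
    then show ?thesis by (rule alg_piece_0_constant) (rule exI)
  qed
  then obtain c where c: "\<And>i. D (weight_field 0 (ext_vector (axis i 1))) = weight_field 0 (c i *s axis {} 1)"
    by metis
  define \<delta> where "\<delta> = (\<chi> i. c i)"
  have "D (weight_field 0 (ext_vector x)) = bv_op \<delta> (weight_field 0 (ext_vector x))" for x
  proof -
    let ?e = "\<lambda>i. weight_field 0 (ext_vector (axis i 1))"
    have alg: "?e i \<in> alg \<Delta>" for i using alg_piece_subset_alg[OF invariant_field_piece] .
    have "ext_vector x = (\<Sum>i\<in>UNIV. x $ i *s ext_vector (axis i 1))"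
      by (subst vector_expand[of x]) (simp add: ext_vector_sum)
    then have "weight_field 0 (ext_vector x) = (\<lambda>t. \<Sum>i\<in>UNIV. x $ i *s ?e i t)"
      by (simp add: fun_eq_iff weight_field_sum weight_field_scale)
    then have "D (weight_field 0 (ext_vector x)) = (\<lambda>t. \<Sum>i\<in>UNIV. x $ i *s weight_field 0 (c i *s axis {} 1) t)"
      using alg by (simp add: degree_minus_one_sum[OF degree_D] degree_minus_one_scale[OF degree_D] alg_scale c)
    also have "\<dots> = weight_field 0 (cdot \<delta> x *s axis {} 1)"
      by (simp add: fun_eq_iff weight_field_scale cdot_def \<delta>_def vec.scale_sum_left[symmetric] mult.commute)
    also have "\<dots> = bv_op \<delta> (weight_field 0 (ext_vector x))"
    proof -
      have "contract (\<delta> - cplx_of_lattice 0) (ext_vector x) = cdot \<delta> x *s axis {} 1"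
        using contract_vec_wedge[of \<delta> x "axis {} 1"] by (simp add: cplx_of_lattice_def zero_vec_def[symmetric])
      then show ?thesis by (simp add: bv_op_weight_field)
    qed
    finally show ?thesis .
  qed
  then show thesis by (rule that)
qed

lemma alg_off_torus: "f \<in> alg \<Delta> \<Longrightarrow> t \<notin> torus \<Longrightarrow> f t = 0"
  by (erule alg_weight_sum) simp

text \<open>
  The difference of two operators with the same bracket is a derivation of the wedge product up to
  sign; here it is one that vanishes on the invariant vector fields.
\<close>

context
  fixes \<delta>
  assumes \<delta>: "\<And>x. D (weight_field 0 (ext_vector x)) = bv_op \<delta> (weight_field 0 (ext_vector x))"
begin

lemma difference_derivation:
  assumes b: "b \<in> alg_piece \<Delta> l"
  shows "D (field_wedge (weight_field 0 (ext_vector x)) b) t -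
      bv_op \<delta> (field_wedge (weight_field 0 (ext_vector x)) b) t =
    - (weight_field 0 (ext_vector x) t \<and>\<^sub>e (D b t - bv_op \<delta> b t))"
proof -
  let ?a = "weight_field 0 (ext_vector x)"
  have "schouten ?a b = (\<lambda>t. (- 1) powi 1 *s (D (field_wedge ?a b) t - field_wedge (D ?a) b t -
      (- 1) powi 1 *s field_wedge ?a (D b) t))"
    using BV invariant_field_piece b unfolding BV_operator_def by blast
  then have "schouten ?a b t = - (D (field_wedge ?a b) t - field_wedge (bv_op \<delta> ?a) b t +
      ?a t \<and>\<^sub>e D b t)"
    by (simp add: \<delta> field_wedge_def vector_smult_lneg)
  moreover have "schouten ?a b t = - (bv_op \<delta> (field_wedge ?a b) t - field_wedge (bv_op \<delta> ?a) b t +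
      ?a t \<and>\<^sub>e bv_op \<delta> b t)"
    unfolding schouten_bv_op[OF invariant_field_piece[of x] b, where \<delta> = \<delta>]
    by (simp add: field_wedge_def vector_smult_lneg)
  ultimately show ?thesis
    by (simp add: wedge_diff_right algebra_simps)
qed

lemma D_top_weight_field:
  assumes I: "I \<in> S_all \<Delta>" and dual: "dual_lists \<alpha>s bs"
    and ann: "annihilated \<Delta> I = {A. \<forall>b\<in>set bs. ext_vector b \<and>\<^sub>e A = 0}"
  shows "D (weight_field I (wedge_list bs)) = bv_op \<delta> (weight_field I (wedge_list bs))"
proof
  fix t
  let ?w = "weight_field I (wedge_list bs)"
  have kill: "ext_vector b \<and>\<^sub>e wedge_list bs = 0" if "b \<in> set bs" for b
    using that by (intro vec_wedge_kill vec.span_base)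
  then have w: "?w \<in> alg_piece \<Delta> (int (length bs))"
    by (intro weight_field_in_alg_piece I homog_wedge_list) (simp add: ann)
  have Dw: "D ?w \<in> alg_piece \<Delta> (int (length bs) - 1)"
    using degree_minus_one_piece[OF degree_D w] .
  show "D ?w t = bv_op \<delta> ?w t"
  proof (cases "t \<in> torus \<and> bs \<noteq> []")
    case True
    then have t: "t \<in> torus" and len: "0 < length bs" by auto
    \<comment> \<open>The difference at \<open>t\<close>, carried back to the invariant frame: the
      vectors annihilating it are then those of \<open>bs\<close> themselves instead of their images
      in the tangent space.\<close>
    define \<eta> where "\<eta> = ext_map (diag_map (vinv t)) (D ?w t - bv_op \<delta> ?w t)"
    have "ext_vector x \<and>\<^sub>e \<eta> = 0" if x: "x \<in> set bs" for x
    proof -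
      have "field_wedge (weight_field 0 (ext_vector x)) ?w = (\<lambda>t. 0)"
        by (simp add: field_wedge_def wedge_weight_field kill[OF x])
      then have "weight_field 0 (ext_vector x) t \<and>\<^sub>e (D ?w t - bv_op \<delta> ?w t) = 0"
        using difference_derivation[OF w, of x t] by (simp add: degree_minus_one_zero[OF degree_D])
      moreover have "weight_field 0 (ext_vector x) t = ext_vector (diag_map t x)"
        using ext_map_vec_wedge[OF clinear_diag_map, of t x "axis {} 1"]
        by (simp add: weight_field_def rho_diag t)
      ultimately have "ext_map (diag_map (vinv t)) (ext_vector (diag_map t x) \<and>\<^sub>e (D ?w t - bv_op \<delta> ?w t)) = 0"
        by simp
      then show ?thesis
        by (simp add: ext_map_vec_wedge clinear_diag_map diag_map_vinv t \<eta>_def)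
    qed
    moreover have "homog (length bs - 1) \<eta>"
    proof -
      have "nat \<bar>int (length bs) - 1\<bar> = length bs - 1" using len by simp
      then have "homog (length bs - 1) (D ?w t)" using homog_alg_piece[OF Dw, of t] by simp
      moreover have "homog (length bs - 1) (bv_op \<delta> ?w t)"
        unfolding bv_op_weight_field by (intro homog_weight_field homog_contract homog_wedge_list)
      ultimately have "homog (length bs - 1) (D ?w t - bv_op \<delta> ?w t)"
        by (simp add: homog_def)
      then show ?thesis unfolding \<eta>_def by (rule homog_ext_map)
    qed
    ultimately have "\<eta> = 0" using annihilated_low_degree[OF dual, of \<eta> "length bs - 1"] len by simp
    then have "ext_map (diag_map t) \<eta> = 0" by simp
    then show ?thesis by (simp add: \<eta>_def ext_map_diag_vinv t)
  next
    case False
    show ?thesis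
    proof (cases "bs = []")
      case True
      then have "D ?w = (\<lambda>t. 0)" using Dw by (simp add: alg_piece_off)
      moreover have "bv_op \<delta> ?w = (\<lambda>t. 0)" using w True by (intro bv_op_degree_0) simp
      ultimately show ?thesis by simp
    next
      case nonempty: False
      then have "t \<notin> torus" using False by simp
      then show ?thesis
        using alg_off_torus[OF alg_piece_subset_alg[OF Dw]] by (simp add: bv_op_def)
    qed
  qed
qed

text \<open>Starting from the top form of the active span, invariant vector fields are wedged on one
  at a time; the difference of the operators, already 0, stays 0 by the derivation rule. Products of
  this kind span, by divisibility of annihilated forms.\<close>

lemma D_weight_field:
  assumes I: "I \<in> S_all \<Delta>" and M: "M \<in> annihilated \<Delta> I" "homog k M"
  shows "D (weight_field I M) = bv_op \<delta> (weight_field I M)"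
proof -
  obtain bs \<alpha>s where bs: "dual_lists \<alpha>s bs" "length bs = dim (real_of_lattice ` active \<Delta> I)"
    "complexify (face_perp \<Delta> I) = vec.span (set bs)"
    "annihilated \<Delta> I = {A. \<forall>b\<in>set bs. ext_vector b \<and>\<^sub>e A = 0}"
    "\<And>b. b \<in> active \<Delta> I \<Longrightarrow> cplx_of_lattice b \<in> vec.span (set bs)"
    by (rule annihilated_basis[of \<Delta> I]) (rule that, assumption+)
  have piece: "weight_field I (wedge_list (bs @ xs)) \<in> alg_piece \<Delta> (int (length (bs @ xs)))" for xs
  proof (intro weight_field_in_alg_piece I homog_wedge_list)
    show "wedge_list (bs @ xs) \<in> annihilated \<Delta> I"
      unfolding bs(4) by (auto intro!: vec_wedge_kill vec.span_base)
  qed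
  have list: "D (weight_field I (wedge_list (bs @ xs))) = bv_op \<delta> (weight_field I (wedge_list (bs @ xs)))" for xs
  proof (induction xs)
    case Nil
    show ?case using D_top_weight_field[OF I bs(1,4)] by simp
  next
    case (Cons x xs)
    let ?a = "weight_field 0 (ext_vector x)" and ?b = "weight_field I (wedge_list (bs @ xs))"
    \<comment> \<open>The derivation rule wants the new factor in front; moving it past
      \<open>bs\<close> costs the sign.\<close>
    have eq: "weight_field I (wedge_list (bs @ x # xs)) = (\<lambda>t. (- 1) ^ length bs *s field_wedge ?a ?b t)"
      by (simp add: fun_eq_iff wedge_list_append_Cons field_wedge_def wedge_weight_field weight_field_scale)
    have alg: "field_wedge ?a ?b \<in> alg \<Delta>" using field_wedge_alg_piece[OF invariant_field_piece piece] .
    have "D (field_wedge ?a ?b) = bv_op \<delta> (field_wedge ?a ?b)"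
      using difference_derivation[OF piece, of x xs] Cons.IH by (simp add: fun_eq_iff)
    then show ?case
      unfolding eq degree_minus_one_scale[OF degree_D alg] bv_op_scale[OF torus_differentiable_alg[OF alg]]
      by simp
  qed
  show ?thesis
  proof (cases "k < length bs")
    case True
    then have "M = 0" using annihilated_low_degree[OF bs(1), of M k] M by (simp add: bs(4))
    then have "weight_field I M = (\<lambda>t. 0)" by (simp add: fun_eq_iff)
    then show ?thesis by (simp add: degree_minus_one_zero[OF degree_D])
  next
    case False
    have "fold contract \<alpha>s M \<in> ext_power UNIV (k - length bs)"
      using homog_fold_contract[OF M(2), of \<alpha>s] bs(1) by (simp add: ext_power_UNIV dual_lists_def)
    then have "weight_field I (wedge_list bs \<and>\<^sub>e fold contract \<alpha>s M) \<in> alg \<Delta> \<and>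
      D (weight_field I (wedge_list bs \<and>\<^sub>e fold contract \<alpha>s M)) =
        bv_op \<delta> (weight_field I (wedge_list bs \<and>\<^sub>e fold contract \<alpha>s M))"
      unfolding ext_power_def
    proof (induction rule: vec.span_induct_alt)
      case base
      have "weight_field I (wedge_list bs \<and>\<^sub>e 0) = (\<lambda>t. 0)" by (simp add: fun_eq_iff)
      then show ?case by (simp add: alg_zero degree_minus_one_zero[OF degree_D])
    next
      case (step c Y Z)
      let ?Y = "weight_field I (wedge_list bs \<and>\<^sub>e Y)" and ?Z = "weight_field I (wedge_list bs \<and>\<^sub>e Z)"
      obtain xs where "Y = wedge_list xs" using step by blast
      then have Y: "?Y \<in> alg \<Delta>" "D ?Y = bv_op \<delta> ?Y"
        using alg_piece_subset_alg[OF piece[of xs]] list[of xs] by (simp_all add: wedge_list_append)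
      have eq: "weight_field I (wedge_list bs \<and>\<^sub>e (c *s Y + Z)) = (\<lambda>t. c *s ?Y t + ?Z t)"
        by (simp add: fun_eq_iff wedge_add_right weight_field_add weight_field_scale)
      have cY: "(\<lambda>t. c *s ?Y t) \<in> alg \<Delta>" using Y(1) by (rule alg_scale)
      have Z: "?Z \<in> alg \<Delta>" "D ?Z = bv_op \<delta> ?Z" using step by auto
      show ?case
        unfolding eq degree_minus_one_add[OF degree_D cY Z(1)] degree_minus_one_scale[OF degree_D Y(1)]
          bv_op_add[OF torus_differentiable_alg[OF cY] torus_differentiable_alg[OF Z(1)]]
          bv_op_scale[OF torus_differentiable_alg[OF Y(1)]]
        using alg_add[OF cY Z(1)] Y(2) Z(2) by simp
    qed
    moreover have "M = wedge_list bs \<and>\<^sub>e fold contract \<alpha>s M"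
      using M(1) by (intro divisible_by_wedge_list[OF bs(1)]) (simp add: bs(4))
    ultimately show ?thesis by simp
  qed
qed

text \<open>The value of the operator on the top form is holomorphic, so its coefficient is again
  annihilated by each active generator. The derivation rule turns this into the vanishing of a
  multiple of the nonzero top form, the factor being the pairing of \<delta> - I with the
  generator.\<close>

lemma divergence_in_face_hat:
  assumes I: "I \<in> S_all \<Delta>"
  shows "\<delta> \<in> face_hat \<Delta> I"
proof -
  obtain bs \<alpha>s where bs: "dual_lists \<alpha>s bs" "length bs = dim (real_of_lattice ` active \<Delta> I)"
    "complexify (face_perp \<Delta> I) = vec.span (set bs)"
    "annihilated \<Delta> I = {A. \<forall>b\<in>set bs. ext_vector b \<and>\<^sub>e A = 0}"
    "\<And>b. b \<in> active \<Delta> I \<Longrightarrow> cplx_of_lattice b \<in> vec.span (set bs)"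
    by (rule annihilated_basis[of \<Delta> I]) (rule that, assumption+)
  let ?\<omega> = "wedge_list bs" and ?\<alpha> = "\<delta> - cplx_of_lattice I"
  have \<omega>: "?\<omega> \<in> annihilated \<Delta> I"
    unfolding bs(4) by (auto intro!: vec_wedge_kill vec.span_base)
  have "D (weight_field I ?\<omega>) = weight_field I (contract ?\<alpha> ?\<omega>)"
    using D_weight_field[OF I \<omega> homog_wedge_list] by (simp add: bv_op_weight_field)
  moreover have "weight_field I ?\<omega> \<in> alg_piece \<Delta> (int (length bs))"
    by (intro weight_field_in_alg_piece I \<omega> homog_wedge_list)
  ultimately have piece: "weight_field I (contract ?\<alpha> ?\<omega>) \<in> alg_piece \<Delta> (int (length bs) - 1)"
    using degree_minus_one_piece[OF degree_D] by metis
  have "length bs \<le> CARD('n)"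
    using homog_gt[OF homog_wedge_list[of bs]] wedge_list_nonzero[OF bs(1)] by (meson not_le)
  have "contract ?\<alpha> ?\<omega> \<in> annihilated \<Delta> I"
  proof (cases "contract ?\<alpha> ?\<omega> = 0 \<or> bs = []")
    case True
    then show ?thesis by auto
  next
    case False
    then have "weight_field I (contract ?\<alpha> ?\<omega>) \<in> holo_fields \<Delta> (length bs - 1)"
      using piece \<open>length bs \<le> CARD('n)\<close> by (cases bs) (auto simp: alg_piece_def nat_diff_distrib)
    then show ?thesis
      using bounded_weight_field(2)[OF complete holo_bounded_field[OF complete]] False by blast
  qed
  have "cdot ?\<alpha> (cplx_of_lattice b) = 0" if b: "b \<in> active \<Delta> I" for b
  proof -
    have "ext_vector (cplx_of_lattice b) \<and>\<^sub>e ?\<omega> = 0"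
      "ext_vector (cplx_of_lattice b) \<and>\<^sub>e contract ?\<alpha> ?\<omega> = 0"
      using b \<omega> \<open>contract ?\<alpha> ?\<omega> \<in> annihilated \<Delta> I\<close> by (auto simp: annihilated_def)
    then have "cdot ?\<alpha> (cplx_of_lattice b) *s ?\<omega> = 0"
      using contract_vec_wedge[of ?\<alpha> "cplx_of_lattice b" ?\<omega>] by simp
    then show ?thesis using wedge_list_nonzero[OF bs(1)] by simp
  qed
  then show ?thesis by (simp add: face_hat_iff[OF complete I])
qed

lemma BV_operator_given_by: "given_by \<Delta> \<delta> D"
  unfolding given_by_def
proof (intro conjI ballI degree_D)
  fix k I A assume I: "I \<in> S_upto \<Delta> k" and A: "A \<in> weight_ext \<Delta> k I"
  have "I \<in> S_all \<Delta>" using I by (rule S_upto_S_all)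
  with A have "A \<in> annihilated \<Delta> I" "homog k A" using weight_ext_eq[OF complete] by blast+
  with \<open>I \<in> S_all \<Delta>\<close> show "D (weight_field I A) = weight_field I (contract (\<delta> - cplx_of_lattice I) A)"
    using D_weight_field by (simp add: bv_op_weight_field)
qed

end

end

end

theorem theorem3p7:
  fixes \<Delta> :: "(real ^ 'n::{finite,linorder}) set set"
  assumes "smooth_complete_fan \<Delta>"
  shows "((\<exists>D. BV_operator \<Delta> D) \<longleftrightarrow> (\<Inter>I\<in>S_all \<Delta>. face_hat \<Delta> I) \<noteq> {}) \<and>
         (\<forall>\<delta>\<in>(\<Inter>I\<in>S_all \<Delta>. face_hat \<Delta> I).
            (\<exists>!D. given_by \<Delta> \<delta> D) \<and> (\<forall>D. given_by \<Delta> \<delta> D \<longrightarrow> BV_operator \<Delta> D)) \<and>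
         (\<forall>D. BV_operator \<Delta> D \<longrightarrow>
            (\<exists>\<delta>\<in>(\<Inter>I\<in>S_all \<Delta>. face_hat \<Delta> I). given_by \<Delta> \<delta> D))"
proof -
  let ?F = "\<Inter>I\<in>S_all \<Delta>. face_hat \<Delta> I"
  \<comment> \<open>Covers both halves of well-definedness: the prescribed values extend to an
    operator, and they determine it.\<close>
  have unique: "given_by \<Delta> \<delta> D \<longleftrightarrow> D = restrict (bv_op \<delta>) (alg \<Delta>)" if "\<delta> \<in> ?F" for \<delta> D
    using given_by_eq_restrict[OF assms] given_by_restrict_bv_op[OF assms, of \<delta>] that by blast
  have BV: "BV_operator \<Delta> (restrict (bv_op \<delta>) (alg \<Delta>))" if "\<delta> \<in> ?F" for \<delta>
    using BV_operator_restrict_bv_op[OF assms, of \<delta>] that by blast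
  have given: "\<exists>\<delta>\<in>?F. given_by \<Delta> \<delta> D" if D: "BV_operator \<Delta> D" for D
  proof -
    obtain \<delta> where \<delta>: "\<And>x. D (weight_field 0 (ext_vector x)) = bv_op \<delta> (weight_field 0 (ext_vector x))"
      using divergence_vector[OF assms D] by blast
    show ?thesis
      using divergence_in_face_hat[OF assms D \<delta>] BV_operator_given_by[OF assms D \<delta>] by blast
  qed
  have "(\<exists>D. BV_operator \<Delta> D) \<longleftrightarrow> ?F \<noteq> {}"
  proof
    assume "\<exists>D. BV_operator \<Delta> D"
    then show "?F \<noteq> {}" using given by (metis empty_iff)
  next
    assume "?F \<noteq> {}"
    then obtain \<delta> where "\<delta> \<in> ?F" by (meson ex_in_conv)
    then show "\<exists>D. BV_operator \<Delta> D" using BV by (intro exI)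
  qed
  moreover have "(\<exists>!D. given_by \<Delta> \<delta> D) \<and> (\<forall>D. given_by \<Delta> \<delta> D \<longrightarrow> BV_operator \<Delta> D)"
    if "\<delta> \<in> ?F" for \<delta>
    using BV[OF that] by (simp add: unique[OF that])
  ultimately show ?thesis using given by (intro conjI ballI allI impI) simp_all
qed

end
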